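(* Let $G$ and $H$ be compact Lie groups acting continuously on metrizable spaces $X$ and $Y$ respectively, and let $\psi\ltimes\epsilon\colon G\ltimes X\to H\ltimes Y$ be an essential equivalence. Let $\mathcal A$ be a class of $G$-invariant subsets of $X$, and let $\mathcal A'=\{A'\mid A\in\mathcal A\}$, where $A'\subseteq Y$ denotes the saturation of $\epsilon(A)$ under the $H$-action (the union of all $H$-orbits meeting $\epsilon(A)$). Then $${}_{\mathcal A}\mathrm{cat}_G(X)={}_{\mathcal A'}\mathrm{cat}_H(Y).$$
   Context: For a topological group $G$ acting on a space $X$, the translation groupoid $G\ltimes X$ has object space $X$ and arrow space $G\times X$, with source $s(g,x)=x$ and target $t(g,x)=gx$. An equivariant map $\psi\ltimes\epsilon\colon G\ltimes X\to H\ltimes Y$ is a pair consisting of a continuous homomorphism $\psi\colon G\to H$ and a continuous map $\epsilon\colon X\to Y$ with $\epsilon(gx)=\psi(g)\epsilon(x)$ for all $g\in G,x\in X$. It is an essential equivalence if (1) the map $X\times H\to Y$, $(x,h)\mapsto h\epsilon(x)$, is an open surjection, and (2) the map $\lambda\colon G\times X\to P$, $\lambda(g,x)=(\psi(g),\epsilon(x),x,gx)$, is a homeomorphism, where $P=\{((h,y),(x,x'))\in (H\times Y)\times(X\times X)\mid y=\epsilon(x),\ hy=\epsilon(x')\}$ is the pullback of $(p_2,t)\colon H\times Y\to Y\times Y$ along $\epsilon\times\epsilon\colon X\times X\to Y\times Y$. For a $G$-space $X$, a $G$-invariant subset $U\subseteq X$ is $G$-compressible into a subset $A\subseteq X$ if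 the inclusion $U\hookrightarrow X$ is $G$-homotopic (through $G$-equivariant maps $U\times I\to X$) to a $G$-map $c\colon U\to X$ with $c(U)\subseteq A$. For a class $\mathcal A$ of $G$-invariant subsets of $X$, the equivariant $\mathcal A$-category ${}_{\mathcal A}\mathrm{cat}_G(X)$ is the least integer $k$ such that $X$ is covered by $k$ $G$-invariant open sets $U_1,\dots,U_k$, each $G$-compressible into some $A_i\in\mathcal A$ (or $\infty$ if no such cover exists). *)

theory Defs
  imports "HOL-Analysis.Analysis" "HOL-Algebra.Group"
begin

fun iter_dd :: "'a::real_normed_vector list \<Rightarrow> ('a \<Rightarrow> 'b::real_normed_vector) \<Rightarrow> 'a \<Rightarrow> 'b" where
  "iter_dd [] f = f"
| "iter_dd (v # vs) f = (\<lambda>x. frechet_derivative (iter_dd vs f) (at x) v)"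

definition smooth_on :: "'a::euclidean_space set \<Rightarrow> ('a \<Rightarrow> 'b::euclidean_space) \<Rightarrow> bool" where
  "smooth_on S f \<longleftrightarrow> open S \<and> (\<forall>vs. iter_dd vs f differentiable_on S)"

definition is_chart :: "'a topology \<Rightarrow> 'a set \<Rightarrow> ('a \<Rightarrow> 'n::euclidean_space) \<Rightarrow> bool" where
  "is_chart T U \<phi> \<longleftrightarrow> openin T U \<and> open (\<phi> ` U) \<and>
      homeomorphic_map (subtopology T U) (top_of_set (\<phi> ` U)) \<phi>"

definition smooth_atlas :: "'a topology \<Rightarrow> ('a set \<times> ('a \<Rightarrow> 'n::euclidean_space)) set \<Rightarrow> bool" where
  "smooth_atlas T A \<longleftrightarrow>
     (\<forall>(U, \<phi>) \<in> A. is_chart T U \<phi>) \<and>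
     (\<Union>(U, \<phi>) \<in> A. U) = topspace T \<and>
     (\<forall>(U, \<phi>) \<in> A. \<forall>(V, \<psi>) \<in> A. smooth_on (\<phi> ` (U \<inter> V)) (\<psi> \<circ> inv_into U \<phi>))"

definition smooth_manifold :: "'a topology \<Rightarrow> ('a set \<times> ('a \<Rightarrow> 'n::euclidean_space)) set \<Rightarrow> bool" where
  "smooth_manifold T A \<longleftrightarrow> Hausdorff_space T \<and> second_countable T \<and> smooth_atlas T A"

definition topological_group :: "('g, 'm) monoid_scheme \<Rightarrow> 'g topology \<Rightarrow> bool" where
  "topological_group G T \<longleftrightarrow> group G \<and> topspace T = carrier G \<and>
     continuous_map (prod_topology T T) T (\<lambda>(a, b). a \<otimes>\<^bsub>G\<^esub> b) \<and>
     continuous_map T T (\<lambda>a. inv\<^bsub>G\<^esub> a)"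

text \<open>Lie group of positive dimension DIM('n): multiplication and inversion smooth
  in charts (product charts on G x G).\<close>
definition lie_group_atlas :: "('g, 'm) monoid_scheme \<Rightarrow> 'g topology \<Rightarrow> ('g set \<times> ('g \<Rightarrow> 'n::euclidean_space)) set \<Rightarrow> bool" where
  "lie_group_atlas G T A \<longleftrightarrow> topological_group G T \<and> smooth_manifold T A \<and>
     (\<forall>(U, \<phi>) \<in> A. \<forall>(U', \<phi>') \<in> A. \<forall>(V, \<psi>) \<in> A.
        smooth_on ((\<lambda>(a, b). (\<phi> a, \<phi>' b)) ` ((U \<times> U') \<inter> {(a, b). a \<otimes>\<^bsub>G\<^esub> b \<in> V}))
                  (\<lambda>(z, z'). \<psi> (inv_into U \<phi> z \<otimes>\<^bsub>G\<^esub> inv_into U' \<phi>' z'))) \<and>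
     (\<forall>(U, \<phi>) \<in> A. \<forall>(V, \<psi>) \<in> A.
        smooth_on (\<phi> ` (U \<inter> {a. inv\<^bsub>G\<^esub> a \<in> V})) (\<lambda>z. \<psi> (inv\<^bsub>G\<^esub> (inv_into U \<phi> z))))"

text \<open>Compact Lie group: either of dimension 0 (a finite discrete group) or a Lie group
  modelled on the Euclidean space 'n (the type parameter fixes the dimension).\<close>
definition compact_lie_group :: "('g, 'm) monoid_scheme \<Rightarrow> 'g topology \<Rightarrow> 'n::euclidean_space itself \<Rightarrow> bool" where
  "compact_lie_group G T _ \<longleftrightarrow> topological_group G T \<and> compact_space T \<and>
     ((finite (carrier G) \<and> T = discrete_topology (carrier G)) \<or>
      (\<exists>A :: ('g set \<times> ('g \<Rightarrow> 'n)) set. lie_group_atlas G T A))"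

definition continuous_action :: "('g, 'm) monoid_scheme \<Rightarrow> 'g topology \<Rightarrow> 'x topology \<Rightarrow> ('g \<Rightarrow> 'x \<Rightarrow> 'x) \<Rightarrow> bool" where
  "continuous_action G TG TX act \<longleftrightarrow> topological_group G TG \<and>
     continuous_map (prod_topology TG TX) TX (\<lambda>(g, x). act g x) \<and>
     (\<forall>x \<in> topspace TX. act \<one>\<^bsub>G\<^esub> x = x) \<and>
     (\<forall>g \<in> carrier G. \<forall>h \<in> carrier G. \<forall>x \<in> topspace TX.
        act (g \<otimes>\<^bsub>G\<^esub> h) x = act g (act h x))"

definition equivariant_map ::
  "('g, 'm) monoid_scheme \<Rightarrow> 'g topology \<Rightarrow> 'x topology \<Rightarrow> ('g \<Rightarrow> 'x \<Rightarrow> 'x) \<Rightarrow>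
   ('h, 'n) monoid_scheme \<Rightarrow> 'h topology \<Rightarrow> 'y topology \<Rightarrow> ('h \<Rightarrow> 'y \<Rightarrow> 'y) \<Rightarrow>
   ('g \<Rightarrow> 'h) \<Rightarrow> ('x \<Rightarrow> 'y) \<Rightarrow> bool" where
  "equivariant_map G TG TX actG H TH TY actH \<psi> \<epsilon> \<longleftrightarrow>
     \<psi> \<in> hom G H \<and> continuous_map TG TH \<psi> \<and> continuous_map TX TY \<epsilon> \<and>
     (\<forall>g \<in> carrier G. \<forall>x \<in> topspace TX. \<epsilon> (actG g x) = actH (\<psi> g) (\<epsilon> x))"

definition essential_equivalence ::
  "('g, 'm) monoid_scheme \<Rightarrow> 'g topology \<Rightarrow> 'x topology \<Rightarrow> ('g \<Rightarrow> 'x \<Rightarrow> 'x) \<Rightarrow>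
   ('h, 'n) monoid_scheme \<Rightarrow> 'h topology \<Rightarrow> 'y topology \<Rightarrow> ('h \<Rightarrow> 'y \<Rightarrow> 'y) \<Rightarrow>
   ('g \<Rightarrow> 'h) \<Rightarrow> ('x \<Rightarrow> 'y) \<Rightarrow> bool" where
  "essential_equivalence G TG TX actG H TH TY actH \<psi> \<epsilon> \<longleftrightarrow>
     equivariant_map G TG TX actG H TH TY actH \<psi> \<epsilon> \<and>
     open_map (prod_topology TX TH) TY (\<lambda>(x, h). actH h (\<epsilon> x)) \<and>
     (\<lambda>(x, h). actH h (\<epsilon> x)) ` topspace (prod_topology TX TH) = topspace TY \<and>
     homeomorphic_map (prod_topology TG TX)
       (subtopology (prod_topology (prod_topology TH TY) (prod_topology TX TX))
          {((h, y), (x, x')). y = \<epsilon> x \<and> actH h y = \<epsilon> x'})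
       (\<lambda>(g, x). ((\<psi> g, \<epsilon> x), (x, actG g x)))"

definition invariant_set :: "('g, 'm) monoid_scheme \<Rightarrow> ('g \<Rightarrow> 'x \<Rightarrow> 'x) \<Rightarrow> 'x set \<Rightarrow> bool" where
  "invariant_set G act U \<longleftrightarrow> (\<forall>g \<in> carrier G. \<forall>u \<in> U. act g u \<in> U)"

definition compressible ::
  "('g, 'm) monoid_scheme \<Rightarrow> 'x topology \<Rightarrow> ('g \<Rightarrow> 'x \<Rightarrow> 'x) \<Rightarrow> 'x set \<Rightarrow> 'x set \<Rightarrow> bool" where
  "compressible G TX act U A \<longleftrightarrow>
     (\<exists>c. homotopic_with (\<lambda>k. \<forall>g \<in> carrier G. \<forall>u \<in> U. k (act g u) = act g (k u))
            (subtopology TX U) TX id c \<and> c ` U \<subseteq> A)"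

definition good_cover ::
  "('g, 'm) monoid_scheme \<Rightarrow> 'x topology \<Rightarrow> ('g \<Rightarrow> 'x \<Rightarrow> 'x) \<Rightarrow> 'x set set \<Rightarrow> nat \<Rightarrow> bool" where
  "good_cover G TX act \<A> k \<longleftrightarrow>
     (\<exists>Us :: nat \<Rightarrow> 'x set.
        (\<forall>i < k. openin TX (Us i) \<and> invariant_set G act (Us i) \<and>
                 (\<exists>A \<in> \<A>. compressible G TX act (Us i) A)) \<and>
        (\<Union>i < k. Us i) = topspace TX)"

definition equivariant_cat ::
  "('g, 'm) monoid_scheme \<Rightarrow> 'x topology \<Rightarrow> ('g \<Rightarrow> 'x \<Rightarrow> 'x) \<Rightarrow> 'x set set \<Rightarrow> enat" where
  "equivariant_cat G TX act \<A> =
     (if \<exists>k. good_cover G TX act \<A> k then enat (LEAST k. good_cover G TX act \<A> k) else \<infinity>)"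

definition saturation :: "('h, 'n) monoid_scheme \<Rightarrow> ('h \<Rightarrow> 'y \<Rightarrow> 'y) \<Rightarrow> ('x \<Rightarrow> 'y) \<Rightarrow> 'x set \<Rightarrow> 'y set" where
  "saturation H act \<epsilon> A = {act h (\<epsilon> a) | h a. h \<in> carrier H \<and> a \<in> A}"

end

theory Submission
  imports Defs
begin

text \<open>
  Write \<open>q(x, h) = h \<epsilon>(x)\<close> for the open surjection \<open>X \<times> H \<rightarrow> Y\<close>. By the second condition on an
  essential equivalence, its fibres are the orbits of the free action
  \<open>g (x, h) = (g x, h \<psi>(g)\<^sup>-\<^sup>1)\<close> of \<open>G\<close>. A \<open>G\<close>-homotopy on \<open>U \<subseteq> X\<close> therefore descends along
  \<open>q\<close> to an \<open>H\<close>-homotopy on the saturation of \<open>\<epsilon>(U)\<close>. Conversely, an \<open>H\<close>-homotopy \<open>\<Phi>\<close> on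
  \<open>V \<subseteq> Y\<close> pulls back to a \<open>G\<close>-homotopy on \<open>\<epsilon>\<^sup>-\<^sup>1(V)\<close> once \<open>q\<close> is known to lift homotopies in a way
  compatible with the actions of \<open>G\<close> and \<open>H\<close> on \<open>X \<times> H\<close>.

  The lifting uses no slices and no Haar measure. On a compact Lie group there is a
  bi-invariant continuous function \<open>N\<close> which, near the diagonal, is strictly quasiconvex in its
  first argument: the supremum over all conjugates of the distance to the identity in a chart,
  whose squares are uniformly convex near the identity. Given \<open>z, w \<in> X \<times> H\<close> with nearby orbits,
  the function \<open>g \<mapsto> max\<^sub>k a(z, k w) N(g, k)\<close>, with a weight \<open>a\<close> concentrated on the points of
  \<open>G w\<close> close to \<open>z\<close>, has a unique minimiser. This gives a continuous transport of \<open>z\<close> into the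
  orbit of \<open>w\<close> which commutes with all symmetries preserving an invariant metric. A path in \<open>Y\<close> is
  lifted by transporting along steps whose length depends continuously on the starting point.
\<close>

section \<open>Suprema and infima over compact spaces\<close>

text \<open>The obstacle is equivariance of the lift. A lift of a homotopy is far from unique, yet
  it must commute with \<open>x \<mapsto> g x\<close>, which on \<open>X \<times> H\<close> becomes
  left multiplication by \<open>\<psi> g\<close> on \<open>H\<close> followed by the free action of
  \<open>g\<close>. So every choice has to be canonical: the transport is built only from data
  preserved by these symmetries, and the minimiser has to be unique rather than selected. Maxima
  replace averages, and strict quasiconvexity is the form of convexity that survives weighted
  maxima, provided that one midpoint serves all functions at once. In a chart, halving a segment
  gains a term quadratic in its length, with a factor inversely proportional to the distance from
  the centre; the curvature of the chart expression loses a fixed multiple of the same square. The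
  gain wins near the identity, and this is the origin of the constant
  \<open>\<epsilon> ^ 3 / 8\<close>. Compactness of the group makes \<open>\<epsilon>\<close>
  uniform over all conjugations. The spaces \<open>X\<close> and \<open>Y\<close> are not compact,
  hence step lengths that vary with the starting point.\<close>

lemma continuous_map_binary:
  assumes "continuous_map (prod_topology A B) C (\<lambda>(x, y). f x y)"
    and "continuous_map X A a" and "continuous_map X B b"
  shows "continuous_map X C (\<lambda>x. f (a x) (b x))"
  using continuous_map_compose[OF continuous_map_pairedI[OF assms(2,3)] assms(1)]
  by (simp add: o_def)

lemma open_map_prod_map:
  assumes "open_map A A' f" and "open_map B B' g"
  shows "open_map (prod_topology A B) (prod_topology A' B') (\<lambda>(x, y). (f x, g y))"
  unfolding open_map_def
proof (intro allI impI)
  fix U assume U: "openin (prod_topology A B) U"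
  show "openin (prod_topology A' B') ((\<lambda>(x, y). (f x, g y)) ` U)"
    unfolding openin_prod_topology_alt
  proof (intro allI impI)
    fix x' y' assume "(x', y') \<in> (\<lambda>(x, y). (f x, g y)) ` U"
    then obtain x y where xy: "(x, y) \<in> U" "x' = f x" "y' = g y" by auto
    obtain V W where VW: "openin A V" "openin B W" "x \<in> V" "y \<in> W" "V \<times> W \<subseteq> U"
      using U xy(1) unfolding openin_prod_topology_alt by meson
    have "f ` V \<times> g ` W \<subseteq> (\<lambda>(x, y). (f x, g y)) ` U"
      using VW(5) by auto
    moreover have "openin A' (f ` V)" "openin B' (g ` W)"
      using assms VW by (auto simp: open_map_def)
    ultimately show "\<exists>V W. openin A' V \<and> openin B' W \<and> x' \<in> V \<and> y' \<in> W \<and>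
        V \<times> W \<subseteq> (\<lambda>(x, y). (f x, g y)) ` U"
      using xy VW by blast
  qed
qed

lemma open_map_id: "open_map X X (\<lambda>x. x)"
  by (simp add: open_map_def)

text \<open>An open continuous surjection is a quotient map. In the applications \<open>g\<close> is
  defined by choosing preimages, and its continuity is read off upstairs.\<close>

lemma continuous_map_descend:
  assumes "continuous_map TZ TY q" and "open_map TZ TY q" and "q ` topspace TZ = topspace TY"
    and "continuous_map TZ TW f" and "\<And>z. z \<in> topspace TZ \<Longrightarrow> g (q z) = f z"
  shows "continuous_map TY TW g"
proof -
  have "quotient_map TZ TY q"
    using assms continuous_open_imp_quotient_map by blast
  moreover have "continuous_map TZ TW (g \<circ> q)"
    using assms(4) by (rule continuous_map_eq) (simp add: assms(5))
  ultimately show ?thesis by (rule continuous_compose_quotient_map)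
qed

lemma compact_INF_attained:
  fixes f :: "'k \<Rightarrow> real"
  assumes "compact_space K" and "topspace K \<noteq> {}" and "continuous_map K euclideanreal f"
  shows "\<exists>k\<in>topspace K. (INF j\<in>topspace K. f j) = f k \<and> (\<forall>j\<in>topspace K. f k \<le> f j)"
proof -
  have "compact (f ` topspace K)"
    using image_compactin[of K "topspace K" euclideanreal f] assms
    by (simp add: compact_space_def)
  then obtain k where k: "k \<in> topspace K" "\<forall>j\<in>topspace K. f k \<le> f j"
    using compact_attains_inf[of "f ` topspace K"] assms(2) by auto
  have "(INF j\<in>topspace K. f j) = f k"
    by (rule cInf_eq_minimum) (use k in auto)
  then show ?thesis using k by blast
qed

text \<open>Superlevel sets are intersections of closed slices. Sublevel sets are projections of
  closed sets, because minima are attained, and the projection along a compact factor is a closed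
  map.\<close>

lemma continuous_map_INF:
  fixes f :: "'p \<Rightarrow> 'k \<Rightarrow> real"
  assumes K: "compact_space K" "topspace K \<noteq> {}"
    and f: "continuous_map (prod_topology P K) euclideanreal (\<lambda>(p, k). f p k)"
  shows "continuous_map P euclideanreal (\<lambda>p. INF k\<in>topspace K. f p k)"
proof -
  let ?m = "\<lambda>p. INF k\<in>topspace K. f p k"
  have att: "\<exists>k\<in>topspace K. ?m p = f p k \<and> (\<forall>j\<in>topspace K. f p k \<le> f p j)"
    if "p \<in> topspace P" for p
    by (rule compact_INF_attained[OF K])
      (rule continuous_map_binary[OF f], use that in auto)
  have sl: "continuous_map P euclideanreal (\<lambda>p. f p k)" if "k \<in> topspace K" for k
    by (rule continuous_map_binary[OF f]) (use that in auto)
  show ?thesis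
    unfolding continuous_map_upper_lower_semicontinuous_le
  proof (intro conjI allI)
    fix a
    have "{p \<in> topspace P. ?m p \<ge> a} = (\<Inter>k\<in>topspace K. {p \<in> topspace P. f p k \<ge> a})"
    proof (rule Set.set_eqI, rule iffI)
      fix p assume "p \<in> {p \<in> topspace P. ?m p \<ge> a}"
      then show "p \<in> (\<Inter>k\<in>topspace K. {p \<in> topspace P. f p k \<ge> a})"
        using att[of p] by fastforce
    next
      fix p assume p: "p \<in> (\<Inter>k\<in>topspace K. {p \<in> topspace P. f p k \<ge> a})"
      then have "p \<in> topspace P" using K(2) by blast
      then obtain k where "k \<in> topspace K" "?m p = f p k" using att by blast
      then show "p \<in> {p \<in> topspace P. ?m p \<ge> a}"
        using p by simp
    qed
    moreover have "closedin P {p \<in> topspace P. f p k \<ge> a}" if "k \<in> topspace K" for k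
      using sl[OF that] unfolding continuous_map_upper_lower_semicontinuous_le by blast
    ultimately show "closedin P {p \<in> topspace P. ?m p \<ge> a}"
      using K(2) by auto
    have "{p \<in> topspace P. ?m p \<le> a} =
        fst ` {x \<in> topspace (prod_topology P K). (\<lambda>(p, k). f p k) x \<le> a}"
    proof (rule Set.set_eqI, rule iffI)
      fix p assume p: "p \<in> {p \<in> topspace P. ?m p \<le> a}"
      then obtain k where "k \<in> topspace K" "f p k \<le> a" using att[of p] by force
      then show "p \<in> fst ` {x \<in> topspace (prod_topology P K). (\<lambda>(p, k). f p k) x \<le> a}"
        using p by force
    next
      fix p assume "p \<in> fst ` {x \<in> topspace (prod_topology P K). (\<lambda>(p, k). f p k) x \<le> a}"
      then obtain k where "p \<in> topspace P" "k \<in> topspace K" "f p k \<le> a" by auto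
      then show "p \<in> {p \<in> topspace P. ?m p \<le> a}"
        using att[of p] by fastforce
    qed
    moreover have "closedin (prod_topology P K)
        {x \<in> topspace (prod_topology P K). (\<lambda>(p, k). f p k) x \<le> a}"
      using f unfolding continuous_map_upper_lower_semicontinuous_le by blast
    then have "closedin P (fst ` {x \<in> topspace (prod_topology P K). (\<lambda>(p, k). f p k) x \<le> a})"
      using closed_map_fst[OF K(1), of P] unfolding closed_map_def by blast
    ultimately show "closedin P {p \<in> topspace P. ?m p \<le> a}"
      by (simp only:)
  qed
qed

lemma compact_SUP_attained:
  fixes f :: "'k \<Rightarrow> real"
  assumes "compact_space K" and "topspace K \<noteq> {}" and "continuous_map K euclideanreal f"
  shows "\<exists>k\<in>topspace K. (SUP j\<in>topspace K. f j) = f k \<and> (\<forall>j\<in>topspace K. f j \<le> f k)"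
proof -
  obtain k where k: "k \<in> topspace K" "\<forall>j\<in>topspace K. - f k \<le> - f j"
    using compact_INF_attained[OF assms(1,2), of "\<lambda>x. - f x"] assms(3)
    by (auto intro: continuous_map_minus)
  have "(SUP j\<in>topspace K. f j) = f k"
    by (rule cSup_eq_maximum) (use k in auto)
  then show ?thesis using k by auto
qed

lemma compact_SUP_upper:
  fixes f :: "'k \<Rightarrow> real"
  assumes "compact_space K" and "continuous_map K euclideanreal f" and "k \<in> topspace K"
  shows "f k \<le> (SUP j\<in>topspace K. f j)"
  using compact_SUP_attained[OF assms(1) _ assms(2)] assms(3) by fastforce

lemma compact_INF_lower:
  fixes f :: "'k \<Rightarrow> real"
  assumes "compact_space K" and "continuous_map K euclideanreal f" and "k \<in> topspace K"
  shows "(INF j\<in>topspace K. f j) \<le> f k"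
  using compact_INF_attained[OF assms(1) _ assms(2)] assms(3) by fastforce

lemma continuous_map_SUP:
  fixes f :: "'p \<Rightarrow> 'k \<Rightarrow> real"
  assumes K: "compact_space K" "topspace K \<noteq> {}"
    and f: "continuous_map (prod_topology P K) euclideanreal (\<lambda>(p, k). f p k)"
  shows "continuous_map P euclideanreal (\<lambda>p. SUP k\<in>topspace K. f p k)"
proof -
  have f': "continuous_map (prod_topology P K) euclideanreal (\<lambda>(p, k). - f p k)"
    using continuous_map_minus[OF f] by (simp add: case_prod_unfold)
  have "continuous_map P euclideanreal (\<lambda>p. - (INF k\<in>topspace K. - f p k))"
    by (intro continuous_map_minus continuous_map_INF[OF K f'])
  moreover have "- (INF k\<in>topspace K. - f p k) = (SUP k\<in>topspace K. f p k)" for p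
    by (simp add: Inf_real_def image_image)
  ultimately show ?thesis by simp
qed

text \<open>The minimiser lies in a nonempty closed set \<open>C\<close> iff the minimum over
  \<open>C\<close> equals the minimum over \<open>K\<close>. Both minima depend continuously on
  \<open>p\<close>, so this is a closed condition.\<close>

lemma continuous_map_unique_argmin:
  fixes f :: "'p \<Rightarrow> 'k \<Rightarrow> real"
  assumes K: "compact_space K"
    and f: "continuous_map (prod_topology P K) euclideanreal (\<lambda>(p, k). f p k)"
    and g: "\<And>p. p \<in> topspace P \<Longrightarrow> g p \<in> topspace K"
    and less: "\<And>p k. p \<in> topspace P \<Longrightarrow> k \<in> topspace K \<Longrightarrow> k \<noteq> g p \<Longrightarrow> f p (g p) < f p k"
  shows "continuous_map P K g"
  unfolding continuous_map_closedin
proof (intro conjI ballI allI impI)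
  show "g \<in> topspace P \<rightarrow> topspace K" using g by blast
next
  fix C assume C: "closedin K C"
  show "closedin P {x \<in> topspace P. g x \<in> C}"
  proof (cases "C = {}")
    case False
    have CK: "C \<subseteq> topspace K" using C closedin_subset by blast
    have KC: "compact_space (subtopology K C)" "topspace (subtopology K C) = C"
      using C K closedin_compact_space compact_space_subtopology CK by auto
    have fC: "continuous_map (prod_topology P (subtopology K C)) euclideanreal (\<lambda>(p, k). f p k)"
      using continuous_map_from_subtopology[OF f, of "topspace P \<times> C"]
        prod_topology_subtopology(2)[of P K C]
      by (simp add: f continuous_map_from_subtopology prod_topology_subtopology(2))
    have m1: "continuous_map P euclideanreal (\<lambda>p. INF k\<in>C. f p k)"
      using continuous_map_INF[OF KC(1) _ fC] KC(2) False by simp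
    have m2: "continuous_map P euclideanreal (\<lambda>p. INF k\<in>topspace K. f p k)"
      using continuous_map_INF[OF K _ f] False CK by (metis subset_empty)
    have "{x \<in> topspace P. g x \<in> C} =
        {p \<in> topspace P. (INF k\<in>C. f p k) - (INF k\<in>topspace K. f p k) \<le> 0}"
    proof (intro Collect_cong conj_cong refl)
      fix p assume p: "p \<in> topspace P"
      have "(INF k\<in>topspace K. f p k) = f p (g p)"
        by (rule cInf_eq_minimum) (use g[OF p] less[OF p] in \<open>force+\<close>)
      moreover obtain k where k: "k \<in> C" "(INF k\<in>C. f p k) = f p k" "\<forall>j\<in>C. f p k \<le> f p j"
        using compact_INF_attained[OF KC(1), of "f p"] KC(2) False
          continuous_map_binary[OF fC, of _ "\<lambda>_. p" "\<lambda>x. x"] p by auto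
      ultimately show "(g p \<in> C) = ((INF k\<in>C. f p k) - (INF k\<in>topspace K. f p k) \<le> 0)"
        using less[OF p, of k] CK by (metis diff_le_0_iff_le in_mono not_less)
    qed
    moreover have "closedin P {p \<in> topspace P. (INF k\<in>C. f p k) - (INF k\<in>topspace K. f p k) \<le> 0}"
      using continuous_map_diff[OF m1 m2]
      unfolding continuous_map_upper_lower_semicontinuous_le by blast
    ultimately show ?thesis by simp
  qed simp
qed

section \<open>Homotopy lifting by transport\<close>

text \<open>Positivity of \<open>\<beta> z w\<close> says that the fibre of \<open>w\<close> is
  close enough to \<open>z\<close> for \<open>z\<close> to be moved into it. The last conclusion
  quantifies over \<open>b\<close> after \<open>F\<close> is fixed: a single lift respects every
  symmetry of the transport that carries the path over \<open>p\<close> to the path over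
  \<open>p'\<close>.\<close>

lemma homotopy_lifting_by_transport:
  fixes \<beta> :: "'z \<Rightarrow> 'z \<Rightarrow> real" and T :: "'z \<Rightarrow> 'z \<Rightarrow> 'z"
  assumes q: "continuous_map TZ TY q" "open_map TZ TY q" "q ` topspace TZ = topspace TY"
    and beta: "continuous_map (prod_topology TZ TZ) euclideanreal (\<lambda>(z, w). \<beta> z w)"
    and beta_nonneg: "\<And>z w. \<lbrakk>z \<in> topspace TZ; w \<in> topspace TZ\<rbrakk> \<Longrightarrow> 0 \<le> \<beta> z w"
    and beta_diag: "\<And>z. z \<in> topspace TZ \<Longrightarrow> 0 < \<beta> z z"
    and beta_fib: "\<And>z w z' w'. \<lbrakk>z \<in> topspace TZ; w \<in> topspace TZ; z' \<in> topspace TZ; w' \<in> topspace TZ;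
        q z = q z'; q w = q w'\<rbrakk> \<Longrightarrow> \<beta> z w = \<beta> z' w'"
    and T: "continuous_map (subtopology (prod_topology TZ TZ) {(z, w). 0 < \<beta> z w}) TZ (\<lambda>(z, w). T z w)"
    and T_over: "\<And>z w. \<lbrakk>z \<in> topspace TZ; w \<in> topspace TZ; 0 < \<beta> z w\<rbrakk> \<Longrightarrow> q (T z w) = q w"
    and T_fib: "\<And>z w w'. \<lbrakk>z \<in> topspace TZ; w \<in> topspace TZ; w' \<in> topspace TZ;
        q w = q w'; 0 < \<beta> z w\<rbrakk> \<Longrightarrow> T z w = T z w'"
    and T_diag: "\<And>z. z \<in> topspace TZ \<Longrightarrow> T z z = z"
    and \<Phi>: "continuous_map (prod_topology (top_of_set {0..1::real}) P) TY \<Phi>"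
    and f0: "continuous_map P TZ f0" "\<And>p. p \<in> topspace P \<Longrightarrow> q (f0 p) = \<Phi> (0, p)"
  obtains F where
    "continuous_map (prod_topology (top_of_set {0..1}) P) TZ F"
    "\<And>t p. \<lbrakk>t \<in> {0..1}; p \<in> topspace P\<rbrakk> \<Longrightarrow> q (F (t, p)) = \<Phi> (t, p)"
    "\<And>p. p \<in> topspace P \<Longrightarrow> F (0, p) = f0 p"
    "\<forall>b. \<forall>p\<in>topspace P. \<forall>p'\<in>topspace P.
       (\<forall>z\<in>topspace TZ. b z \<in> topspace TZ) \<longrightarrow>
       (\<forall>z\<in>topspace TZ. \<forall>w\<in>topspace TZ. \<beta> (b z) (b w) = \<beta> z w) \<longrightarrow>
       (\<forall>z\<in>topspace TZ. \<forall>w\<in>topspace TZ. 0 < \<beta> z w \<longrightarrow> T (b z) (b w) = b (T z w)) \<longrightarrow>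
       (\<forall>s\<in>{0..1}. \<forall>z\<in>topspace TZ. q z = \<Phi> (s, p) \<longrightarrow> q (b z) = \<Phi> (s, p')) \<longrightarrow>
       f0 p' = b (f0 p) \<longrightarrow> (\<forall>t\<in>{0..1}. F (t, p') = b (F (t, p)))"
proof -
  let ?I = "top_of_set {0..1::real}"
  \<comment> \<open>An arbitrary, possibly discontinuous section. The fibre conditions make
    \<open>\<beta>'\<close> and \<open>T'\<close> independent of it, and their continuity comes from
    descent along \<open>q\<close>.\<close>
  define sec where "sec = inv_into (topspace TZ) q"
  have sec: "sec y \<in> topspace TZ" "q (sec y) = y" if "y \<in> topspace TY" for y
    using that q(3) by (auto simp: sec_def inv_into_into f_inv_into_f)
  have qY: "q z \<in> topspace TY" if "z \<in> topspace TZ" for z using q(3) that by blast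
  define \<beta>' where "\<beta>' y y' = \<beta> (sec y) (sec y')" for y y'
  define T' where "T' z y = T z (sec y)" for z y
  have beta'_q: "\<beta>' (q z) (q w) = \<beta> z w" if "z \<in> topspace TZ" "w \<in> topspace TZ" for z w
    unfolding \<beta>'_def by (rule beta_fib) (use that sec qY in auto)
  have T'_q: "T' z (q w) = T z w" if "z \<in> topspace TZ" "w \<in> topspace TZ" "0 < \<beta> z w" for z w
    unfolding T'_def by (rule T_fib[symmetric]) (use that sec qY in auto)
  have beta'_cont: "continuous_map (prod_topology TY TY) euclideanreal (\<lambda>(y, y'). \<beta>' y y')"
  proof (rule continuous_map_descend[where f = "\<lambda>(z, w). \<beta> z w"])
    show "continuous_map (prod_topology TZ TZ) (prod_topology TY TY) (\<lambda>(z, w). (q z, q w))"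
      using q(1) by (simp add: continuous_map_prod_top)
    show "open_map (prod_topology TZ TZ) (prod_topology TY TY) (\<lambda>(z, w). (q z, q w))"
      by (intro open_map_prod_map q(2))
    show "(\<lambda>(z, w). (q z, q w)) ` topspace (prod_topology TZ TZ) = topspace (prod_topology TY TY)"
      using q(3) by (simp add: image_paired_Times)
  qed (use beta beta'_q in auto)
  let ?D = "{(z, y). 0 < \<beta>' (q z) y}"
  have T'_cont: "continuous_map (subtopology (prod_topology TZ TY) ?D) TZ (\<lambda>(z, y). T' z y)"
  proof (rule continuous_map_descend[where f = "\<lambda>(z, w). T z w"])
    let ?q = "\<lambda>(z, w). (z, q w)"
    let ?E = "subtopology (prod_topology TZ TZ) {(z, w). 0 < \<beta> z w}"
    \<comment> \<open>An open map stays open when restricted to the full preimage of a set; here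
      \<open>topspace ?E\<close> is the full preimage of \<open>?D\<close>.\<close>
    have pre: "{x \<in> topspace (prod_topology TZ TZ). ?q x \<in> ?D} = topspace ?E"
      using beta'_q by auto
    have Eeq: "subtopology (prod_topology TZ TZ) (topspace ?E) = ?E"
      by (metis subtopology_restrict topspace_subtopology)
    have c: "continuous_map (prod_topology TZ TZ) (prod_topology TZ TY) ?q"
      using q(1) by (simp add: continuous_map_prod_top)
    show "continuous_map ?E (subtopology (prod_topology TZ TY) ?D) ?q"
      unfolding continuous_map_in_subtopology
      using continuous_map_from_subtopology[OF c] beta'_q by auto
    show "open_map ?E (subtopology (prod_topology TZ TY) ?D) ?q"
      using open_map_restriction[OF open_map_prod_map[OF open_map_id q(2)], of TZ ?D "topspace ?E"]
        pre Eeq by simp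
    show "?q ` topspace ?E = topspace (subtopology (prod_topology TZ TY) ?D)"
    proof (rule Set.set_eqI, rule iffI)
      fix x assume "x \<in> topspace (subtopology (prod_topology TZ TY) ?D)"
      then obtain z y where x: "x = (z, y)" "z \<in> topspace TZ" "y \<in> topspace TY" "0 < \<beta>' (q z) y"
        by auto
      then have "(z, sec y) \<in> topspace ?E" "x = ?q (z, sec y)"
        using sec[of y] beta'_q[of z "sec y"] by auto
      then show "x \<in> ?q ` topspace ?E" by blast
    qed (use qY beta'_q in auto)
    show "continuous_map ?E TZ (\<lambda>(z, w). T z w)" by (rule T)
  qed (use T'_q in auto)
  have T'_in: "T' z y \<in> topspace TZ" if "z \<in> topspace TZ" "y \<in> topspace TY" "0 < \<beta>' (q z) y" for z y
    using continuous_map_image_subset_topspace[OF T'_cont] that by force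
  have T'_over: "q (T' z y) = y" if "z \<in> topspace TZ" "y \<in> topspace TY" "0 < \<beta>' (q z) y" for z y
    using T_over[of z "sec y"] that sec[of y] beta'_q[of z "sec y"] by (simp add: T'_def)
  have T'_diag: "T' z (q z) = z" if "z \<in> topspace TZ" for z
    using T'_q[of z z] that beta_diag T_diag by simp
  have PhiY: "\<Phi> (t, p) \<in> topspace TY" if "t \<in> {0..1}" "p \<in> topspace P" for t p
    using continuous_map_image_subset_topspace[OF \<Phi>] that by force
  let ?II = "prod_topology ?I ?I"
  \<comment> \<open>Both terms are nonnegative and never vanish together, since
    \<open>\<beta>'\<close> is positive on the diagonal. Hence the minimum \<open>\<delta> p\<close>
    is positive, and two times less than \<open>\<delta> p\<close> apart are joined by a positive
    \<open>\<beta>'\<close>.\<close>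
  define d where "d p s = \<bar>fst s - snd s\<bar> + \<beta>' (\<Phi> (fst s, p)) (\<Phi> (snd s, p))" for p s
  define \<delta> where "\<delta> p = (INF s\<in>topspace ?II. d p s)" for p
  have II: "compact_space ?II" "topspace ?II \<noteq> {}"
    using compact_space_prod_topology[of ?I ?I] by (auto simp: compact_space_subtopology)
  have Phi_c: "continuous_map X TY (\<lambda>x. \<Phi> (a x, c x))"
    if "continuous_map X ?I a" "continuous_map X P c" for X :: "'x topology" and a c
    using continuous_map_compose[OF continuous_map_pairedI[OF that] \<Phi>] by (simp add: o_def)
  have I_real: "continuous_map X euclideanreal a" if "continuous_map X ?I a" for X :: "'x topology" and a
    using that by (simp add: continuous_map_in_subtopology)
  have d_cont: "continuous_map (prod_topology P ?II) euclideanreal (\<lambda>(p, s). d p s)"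
  proof -
    have 1: "continuous_map (prod_topology P ?II) ?I (\<lambda>x. fst (snd x))"
       "continuous_map (prod_topology P ?II) ?I (\<lambda>x. snd (snd x))"
      using continuous_map_compose[OF continuous_map_snd[of P ?II] continuous_map_fst]
       continuous_map_compose[OF continuous_map_snd[of P ?II] continuous_map_snd]
      by (simp_all add: o_def)
    have "continuous_map (prod_topology P ?II) euclideanreal
      (\<lambda>x. \<bar>fst (snd x) - snd (snd x)\<bar> + \<beta>' (\<Phi> (fst (snd x), fst x)) (\<Phi> (snd (snd x), fst x)))"
      by (intro continuous_map_add continuous_map_real_abs continuous_map_diff I_real 1
          continuous_map_binary[OF beta'_cont] Phi_c continuous_map_fst)
    then show ?thesis by (simp add: d_def case_prod_unfold)
  qed
  have \<delta>_cont: "continuous_map P euclideanreal \<delta>"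
    unfolding \<delta>_def by (rule continuous_map_INF[OF II d_cont])
  have d_cont1: "continuous_map ?II euclideanreal (d p)" if "p \<in> topspace P" for p
    using continuous_map_binary[OF d_cont, of ?II "\<lambda>_. p" "\<lambda>x. x"] that by simp
  have beta'_nonneg: "0 \<le> \<beta>' y y'" if "y \<in> topspace TY" "y' \<in> topspace TY" for y y'
    using sec that by (auto simp: \<beta>'_def intro: beta_nonneg)
  have \<delta>_pos: "0 < \<delta> p" if p: "p \<in> topspace P" for p
  proof -
    obtain s where s: "s \<in> topspace ?II" "\<delta> p = d p s"
      using compact_INF_attained[OF II d_cont1[OF p]] by (auto simp: \<delta>_def)
    have nn: "0 \<le> \<beta>' (\<Phi> (fst s, p)) (\<Phi> (snd s, p))"
      using s p by (auto intro!: beta'_nonneg PhiY)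
    show ?thesis
    proof (cases "fst s = snd s")
      case True
      have "0 < \<beta>' (\<Phi> (fst s, p)) (\<Phi> (fst s, p))"
        unfolding \<beta>'_def using s p by (auto intro!: beta_diag sec PhiY)
      then show ?thesis using s(2) True by (simp add: d_def)
    qed (use s(2) nn in \<open>simp add: d_def\<close>)
  qed
  have near: "0 < \<beta>' (\<Phi> (t, p)) (\<Phi> (t', p))"
    if "p \<in> topspace P" "t \<in> {0..1}" "t' \<in> {0..1}" "\<bar>t - t'\<bar> < \<delta> p" for p t t'
    using compact_INF_lower[OF II(1) d_cont1[OF that(1)], of "(t, t')"] that
    by (auto simp: \<delta>_def d_def)
  \<comment> \<open>Half of the admissible length keeps the bound strict; the cap at
    \<open>t\<close> makes the process stationary once \<open>t\<close> is reached.\<close>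
  define step where "step n t p = min t (real n * \<delta> p / 2)" for n t p
  have step01: "step n t p \<in> {0..1}" if "t \<in> {0..1}" "p \<in> topspace P" for n t p
    using that \<delta>_pos[OF that(2)] by (auto simp: step_def min_def)
  have step_near: "\<bar>step n t p - step (Suc n) t p\<bar> < \<delta> p" if "p \<in> topspace P" for n t p
    using \<delta>_pos[OF that] by (auto simp: step_def min_def field_simps)
  let ?IP = "prod_topology ?I P"
  have step_cont: "continuous_map ?IP ?I (\<lambda>x. step n (fst x) (snd x))" for n
  proof -
    have "continuous_map ?IP euclideanreal (\<lambda>x. \<delta> (snd x))"
      using continuous_map_compose[OF continuous_map_snd \<delta>_cont] by (simp add: o_def)
    then have "continuous_map ?IP euclideanreal (\<lambda>x. min (fst x) (real n * \<delta> (snd x) / 2))"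
      by (intro continuous_map_real_min continuous_map_real_divide continuous_map_real_mult)
        (auto intro: I_real continuous_map_fst)
    then show ?thesis
      unfolding continuous_map_in_subtopology using step01 by (auto simp: step_def)
  qed
  define L where "L = rec_nat (\<lambda>(t, p). f0 p) (\<lambda>n l (t, p). T' (l (t, p)) (\<Phi> (step (Suc n) t p, p)))"
  have L0: "L 0 (t, p) = f0 p" and LS: "L (Suc n) (t, p) = T' (L n (t, p)) (\<Phi> (step (Suc n) t p, p))" for n t p
    by (simp_all add: L_def)
  have L: "continuous_map ?IP TZ (L n) \<and> (\<forall>t\<in>{0..1}. \<forall>p\<in>topspace P. q (L n (t, p)) = \<Phi> (step n t p, p))" for n
  proof (induction n)
    case 0
    have "continuous_map ?IP TZ (\<lambda>x. f0 (snd x))"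
      using continuous_map_compose[OF continuous_map_snd f0(1)] by (simp add: o_def)
    moreover have "L 0 = (\<lambda>x. f0 (snd x))" using L0 by auto
    moreover have "step 0 t p = 0" if "t \<in> {0..1}" for t p using that by (simp add: step_def)
    ultimately show ?case using f0(2) by simp
  next
    case (Suc n)
    have Ln: "L n (t, p) \<in> topspace TZ" if "t \<in> {0..1}" "p \<in> topspace P" for t p
      using continuous_map_image_subset_topspace[OF conjunct1[OF Suc]] that by force
    have pos: "0 < \<beta>' (q (L n (t, p))) (\<Phi> (step (Suc n) t p, p))" if "t \<in> {0..1}" "p \<in> topspace P" for t p
      using Suc near step01 step_near that by simp
    have "continuous_map ?IP (subtopology (prod_topology TZ TY) ?D)
        (\<lambda>x. (L n x, \<Phi> (step (Suc n) (fst x) (snd x), snd x)))"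
      unfolding continuous_map_in_subtopology
    proof
      show "continuous_map ?IP (prod_topology TZ TY) (\<lambda>x. (L n x, \<Phi> (step (Suc n) (fst x) (snd x), snd x)))"
        by (intro continuous_map_pairedI Phi_c step_cont continuous_map_snd conjunct1[OF Suc])
    qed (use pos in auto)
    from continuous_map_compose[OF this T'_cont]
    have "continuous_map ?IP TZ (\<lambda>x. T' (L n x) (\<Phi> (step (Suc n) (fst x) (snd x), snd x)))"
      by (simp add: o_def)
    moreover have "L (Suc n) = (\<lambda>x. T' (L n x) (\<Phi> (step (Suc n) (fst x) (snd x), snd x)))"
      using LS by auto
    ultimately show ?case
      using T'_over pos Ln PhiY step01 LS by simp
  qed
  have L_in: "L n (t, p) \<in> topspace TZ" if "t \<in> {0..1}" "p \<in> topspace P" for n t p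
    using continuous_map_image_subset_topspace[OF conjunct1[OF L]] that by force
  \<comment> \<open>After the cap is reached, each further transport goes into the fibre already
    occupied, where \<open>T'_diag\<close> makes it trivial.\<close>
  have L_stab: "L (n + k) (t, p) = L n (t, p)"
    if "t \<in> {0..1}" "p \<in> topspace P" "2 \<le> real n * \<delta> p" for n k t p
  proof (induction k)
    case (Suc k)
    have "step m t p = t" if "n \<le> m" for m
    proof -
      have "real n * \<delta> p \<le> real m * \<delta> p"
        using that \<delta>_pos[OF \<open>p \<in> topspace P\<close>] by (intro mult_right_mono) auto
      then have "2 \<le> real m * \<delta> p" using \<open>2 \<le> real n * \<delta> p\<close> by linarith
      then show ?thesis using \<open>t \<in> {0..1}\<close> by (simp add: step_def)
    qed
    then have "step (Suc (n + k)) t p = t" "step (n + k) t p = t" by simp_all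
    moreover have "q (L (n + k) (t, p)) = \<Phi> (step (n + k) t p, p)"
      using L[of "n + k"] that by blast
    ultimately show ?case
      using LS[of "n + k" t p] T'_diag[OF L_in[OF that(1,2), of "n + k"]] Suc by simp
  qed simp
  \<comment> \<open>The ceiling jumps with \<open>p\<close>, but by \<open>L_stab\<close> more steps
    give the same value. So \<open>F\<close> agrees with \<open>L n\<close> on the open set where
    \<open>2 < real n * \<delta> p\<close>, and these sets cover.\<close>
  define F where "F x = L (nat \<lceil>2 / \<delta> (snd x)\<rceil>) x" for x
  have F_eq: "F (t, p) = L n (t, p)" if "t \<in> {0..1}" "p \<in> topspace P" "2 \<le> real n * \<delta> p" for n t p
  proof -
    let ?m = "nat \<lceil>2 / \<delta> p\<rceil>"
    have "2 / \<delta> p \<le> real n" using that \<delta>_pos[OF that(2)] by (simp add: field_simps)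
    then have "?m \<le> n" by linarith
    moreover have "2 / \<delta> p \<le> real ?m" by linarith
    then have "2 \<le> real ?m * \<delta> p" using \<delta>_pos[OF that(2)] by (simp only: pos_divide_le_eq)
    ultimately show ?thesis
      using L_stab[of t p ?m "n - ?m"] that by (simp add: F_def)
  qed
  have F_ex: "\<exists>n. 2 < real n * \<delta> p" if "p \<in> topspace P" for p
    using reals_Archimedean3[OF \<delta>_pos[OF that]] by blast
  show thesis
  proof
    show "continuous_map ?IP TZ F"
    proof (rule pasting_lemma[where I = UNIV and T = "\<lambda>n. {x \<in> topspace ?IP. 2 < real n * \<delta> (snd x)}" and f = L])
      fix n :: nat
      have "continuous_map ?IP euclideanreal (\<lambda>x. real n * \<delta> (snd x))"
        using continuous_map_compose[OF continuous_map_snd \<delta>_cont]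
        by (intro continuous_map_real_mult) (auto simp: o_def)
      then show "openin ?IP {x \<in> topspace ?IP. 2 < real n * \<delta> (snd x)}"
        unfolding continuous_map_upper_lower_semicontinuous_lt by blast
    next
      fix i j x
      assume "x \<in> topspace ?IP \<inter> {x \<in> topspace ?IP. 2 < real i * \<delta> (snd x)} \<inter>
        {x \<in> topspace ?IP. 2 < real j * \<delta> (snd x)}"
      then show "L i x = L j x"
        using F_eq[of "fst x" "snd x" i] F_eq[of "fst x" "snd x" j] by auto
    next
      fix x assume x: "x \<in> topspace ?IP"
      then obtain n where "2 < real n * \<delta> (snd x)" using F_ex[of "snd x"] by auto
      then show "\<exists>j. j \<in> UNIV \<and> x \<in> {x \<in> topspace ?IP. 2 < real j * \<delta> (snd x)} \<and> F x = L j x"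
        using x F_eq[of "fst x" "snd x" n] by auto
    qed (use L continuous_map_from_subtopology in blast)
  next
    fix t p assume tp: "t \<in> {0..1::real}" "p \<in> topspace P"
    then obtain n where n: "2 < real n * \<delta> p" using F_ex by blast
    then show "q (F (t, p)) = \<Phi> (t, p)"
      using F_eq[of t p n] L[of n] tp by (auto simp: step_def min_def)
  next
    fix p assume p: "p \<in> topspace P"
    have "L n (0, p) = f0 p" for n
    proof (induction n)
      case (Suc n)
      have "step (Suc n) 0 p = 0" using \<delta>_pos[OF p] by (simp add: step_def)
      then show ?case
        using Suc LS[of n 0 p] f0(2)[OF p] T'_diag[of "f0 p"] f0(1) p
          continuous_map_image_subset_topspace[OF f0(1)] by auto
    qed (simp add: L0)
    then show "F (0, p) = f0 p" by (simp add: F_def)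
  next
    show "\<forall>b. \<forall>p\<in>topspace P. \<forall>p'\<in>topspace P.
       (\<forall>z\<in>topspace TZ. b z \<in> topspace TZ) \<longrightarrow>
       (\<forall>z\<in>topspace TZ. \<forall>w\<in>topspace TZ. \<beta> (b z) (b w) = \<beta> z w) \<longrightarrow>
       (\<forall>z\<in>topspace TZ. \<forall>w\<in>topspace TZ. 0 < \<beta> z w \<longrightarrow> T (b z) (b w) = b (T z w)) \<longrightarrow>
       (\<forall>s\<in>{0..1}. \<forall>z\<in>topspace TZ. q z = \<Phi> (s, p) \<longrightarrow> q (b z) = \<Phi> (s, p')) \<longrightarrow>
       f0 p' = b (f0 p) \<longrightarrow> (\<forall>t\<in>{0..1}. F (t, p') = b (F (t, p)))"
    proof (intro allI ballI impI)
      fix p p' b and t :: real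
      assume p: "p \<in> topspace P" "p' \<in> topspace P" and t: "t \<in> {0..1}"
        and b': "\<forall>z\<in>topspace TZ. b z \<in> topspace TZ"
          "\<forall>z\<in>topspace TZ. \<forall>w\<in>topspace TZ. \<beta> (b z) (b w) = \<beta> z w"
          "\<forall>z\<in>topspace TZ. \<forall>w\<in>topspace TZ. 0 < \<beta> z w \<longrightarrow> T (b z) (b w) = b (T z w)"
          "\<forall>s\<in>{0..1}. \<forall>z\<in>topspace TZ. q z = \<Phi> (s, p) \<longrightarrow> q (b z) = \<Phi> (s, p')"
          "f0 p' = b (f0 p)"
      note b = b'[rule_format]
      have sec_p: "\<Phi> (s, p') = q (b (sec (\<Phi> (s, p))))" if "s \<in> {0..1}" for s
        using b(4)[of s "sec (\<Phi> (s, p))"] sec[OF PhiY[OF that p(1)]] that by simp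
      \<comment> \<open>The symmetry gives both paths the same step lengths, so the two lifts can be
        compared one transport at a time.\<close>
      have "d p' s = d p s" if "s \<in> topspace ?II" for s
      proof -
        have "\<beta>' (\<Phi> (fst s, p')) (\<Phi> (snd s, p')) = \<beta>' (\<Phi> (fst s, p)) (\<Phi> (snd s, p))"
        proof -
          let ?z = "sec (\<Phi> (fst s, p))" and ?w = "sec (\<Phi> (snd s, p))"
          have s: "fst s \<in> {0..1}" "snd s \<in> {0..1}" using that by auto
          then have zw: "?z \<in> topspace TZ" "?w \<in> topspace TZ"
            using sec PhiY p by auto
          have "\<beta>' (\<Phi> (fst s, p')) (\<Phi> (snd s, p')) = \<beta>' (q (b ?z)) (q (b ?w))"
            using sec_p s by simp
          also have "\<dots> = \<beta> ?z ?w" using zw b(1,2) beta'_q by simp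
          finally show ?thesis by (simp add: \<beta>'_def)
        qed
        then show ?thesis by (simp add: d_def)
      qed
      then have \<delta>: "\<delta> p' = \<delta> p" by (simp add: \<delta>_def)
      have "L n (t, p') = b (L n (t, p))" for n
      proof (induction n)
        case (Suc n)
        let ?s = "step (Suc n) t p"
        let ?w = "sec (\<Phi> (?s, p))"
        have s: "?s \<in> {0..1}" and w: "?w \<in> topspace TZ" "q ?w = \<Phi> (?s, p)"
          using step01 t p sec PhiY by auto
        have pos: "0 < \<beta> (L n (t, p)) ?w"
          using near[OF p(1) step01[OF t p(1), of n] s step_near[OF p(1)]]
            beta'_q[OF L_in[OF t p(1), of n] w(1)] L[of n] t p(1) w(2) by auto
        have "L (Suc n) (t, p') = T' (b (L n (t, p))) (q (b ?w))"
          using LS[of n t p'] Suc sec_p[OF s] \<delta> by (simp add: step_def)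
        also have "\<dots> = T (b (L n (t, p))) (b ?w)"
          using T'_q b(1,2) L_in t p w pos by simp
        also have "\<dots> = b (T (L n (t, p)) ?w)"
          using b(3) L_in t p w pos by simp
        also have "\<dots> = b (L (Suc n) (t, p))"
          using LS[of n t p] by (simp add: T'_def)
        finally show ?case .
      qed (simp add: L0 b(5))
      then show "F (t, p') = b (F (t, p))" by (simp add: F_def \<delta>)
    qed
  qed
qed

section \<open>Smooth maps and midpoints\<close>

lemma midpoint_in_convex:
  fixes C :: "'a::real_normed_vector set"
  assumes "convex C" and "u \<in> C" and "v \<in> C"
  shows "midpoint u v \<in> C"
  using convexD[OF assms, of "1/2" "1/2"]
  by (simp add: midpoint_def scaleR_right_distrib inverse_eq_divide)

text \<open>A substitute for bounded second derivatives that passes to compositions without a chain rule.\<close>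

definition jensen_lipschitz ::
    "real \<Rightarrow> 'a::real_normed_vector set \<Rightarrow> ('a \<Rightarrow> 'b::real_normed_vector) \<Rightarrow> bool" where
  "jensen_lipschitz L S f \<longleftrightarrow> (\<forall>x\<in>S. \<forall>y\<in>S. norm (f x - f y) \<le> L * norm (x - y) \<and>
     norm (f (midpoint x y) - midpoint (f x) (f y)) \<le> L * (norm (x - y))\<^sup>2)"

lemma jensen_lipschitzD:
  assumes "jensen_lipschitz L S f" and "x \<in> S" and "y \<in> S"
  shows "norm (f x - f y) \<le> L * norm (x - y)"
    and "norm (f (midpoint x y) - midpoint (f x) (f y)) \<le> L * (norm (x - y))\<^sup>2"
  using assms by (auto simp: jensen_lipschitz_def)

lemma jensen_lipschitz_mono:
  assumes "jensen_lipschitz L S f" and "T \<subseteq> S" and "L \<le> M"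
  shows "jensen_lipschitz M T f"
  unfolding jensen_lipschitz_def
proof (intro ballI conjI)
  fix x y assume "x \<in> T" "y \<in> T"
  then have xy: "x \<in> S" "y \<in> S" using assms(2) by auto
  show "norm (f x - f y) \<le> M * norm (x - y)"
    using jensen_lipschitzD(1)[OF assms(1) xy] mult_right_mono[OF assms(3) norm_ge_zero[of "x - y"]]
    by linarith
  show "norm (f (midpoint x y) - midpoint (f x) (f y)) \<le> M * (norm (x - y))\<^sup>2"
    using jensen_lipschitzD(2)[OF assms(1) xy] mult_right_mono[OF assms(3), of "(norm (x - y))\<^sup>2"]
    by simp
qed

lemma jensen_lipschitz_cong:
  assumes "jensen_lipschitz L S f" and "convex S" and "\<And>x. x \<in> S \<Longrightarrow> f x = g x"
  shows "jensen_lipschitz L S g"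
  using assms midpoint_in_convex[OF assms(2)] unfolding jensen_lipschitz_def by simp

text \<open>Insert \<open>g (midpoint (f x) (f y))\<close>: one difference is the midpoint error of
  \<open>f\<close> magnified by the Lipschitz constant of \<open>g\<close>, the other is the
  midpoint error of \<open>g\<close> on a segment of length at most
  \<open>L * norm (x - y)\<close>.\<close>

lemma jensen_lipschitz_compose:
  assumes f: "jensen_lipschitz L S f" and g: "jensen_lipschitz M T g"
    and "f ` S \<subseteq> T" and "convex S" and T: "convex T" and L: "0 \<le> L" and M: "0 \<le> M"
  shows "jensen_lipschitz (M * L + M * L\<^sup>2) S (g \<circ> f)"
  unfolding jensen_lipschitz_def
proof (intro ballI conjI)
  fix x y assume x: "x \<in> S" and y: "y \<in> S"
  have fxy: "f x \<in> T" "f y \<in> T" using assms(3) x y by auto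
  have fl: "norm (f x - f y) \<le> L * norm (x - y)" by (rule jensen_lipschitzD(1)[OF f x y])
  have "norm (g (f x) - g (f y)) \<le> M * norm (f x - f y)"
    by (rule jensen_lipschitzD(1)[OF g fxy])
  also have "\<dots> \<le> M * (L * norm (x - y))" by (rule mult_left_mono[OF fl M])
  also have "\<dots> \<le> (M * L + M * L\<^sup>2) * norm (x - y)"
    using M by (simp add: algebra_simps)
  finally show "norm ((g \<circ> f) x - (g \<circ> f) y) \<le> (M * L + M * L\<^sup>2) * norm (x - y)" by simp
  have "norm (g (f (midpoint x y)) - g (midpoint (f x) (f y))) \<le>
      M * norm (f (midpoint x y) - midpoint (f x) (f y))"
    by (rule jensen_lipschitzD(1)[OF g _ midpoint_in_convex[OF T fxy]])
      (use assms(3) midpoint_in_convex[OF assms(4) x y] in auto)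
  also have "\<dots> \<le> M * (L * (norm (x - y))\<^sup>2)"
    by (rule mult_left_mono[OF jensen_lipschitzD(2)[OF f x y] M])
  finally have 1: "norm (g (f (midpoint x y)) - g (midpoint (f x) (f y))) \<le> M * (L * (norm (x - y))\<^sup>2)" .
  have "norm (g (midpoint (f x) (f y)) - midpoint (g (f x)) (g (f y))) \<le> M * (norm (f x - f y))\<^sup>2"
    by (rule jensen_lipschitzD(2)[OF g fxy])
  also have "\<dots> \<le> M * (L * norm (x - y))\<^sup>2"
    by (intro mult_left_mono power_mono fl M) simp
  finally have 2: "norm (g (midpoint (f x) (f y)) - midpoint (g (f x)) (g (f y))) \<le> M * (L * norm (x - y))\<^sup>2" .
  have "norm (g (f (midpoint x y)) - midpoint (g (f x)) (g (f y))) \<le>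
      norm (g (f (midpoint x y)) - g (midpoint (f x) (f y))) +
      norm (g (midpoint (f x) (f y)) - midpoint (g (f x)) (g (f y)))"
    using norm_triangle_ineq[of "g (f (midpoint x y)) - g (midpoint (f x) (f y))"
        "g (midpoint (f x) (f y)) - midpoint (g (f x)) (g (f y))"] by simp
  then show "norm ((g \<circ> f) (midpoint x y) - midpoint ((g \<circ> f) x) ((g \<circ> f) y)) \<le>
      (M * L + M * L\<^sup>2) * (norm (x - y))\<^sup>2"
    using 1 2 by (simp add: algebra_simps power_mult_distrib)
qed

lemma iter_dd_append: "iter_dd (us @ vs) f = iter_dd us (iter_dd vs f)"
  by (induction us) auto

lemma smooth_on_iter_dd: "smooth_on S f \<Longrightarrow> smooth_on S (iter_dd vs f)"
  unfolding smooth_on_def by (metis iter_dd_append)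

text \<open>Since \<open>smooth_on\<close> controls directional derivatives, bounds on the
  derivative as a linear map have to be assembled from the basis directions.\<close>

lemma norm_linear_le_sum_Basis:
  fixes f :: "'a::euclidean_space \<Rightarrow> 'b::real_normed_vector"
  assumes "linear f" and "\<And>b. b \<in> Basis \<Longrightarrow> norm (f b) \<le> B b"
  shows "norm (f v) \<le> (\<Sum>b\<in>Basis. B b) * norm v"
proof -
  have "f v = f (\<Sum>b\<in>Basis. (v \<bullet> b) *\<^sub>R b)" by (simp add: euclidean_representation)
  also have "\<dots> = (\<Sum>b\<in>Basis. (v \<bullet> b) *\<^sub>R f b)"
    using assms(1) by (simp add: linear_sum linear_scale)
  also have "norm \<dots> \<le> (\<Sum>b\<in>Basis. norm v * B b)"
  proof (rule sum_norm_le)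
    fix b :: 'a assume b: "b \<in> Basis"
    have "\<bar>v \<bullet> b\<bar> * norm (f b) \<le> norm v * B b"
      by (intro mult_mono Basis_le_norm b assms(2)) auto
    then show "norm ((v \<bullet> b) *\<^sub>R f b) \<le> norm v * B b" by simp
  qed
  finally show ?thesis by (simp add: sum_distrib_left sum_distrib_right mult.commute)
qed

lemma smooth_on_has_derivative:
  assumes "smooth_on S f" and "x \<in> S"
  shows "(f has_derivative frechet_derivative f (at x)) (at x)"
proof -
  have "f differentiable_on S" "open S"
    using assms(1) unfolding smooth_on_def by (metis iter_dd.simps(1))+
  then show ?thesis
    using assms(2) by (metis differentiable_on_eq_differentiable_at frechet_derivative_works)
qed

text \<open>The directional derivatives are continuous, hence bounded on a closed ball, and the mean
  value inequality applies there by convexity.\<close>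

lemma smooth_on_locally_Lipschitz:
  fixes f :: "'a::euclidean_space \<Rightarrow> 'b::euclidean_space"
  assumes f: "smooth_on S f" and p: "p \<in> S"
  obtains \<eta> L where "0 < \<eta>" and "0 \<le> L" and "cball p \<eta> \<subseteq> S"
    and "\<And>x y. \<lbrakk>x \<in> cball p \<eta>; y \<in> cball p \<eta>\<rbrakk> \<Longrightarrow> norm (f x - f y) \<le> L * norm (x - y)"
proof -
  have "open S" using f by (simp add: smooth_on_def)
  then obtain \<eta> where \<eta>: "0 < \<eta>" "cball p \<eta> \<subseteq> S" using p open_contains_cball by blast
  have "\<exists>B. \<forall>x\<in>cball p \<eta>. norm (frechet_derivative f (at x) b) \<le> B" for b
  proof -
    have "iter_dd [b] f differentiable_on S" using f unfolding smooth_on_def by blast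
    then have "continuous_on (cball p \<eta>) (\<lambda>x. frechet_derivative f (at x) b)"
      using differentiable_imp_continuous_on continuous_on_subset[OF _ \<eta>(2)] by fastforce
    then have "bounded ((\<lambda>x. frechet_derivative f (at x) b) ` cball p \<eta>)"
      using compact_continuous_image compact_cball compact_imp_bounded by blast
    then show ?thesis by (auto simp: bounded_iff)
  qed
  then obtain B where B: "\<And>b x. x \<in> cball p \<eta> \<Longrightarrow> norm (frechet_derivative f (at x) b) \<le> B b"
    by metis
  let ?L = "\<Sum>b\<in>Basis. B b"
  have L0: "0 \<le> ?L"
  proof (rule sum_nonneg)
    fix b :: 'a
    show "0 \<le> B b" using order_trans[OF norm_ge_zero B[of p b]] \<eta>(1) by simp
  qed
  show thesis
  proof
    fix x y assume xy: "x \<in> cball p \<eta>" "y \<in> cball p \<eta>"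
    show "norm (f x - f y) \<le> ?L * norm (x - y)"
    proof (rule differentiable_bound[OF convex_cball _ _ xy])
      fix z assume z: "z \<in> cball p \<eta>"
      have d: "(f has_derivative frechet_derivative f (at z)) (at z)"
        using smooth_on_has_derivative[OF f] z \<eta>(2) by blast
      then show "(f has_derivative frechet_derivative f (at z)) (at z within cball p \<eta>)"
        by (rule has_derivative_at_withinI)
      show "onorm (frechet_derivative f (at z)) \<le> ?L"
        by (intro onorm_le norm_linear_le_sum_Basis has_derivative_linear[OF d] B z)
    qed
  qed (use \<eta> L0 in auto)
qed

text \<open>Meant for the first partial derivatives, whose Lipschitz bounds are wanted on one common
  ball.\<close>

lemma smooth_on_locally_Lipschitz_family:
  fixes f :: "'i \<Rightarrow> 'a::euclidean_space \<Rightarrow> 'b::euclidean_space"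
  assumes "finite I" and "\<And>i. i \<in> I \<Longrightarrow> smooth_on S (f i)" and p: "p \<in> S" and "open S"
  obtains \<eta> L where "0 < \<eta>" and "0 \<le> L" and "cball p \<eta> \<subseteq> S"
    and "\<And>i x y. \<lbrakk>i \<in> I; x \<in> cball p \<eta>; y \<in> cball p \<eta>\<rbrakk> \<Longrightarrow> norm (f i x - f i y) \<le> L * norm (x - y)"
proof -
  have "\<exists>\<eta> L. 0 < \<eta> \<and> 0 \<le> L \<and> cball p \<eta> \<subseteq> S \<and>
      (\<forall>i\<in>I. \<forall>x\<in>cball p \<eta>. \<forall>y\<in>cball p \<eta>. norm (f i x - f i y) \<le> L * norm (x - y))"
    using assms(1,2)
  proof (induction I rule: finite_induct)
    case empty
    obtain \<eta> where "0 < \<eta>" "cball p \<eta> \<subseteq> S"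
      using p \<open>open S\<close> open_contains_cball by blast
    then show ?case by (intro exI[of _ \<eta>] exI[of _ 0]) auto
  next
    case (insert i I)
    obtain \<eta> L where 1: "0 < \<eta>" "0 \<le> L" "cball p \<eta> \<subseteq> S"
        "\<forall>i\<in>I. \<forall>x\<in>cball p \<eta>. \<forall>y\<in>cball p \<eta>. norm (f i x - f i y) \<le> L * norm (x - y)"
      using insert by auto
    obtain \<eta>' L' where 2: "0 < \<eta>'" "0 \<le> L'" "cball p \<eta>' \<subseteq> S"
        "\<And>x y. \<lbrakk>x \<in> cball p \<eta>'; y \<in> cball p \<eta>'\<rbrakk> \<Longrightarrow> norm (f i x - f i y) \<le> L' * norm (x - y)"
      using smooth_on_locally_Lipschitz[of S "f i" p] insert.prems p by blast
    have "\<forall>j\<in>insert i I. \<forall>x\<in>cball p (min \<eta> \<eta>'). \<forall>y\<in>cball p (min \<eta> \<eta>').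
        norm (f j x - f j y) \<le> max L L' * norm (x - y)"
    proof (intro ballI)
      fix j x y assume j: "j \<in> insert i I" and x: "x \<in> cball p (min \<eta> \<eta>')" and y: "y \<in> cball p (min \<eta> \<eta>')"
      have "norm (f j x - f j y) \<le> L * norm (x - y) \<or> norm (f j x - f j y) \<le> L' * norm (x - y)"
        using j x y 1(4) 2(4) by auto
      moreover have "L * norm (x - y) \<le> max L L' * norm (x - y)" "L' * norm (x - y) \<le> max L L' * norm (x - y)"
        by (auto intro: mult_right_mono)
      ultimately show "norm (f j x - f j y) \<le> max L L' * norm (x - y)" by linarith
    qed
    moreover have "cball p (min \<eta> \<eta>') \<subseteq> S" using 1(3) by auto
    ultimately show ?case
      using 1 2 by (intro exI[of _ "min \<eta> \<eta>'"] exI[of _ "max L L'"]) auto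
  qed
  then show thesis using that by blast
qed

text \<open>For the midpoint bound, write the endpoints as \<open>m + v\<close> and
  \<open>m - v\<close> and differentiate the symmetric sum \<open>f (m + s v) + f (m - s v)\<close>
  in \<open>s\<close>. The derivative compares the differential of \<open>f\<close> at two points
  whose distance is of order \<open>norm v\<close>, and applies the difference to \<open>v\<close>;
  so it is quadratic in \<open>norm v\<close>.\<close>

lemma smooth_on_imp_jensen_lipschitz:
  fixes f :: "'a::euclidean_space \<Rightarrow> 'b::euclidean_space"
  assumes f: "smooth_on S f" and p: "p \<in> S"
  obtains \<eta> L where "0 < \<eta>" and "0 < L" and "ball p \<eta> \<subseteq> S" and "jensen_lipschitz L (ball p \<eta>) f"
proof -
  have "open S" using f by (simp add: smooth_on_def)
  obtain \<eta>1 L1 where 1: "0 < \<eta>1" "0 \<le> L1" "cball p \<eta>1 \<subseteq> S"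
      "\<And>x y. \<lbrakk>x \<in> cball p \<eta>1; y \<in> cball p \<eta>1\<rbrakk> \<Longrightarrow> norm (f x - f y) \<le> L1 * norm (x - y)"
    using smooth_on_locally_Lipschitz[OF f p] by blast
  have sm: "smooth_on S (\<lambda>x. frechet_derivative f (at x) b)" for b
    using smooth_on_iter_dd[OF f, of "[b]"] by simp
  obtain \<eta>2 L2 where 2: "0 < \<eta>2" "0 \<le> L2"
      "\<And>b x y. \<lbrakk>b \<in> Basis; x \<in> cball p \<eta>2; y \<in> cball p \<eta>2\<rbrakk> \<Longrightarrow>
        norm (frechet_derivative f (at x) b - frechet_derivative f (at y) b) \<le> L2 * norm (x - y)"
    using smooth_on_locally_Lipschitz_family[of Basis S "\<lambda>b x. frechet_derivative f (at x) b" p,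
        OF finite_Basis sm p \<open>open S\<close>] by metis
  define \<eta> where "\<eta> = min \<eta>1 \<eta>2"
  define D where "D = real DIM('a) * L2"
  have D0: "0 \<le> D" using 2 by (simp add: D_def)
  have sub: "ball p \<eta> \<subseteq> cball p \<eta>1" "ball p \<eta> \<subseteq> cball p \<eta>2" by (auto simp: \<eta>_def)
  have jen: "norm (f (midpoint x y) - midpoint (f x) (f y)) \<le> D * (norm (x - y))\<^sup>2"
    if x: "x \<in> ball p \<eta>" and y: "y \<in> ball p \<eta>" for x y
  proof -
    define m where "m = midpoint x y"
    define v where "v = (1/2) *\<^sub>R (x - y)"
    have mv: "m + v = x" "m - v = y"
      by (simp_all add: m_def v_def midpoint_def algebra_simps flip: scaleR_add_left)
    have inb: "m + s *\<^sub>R v \<in> ball p \<eta>" "m - s *\<^sub>R v \<in> ball p \<eta>" if "s \<in> {0..1}" for s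
    proof -
      have "m + s *\<^sub>R v = ((1 + s) / 2) *\<^sub>R x + ((1 - s) / 2) *\<^sub>R y"
        "m - s *\<^sub>R v = ((1 - s) / 2) *\<^sub>R x + ((1 + s) / 2) *\<^sub>R y"
        by (simp_all add: m_def v_def midpoint_def algebra_simps add_divide_distrib diff_divide_distrib)
      then show "m + s *\<^sub>R v \<in> ball p \<eta>" "m - s *\<^sub>R v \<in> ball p \<eta>"
        using convexD[OF convex_ball x y, of "(1 + s) / 2" "(1 - s) / 2"]
          convexD[OF convex_ball x y, of "(1 - s) / 2" "(1 + s) / 2"] that
        by (auto simp: field_simps)
    qed
    \<comment> \<open>Here \<open>k 0\<close> is twice the value at the midpoint and
      \<open>k 1 = f x + f y\<close>, so \<open>k 1 - k 0\<close> is \<open>-2\<close> times the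
      midpoint error.\<close>
    define k where "k s = f (m + s *\<^sub>R v) + f (m - s *\<^sub>R v)" for s
    define k' where "k' s h = h *\<^sub>R (frechet_derivative f (at (m + s *\<^sub>R v)) v -
        frechet_derivative f (at (m - s *\<^sub>R v)) v)" for s h
    have "norm (k 1 - k 0) \<le> (2 * D * (norm v)\<^sup>2) * norm (1 - (0::real))"
    proof (rule differentiable_bound[of "{0..1}" k k'])
      fix s :: real assume s: "s \<in> {0..1}"
      have lin: "(f has_derivative frechet_derivative f (at z)) (at z)" if "z \<in> ball p \<eta>" for z
        by (rule smooth_on_has_derivative[OF f]) (use that sub 1(3) in auto)
      have "((\<lambda>s. f (m + s *\<^sub>R v)) has_derivative
          (\<lambda>h. frechet_derivative f (at (m + s *\<^sub>R v)) (h *\<^sub>R v))) (at s)"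
        by (rule has_derivative_compose[where g = f and f = "\<lambda>s. m + s *\<^sub>R v", OF _ lin[OF inb(1)[OF s]]]) (auto intro!: derivative_eq_intros)
      moreover have "((\<lambda>s. f (m - s *\<^sub>R v)) has_derivative
          (\<lambda>h. frechet_derivative f (at (m - s *\<^sub>R v)) (- (h *\<^sub>R v)))) (at s)"
        by (rule has_derivative_compose[where g = f and f = "\<lambda>s. m - s *\<^sub>R v", OF _ lin[OF inb(2)[OF s]]]) (auto intro!: derivative_eq_intros)
      ultimately have "(k has_derivative (\<lambda>h. frechet_derivative f (at (m + s *\<^sub>R v)) (h *\<^sub>R v) +
          frechet_derivative f (at (m - s *\<^sub>R v)) (- (h *\<^sub>R v)))) (at s)"
        unfolding k_def by (rule has_derivative_add)
      moreover have "(\<lambda>h. frechet_derivative f (at (m + s *\<^sub>R v)) (h *\<^sub>R v) +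
          frechet_derivative f (at (m - s *\<^sub>R v)) (- (h *\<^sub>R v))) = k' s"
        using has_derivative_linear[OF lin[OF inb(1)[OF s]]] has_derivative_linear[OF lin[OF inb(2)[OF s]]]
        by (auto simp: k'_def linear_scale linear_neg scaleR_diff_right)
      ultimately show "(k has_derivative k' s) (at s within {0..1})"
        by (metis has_derivative_at_withinI)
      let ?g = "\<lambda>w. frechet_derivative f (at (m + s *\<^sub>R v)) w - frechet_derivative f (at (m - s *\<^sub>R v)) w"
      have "linear ?g"
        by (rule linear_compose_sub[OF has_derivative_linear[OF lin[OF inb(1)[OF s]]]
              has_derivative_linear[OF lin[OF inb(2)[OF s]]]])
      then have "norm (?g v) \<le> (\<Sum>b\<in>(Basis :: 'a set). L2 * norm ((m + s *\<^sub>R v) - (m - s *\<^sub>R v))) * norm v"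
        by (rule norm_linear_le_sum_Basis) (intro 2(3), use inb[OF s] sub in auto)
      also have "(m + s *\<^sub>R v) - (m - s *\<^sub>R v) = (2 * s) *\<^sub>R v" by (simp flip: scaleR_2)
      also have "norm ((2 * s) *\<^sub>R v) = 2 * s * norm v" using s by simp
      finally have "norm (?g v) \<le> s * (2 * D * (norm v)\<^sup>2)"
        by (simp add: D_def power2_eq_square mult_ac)
      also have "\<dots> \<le> 1 * (2 * D * (norm v)\<^sup>2)"
        by (rule mult_right_mono) (use s D0 in auto)
      finally have "norm (k' s h) \<le> (2 * D * (norm v)\<^sup>2) * norm h" for h
        using mult_right_mono[of "norm (?g v)" "2 * D * (norm v)\<^sup>2" "\<bar>h\<bar>"]
        by (simp add: k'_def mult.commute)
      then show "onorm (k' s) \<le> 2 * D * (norm v)\<^sup>2" by (rule onorm_le)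
    qed auto
    then have k: "norm (k 1 - k 0) \<le> 2 * D * (norm v)\<^sup>2" by simp
    have "f m - midpoint (f x) (f y) = - ((1/2) *\<^sub>R (k 1 - k 0))"
      by (simp add: k_def mv midpoint_def algebra_simps flip: scaleR_add_left)
    then have "norm (f m - midpoint (f x) (f y)) \<le> D * (norm v)\<^sup>2" using k by simp
    also have "\<dots> \<le> D * (norm (x - y))\<^sup>2"
      by (intro mult_left_mono power_mono D0) (auto simp: v_def)
    finally show ?thesis by (simp add: m_def)
  qed
  show thesis
  proof
    \<comment> \<open>\<open>L1\<close> and \<open>D\<close> are only nonnegative; the summand
      \<open>1\<close> makes the constant positive.\<close>
    show "jensen_lipschitz (L1 + D + 1) (ball p \<eta>) f"
      unfolding jensen_lipschitz_def
    proof (intro ballI conjI)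
      fix x y assume xy: "x \<in> ball p \<eta>" "y \<in> ball p \<eta>"
      have "L1 * norm (x - y) \<le> (L1 + D + 1) * norm (x - y)"
        using D0 by (intro mult_right_mono) auto
      then show "norm (f x - f y) \<le> (L1 + D + 1) * norm (x - y)"
        using 1(4)[of x y] xy sub by fastforce
      have "D * (norm (x - y))\<^sup>2 \<le> (L1 + D + 1) * (norm (x - y))\<^sup>2"
        using 1(2) by (intro mult_right_mono) auto
      then show "norm (f (midpoint x y) - midpoint (f x) (f y)) \<le> (L1 + D + 1) * (norm (x - y))\<^sup>2"
        using jen[OF xy] by linarith
    qed
  qed (use 1 2 D0 sub in \<open>auto simp: \<eta>_def\<close>)
qed

text \<open>By the parallelogram identity the midpoint of the images has a squared distance from
  \<open>p\<close> smaller than that of the farther image by at least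
  \<open>\<epsilon>\<^sup>2 * \<Delta>\<^sup>2 / 4\<close>. Within radius
  \<open>\<epsilon> ^ 3 / 8\<close> this lowers the distance itself by more than
  \<open>\<Delta>\<^sup>2 / \<epsilon>\<close>, the most that the image of the midpoint can deviate
  from the midpoint of the images.\<close>

lemma jensen_lipschitz_strict_quasiconvex:
  fixes f :: "'a::real_normed_vector \<Rightarrow> 'b::real_inner"
  assumes f: "jensen_lipschitz (1 / \<epsilon>) S f" and x: "x \<in> S" and y: "y \<in> S" and "x \<noteq> y" and \<epsilon>: "0 < \<epsilon>"
    and low: "\<epsilon> * norm (x - y) \<le> norm (f x - f y)"
    and small: "norm (f x - p) < \<epsilon> ^ 3 / 8" "norm (f y - p) < \<epsilon> ^ 3 / 8"
  shows "norm (f (midpoint x y) - p) < max (norm (f x - p)) (norm (f y - p))"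
proof -
  define a where "a = f x - p"
  define b where "b = f y - p"
  define M where "M = max (norm a) (norm b)"
  define s where "s = norm ((1/2) *\<^sub>R (a + b))"
  define \<Delta> where "\<Delta> = norm (x - y)"
  have \<Delta>: "0 < \<Delta>" using \<open>x \<noteq> y\<close> by (simp add: \<Delta>_def)
  have M0: "0 \<le> M" by (simp add: M_def le_max_iff_disj)
  have Ms: "M < \<epsilon> ^ 3 / 8" using small by (simp add: M_def a_def b_def)
  have "s\<^sup>2 = ((norm a)\<^sup>2 + (norm b)\<^sup>2) / 2 - (norm (a - b))\<^sup>2 / 4"
    by (simp add: s_def power2_norm_eq_inner inner_simps inner_commute field_simps)
  moreover have "(norm a)\<^sup>2 \<le> M\<^sup>2" "(norm b)\<^sup>2 \<le> M\<^sup>2"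
    by (auto simp: M_def intro!: power_mono)
  moreover have "(\<epsilon> * \<Delta>)\<^sup>2 \<le> (norm (a - b))\<^sup>2"
    using low \<epsilon> by (intro power_mono) (auto simp: a_def b_def \<Delta>_def)
  ultimately have s2: "\<epsilon>\<^sup>2 * \<Delta>\<^sup>2 / 4 \<le> M\<^sup>2 - s\<^sup>2"
    by (simp add: power_mult_distrib add_divide_distrib)
  have "s\<^sup>2 \<le> M\<^sup>2" using s2 by (smt (verit) zero_le_power2 mult_nonneg_nonneg divide_nonneg_pos)
  then have sM: "s \<le> M" using M0 by (rule power2_le_imp_le)
  \<comment> \<open>The gap of the squares is \<open>(M - s) * (M + s)\<close>, and the second
    factor is at most \<open>2 * M < \<epsilon> ^ 3 / 4\<close>.\<close>
  have "\<Delta>\<^sup>2 / \<epsilon> < M - s"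
  proof (rule ccontr)
    assume "\<not> \<Delta>\<^sup>2 / \<epsilon> < M - s"
    then have "M - s \<le> \<Delta>\<^sup>2 / \<epsilon>" by simp
    have "M\<^sup>2 - s\<^sup>2 = (M - s) * (M + s)" by (simp add: power2_eq_square algebra_simps)
    also have "\<dots> \<le> (\<Delta>\<^sup>2 / \<epsilon>) * (2 * M)"
      using \<open>M - s \<le> \<Delta>\<^sup>2 / \<epsilon>\<close> sM M0 \<epsilon> by (intro mult_mono) (auto simp: s_def)
    also have "\<dots> < (\<Delta>\<^sup>2 / \<epsilon>) * (\<epsilon> ^ 3 / 4)"
      using Ms \<Delta> \<epsilon> by (intro mult_strict_left_mono) auto
    also have "\<dots> = \<epsilon>\<^sup>2 * \<Delta>\<^sup>2 / 4" using \<epsilon> by (simp add: power2_eq_square power3_eq_cube)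
    finally show False using s2 by simp
  qed
  moreover have "norm (f (midpoint x y) - p) \<le> s + \<Delta>\<^sup>2 / \<epsilon>"
  proof -
    have "norm (f (midpoint x y) - p) \<le>
        norm (f (midpoint x y) - midpoint (f x) (f y)) + norm (midpoint (f x) (f y) - p)"
      using norm_triangle_ineq[of "f (midpoint x y) - midpoint (f x) (f y)" "midpoint (f x) (f y) - p"]
      by simp
    moreover have "midpoint (f x) (f y) - p = (1/2) *\<^sub>R (a + b)"
      by (simp add: a_def b_def midpoint_def algebra_simps flip: scaleR_add_left)
    ultimately show ?thesis
      using jensen_lipschitzD(2)[OF f x y] by (simp add: s_def \<Delta>_def)
  qed
  ultimately show ?thesis by (simp add: M_def a_def b_def)
qed

section \<open>Charts and group multiplication in coordinates\<close>

lemma is_chart_inv_into: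
  assumes "is_chart T U \<phi>"
  shows "x \<in> U \<Longrightarrow> inv_into U \<phi> (\<phi> x) = x"
    and "z \<in> \<phi> ` U \<Longrightarrow> inv_into U \<phi> z \<in> U" and "z \<in> \<phi> ` U \<Longrightarrow> \<phi> (inv_into U \<phi> z) = z"
proof -
  have "U \<subseteq> topspace T" using assms openin_subset by (auto simp: is_chart_def)
  then have "inj_on \<phi> U"
    using assms by (auto simp: is_chart_def homeomorphic_map_def Int_absorb1 dest!: homeomorphic_imp_injective_map)
  then show "x \<in> U \<Longrightarrow> inv_into U \<phi> (\<phi> x) = x" by simp
qed (auto simp: inv_into_into f_inv_into_f)

lemma is_chart_openin_vimage:
  assumes c: "is_chart T U \<phi>" and "open B"
  shows "openin T {x \<in> U. \<phi> x \<in> B}"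
proof -
  have U: "openin T U" "U \<subseteq> topspace T" using c openin_subset by (auto simp: is_chart_def)
  have "continuous_map (subtopology T U) (top_of_set (\<phi> ` U)) \<phi>"
    using c by (simp add: is_chart_def homeomorphic_imp_continuous_map)
  then have "continuous_map (subtopology T U) euclidean \<phi>"
    by (simp add: continuous_map_in_subtopology)
  then have "openin (subtopology T U) {x \<in> topspace (subtopology T U). \<phi> x \<in> B}"
    using \<open>open B\<close> by (simp add: continuous_map_def)
  then show ?thesis
    using U by (simp add: Int_absorb1 openin_trans_full)
qed

text \<open>Being closed in the chart domain says nothing about its boundary in \<open>T\<close>;
  the preimage is closed in \<open>T\<close> because it is compact and \<open>T\<close> is
  Hausdorff.\<close>

lemma is_chart_closedin_vimage:
  assumes c: "is_chart T U \<phi>" and T: "Hausdorff_space T" and "compact B" and "B \<subseteq> \<phi> ` U"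
  shows "closedin T {x \<in> U. \<phi> x \<in> B}"
proof -
  have U: "U \<subseteq> topspace T" using c openin_subset by (auto simp: is_chart_def)
  have h: "homeomorphic_map (subtopology T U) (top_of_set (\<phi> ` U)) \<phi>"
    using c by (simp add: is_chart_def)
  let ?C = "{x \<in> U. \<phi> x \<in> B}"
  have im: "\<phi> ` ?C = B" using assms(4) by auto
  have "compactin (subtopology T U) ?C \<longleftrightarrow> compactin (top_of_set (\<phi> ` U)) (\<phi> ` ?C)"
    by (rule homeomorphic_map_compactness[OF h, symmetric]) (use U in auto)
  then have "compactin (subtopology T U) ?C"
    using im \<open>compact B\<close> assms(4) by (simp add: compactin_subtopology)
  then have "compactin T ?C" by (simp add: compactin_subtopology)
  then show ?thesis using T compactin_imp_closedin by blast
qed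

text \<open>Joint smoothness in the product chart is used one variable at a time. The other factor
  is then a parameter, and \<open>\<eta>\<close> and \<open>L\<close> are uniform in it.\<close>

lemma mult_chart_estimates:
  fixes A :: "('g set \<times> ('g \<Rightarrow> 'd::euclidean_space)) set"
  assumes lie: "lie_group_atlas G TG A" and U: "(U, \<phi>) \<in> A" and V: "(V, \<psi>) \<in> A" and W: "(W, \<xi>) \<in> A"
    and a0: "a0 \<in> U" and b0: "b0 \<in> V" and ab0: "a0 \<otimes>\<^bsub>G\<^esub> b0 \<in> W"
  obtains \<eta> L where "0 < \<eta>" and "0 < L"
    and "ball (\<phi> a0) \<eta> \<subseteq> \<phi> ` U" and "ball (\<psi> b0) \<eta> \<subseteq> \<psi> ` V"
    and "\<And>a b. \<lbrakk>a \<in> U; b \<in> V; \<phi> a \<in> ball (\<phi> a0) \<eta>; \<psi> b \<in> ball (\<psi> b0) \<eta>\<rbrakk> \<Longrightarrow> a \<otimes>\<^bsub>G\<^esub> b \<in> W"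
    and "\<And>a. \<lbrakk>a \<in> U; \<phi> a \<in> ball (\<phi> a0) \<eta>\<rbrakk> \<Longrightarrow>
      jensen_lipschitz L (ball (\<psi> b0) \<eta>) (\<lambda>z. \<xi> (a \<otimes>\<^bsub>G\<^esub> inv_into V \<psi> z))"
    and "\<And>b. \<lbrakk>b \<in> V; \<psi> b \<in> ball (\<psi> b0) \<eta>\<rbrakk> \<Longrightarrow>
      jensen_lipschitz L (ball (\<phi> a0) \<eta>) (\<lambda>z. \<xi> (inv_into U \<phi> z \<otimes>\<^bsub>G\<^esub> b))"
proof -
  have "smooth_atlas TG A" using lie by (simp add: lie_group_atlas_def smooth_manifold_def)
  then have cU: "is_chart TG U \<phi>" and cV: "is_chart TG V \<psi>"
    using U V by (auto simp: smooth_atlas_def)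
  let ?S = "(\<lambda>(a, b). (\<phi> a, \<psi> b)) ` ((U \<times> V) \<inter> {(a, b). a \<otimes>\<^bsub>G\<^esub> b \<in> W})"
  let ?M = "\<lambda>(z, z'). \<xi> (inv_into U \<phi> z \<otimes>\<^bsub>G\<^esub> inv_into V \<psi> z')"
  have sm: "smooth_on ?S ?M"
    using lie U V W unfolding lie_group_atlas_def by fastforce
  have "(\<phi> a0, \<psi> b0) \<in> ?S" using a0 b0 ab0 by force
  then obtain \<eta>' L where \<eta>': "0 < \<eta>'" "0 < L" "ball (\<phi> a0, \<psi> b0) \<eta>' \<subseteq> ?S"
      "jensen_lipschitz L (ball (\<phi> a0, \<psi> b0) \<eta>') ?M"
    using smooth_on_imp_jensen_lipschitz[OF sm] by blast
  \<comment> \<open>Two balls of half the radius have their product inside the ball of the product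
    space.\<close>
  define \<eta> where "\<eta> = \<eta>' / 2"
  have box: "(z, z') \<in> ball (\<phi> a0, \<psi> b0) \<eta>'" if "z \<in> ball (\<phi> a0) \<eta>" "z' \<in> ball (\<psi> b0) \<eta>" for z z'
  proof -
    have "dist (\<phi> a0, \<psi> b0) (z, z') \<le> dist (\<phi> a0) z + dist (\<psi> b0) z'"
      using sqrt_sum_squares_le_sum_abs[of "dist (\<phi> a0) z" "dist (\<psi> b0) z'"] by (simp add: dist_Pair_Pair)
    then show ?thesis using that by (simp add: \<eta>_def)
  qed
  show thesis
  proof
    show "0 < \<eta>" "0 < L" using \<eta>' by (auto simp: \<eta>_def)
    show "ball (\<phi> a0) \<eta> \<subseteq> \<phi> ` U"
      using box[of _ "\<psi> b0"] \<eta>'(1,3) by (fastforce simp: \<eta>_def)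
    show "ball (\<psi> b0) \<eta> \<subseteq> \<psi> ` V"
      using box[of "\<phi> a0"] \<eta>'(1,3) by (fastforce simp: \<eta>_def)
  next
    fix a b assume ab: "a \<in> U" "b \<in> V" "\<phi> a \<in> ball (\<phi> a0) \<eta>" "\<psi> b \<in> ball (\<psi> b0) \<eta>"
    \<comment> \<open>The domain \<open>?S\<close> records that the product lies in
      \<open>W\<close>; injectivity of the charts brings this back to \<open>a\<close> and
      \<open>b\<close>.\<close>
    then have "(\<phi> a, \<psi> b) \<in> ?S" using box \<eta>'(3) by blast
    then obtain a' b' where "a' \<in> U" "b' \<in> V" "a' \<otimes>\<^bsub>G\<^esub> b' \<in> W" "\<phi> a = \<phi> a'" "\<psi> b = \<psi> b'" by auto
    then show "a \<otimes>\<^bsub>G\<^esub> b \<in> W"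
      using ab is_chart_inv_into(1)[OF cU] is_chart_inv_into(1)[OF cV] by metis
  next
    fix a assume a: "a \<in> U" "\<phi> a \<in> ball (\<phi> a0) \<eta>"
    have mid: "midpoint (\<phi> a, x) (\<phi> a, y) = (\<phi> a, midpoint x y)" for x y :: 'd
      by (simp add: midpoint_def flip: scaleR_2)
    show "jensen_lipschitz L (ball (\<psi> b0) \<eta>) (\<lambda>z. \<xi> (a \<otimes>\<^bsub>G\<^esub> inv_into V \<psi> z))"
      unfolding jensen_lipschitz_def
    proof (intro ballI)
      fix x y assume "x \<in> ball (\<psi> b0) \<eta>" "y \<in> ball (\<psi> b0) \<eta>"
      from jensen_lipschitzD[OF \<eta>'(4) box[OF a(2) this(1)] box[OF a(2) this(2)]]
      show "norm (\<xi> (a \<otimes>\<^bsub>G\<^esub> inv_into V \<psi> x) - \<xi> (a \<otimes>\<^bsub>G\<^esub> inv_into V \<psi> y)) \<le> L * norm (x - y) \<and>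
         norm (\<xi> (a \<otimes>\<^bsub>G\<^esub> inv_into V \<psi> (midpoint x y)) -
          midpoint (\<xi> (a \<otimes>\<^bsub>G\<^esub> inv_into V \<psi> x)) (\<xi> (a \<otimes>\<^bsub>G\<^esub> inv_into V \<psi> y))) \<le> L * (norm (x - y))\<^sup>2"
        by (simp add: mid norm_Pair is_chart_inv_into(1)[OF cU a(1)])
    qed
  next
    fix b assume b: "b \<in> V" "\<psi> b \<in> ball (\<psi> b0) \<eta>"
    have mid: "midpoint (x, \<psi> b) (y, \<psi> b) = (midpoint x y, \<psi> b)" for x y :: 'd
      by (simp add: midpoint_def flip: scaleR_2)
    show "jensen_lipschitz L (ball (\<phi> a0) \<eta>) (\<lambda>z. \<xi> (inv_into U \<phi> z \<otimes>\<^bsub>G\<^esub> b))"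
      unfolding jensen_lipschitz_def
    proof (intro ballI)
      fix x y assume "x \<in> ball (\<phi> a0) \<eta>" "y \<in> ball (\<phi> a0) \<eta>"
      from jensen_lipschitzD[OF \<eta>'(4) box[OF this(1) b(2)] box[OF this(2) b(2)]]
      show "norm (\<xi> (inv_into U \<phi> x \<otimes>\<^bsub>G\<^esub> b) - \<xi> (inv_into U \<phi> y \<otimes>\<^bsub>G\<^esub> b)) \<le> L * norm (x - y) \<and>
         norm (\<xi> (inv_into U \<phi> (midpoint x y) \<otimes>\<^bsub>G\<^esub> b) -
          midpoint (\<xi> (inv_into U \<phi> x \<otimes>\<^bsub>G\<^esub> b)) (\<xi> (inv_into U \<phi> y \<otimes>\<^bsub>G\<^esub> b))) \<le> L * (norm (x - y))\<^sup>2"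
        by (simp add: mid norm_Pair is_chart_inv_into(1)[OF cV b(1)])
    qed
  qed
qed

section \<open>Conjugation in charts of a compact Lie group\<close>

text \<open>The function \<open>f\<close> is the coordinate form of
  \<open>g \<mapsto> k h g k^-1\<close> with \<open>h\<close> near the identity; it is applied with
  \<open>h = w^-1\<close>, to estimate conjugates of \<open>w^-1 g\<close>. One number serves as
  radius, as lower expansion factor and, inverted, as upper constant, so that the bounds persist
  when \<open>\<epsilon>\<close> shrinks.\<close>

definition conj_chart_bounds ::
    "('g, 'm) monoid_scheme \<Rightarrow> 'g set \<Rightarrow> ('g \<Rightarrow> 'd::euclidean_space) \<Rightarrow> real \<Rightarrow> 'g \<Rightarrow> bool" where
  "conj_chart_bounds G U \<phi> \<epsilon> k \<longleftrightarrow> ball (\<phi> \<one>\<^bsub>G\<^esub>) \<epsilon> \<subseteq> \<phi> ` U \<and>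
     (\<forall>h\<in>U. \<phi> h \<in> ball (\<phi> \<one>\<^bsub>G\<^esub>) \<epsilon> \<longrightarrow>
       (let f = (\<lambda>z. \<phi> (k \<otimes>\<^bsub>G\<^esub> h \<otimes>\<^bsub>G\<^esub> inv_into U \<phi> z \<otimes>\<^bsub>G\<^esub> inv\<^bsub>G\<^esub> k)) in
        (\<forall>z\<in>ball (\<phi> \<one>\<^bsub>G\<^esub>) \<epsilon>. k \<otimes>\<^bsub>G\<^esub> h \<otimes>\<^bsub>G\<^esub> inv_into U \<phi> z \<otimes>\<^bsub>G\<^esub> inv\<^bsub>G\<^esub> k \<in> U) \<and>
        jensen_lipschitz (1 / \<epsilon>) (ball (\<phi> \<one>\<^bsub>G\<^esub>) \<epsilon>) f \<and>
        (\<forall>z\<in>ball (\<phi> \<one>\<^bsub>G\<^esub>) \<epsilon>. \<forall>z'\<in>ball (\<phi> \<one>\<^bsub>G\<^esub>) \<epsilon>. \<epsilon> * norm (z - z') \<le> norm (f z - f z'))))"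

lemma conj_chart_bounds_mono:
  fixes \<phi> :: "'g \<Rightarrow> 'd::euclidean_space"
  assumes "conj_chart_bounds G U \<phi> \<epsilon> k" and "0 < \<epsilon>'" and "\<epsilon>' \<le> \<epsilon>"
  shows "conj_chart_bounds G U \<phi> \<epsilon>' k"
proof -
  have sub: "ball (\<phi> \<one>\<^bsub>G\<^esub>) \<epsilon>' \<subseteq> ball (\<phi> \<one>\<^bsub>G\<^esub>) \<epsilon>" using assms(3) by auto
  have inv_le: "1 / \<epsilon> \<le> 1 / \<epsilon>'" using assms(2,3) by (simp add: frac_le)
  have low: "\<epsilon>' * norm (z - z') \<le> c" if "\<epsilon> * norm (z - z') \<le> c" for z z' :: 'd and c
    using mult_right_mono[OF assms(3) norm_ge_zero[of "z - z'"]] that by linarith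
  show ?thesis
    unfolding conj_chart_bounds_def Let_def
  proof (intro conjI ballI impI)
    show "ball (\<phi> \<one>\<^bsub>G\<^esub>) \<epsilon>' \<subseteq> \<phi> ` U"
      using assms(1) sub by (auto simp: conj_chart_bounds_def)
  next
    fix h assume "h \<in> U" "\<phi> h \<in> ball (\<phi> \<one>\<^bsub>G\<^esub>) \<epsilon>'"
    then have h: "\<forall>z\<in>ball (\<phi> \<one>\<^bsub>G\<^esub>) \<epsilon>. k \<otimes>\<^bsub>G\<^esub> h \<otimes>\<^bsub>G\<^esub> inv_into U \<phi> z \<otimes>\<^bsub>G\<^esub> inv\<^bsub>G\<^esub> k \<in> U"
      "jensen_lipschitz (1 / \<epsilon>) (ball (\<phi> \<one>\<^bsub>G\<^esub>) \<epsilon>)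
        (\<lambda>z. \<phi> (k \<otimes>\<^bsub>G\<^esub> h \<otimes>\<^bsub>G\<^esub> inv_into U \<phi> z \<otimes>\<^bsub>G\<^esub> inv\<^bsub>G\<^esub> k))"
      "\<forall>z\<in>ball (\<phi> \<one>\<^bsub>G\<^esub>) \<epsilon>. \<forall>z'\<in>ball (\<phi> \<one>\<^bsub>G\<^esub>) \<epsilon>. \<epsilon> * norm (z - z') \<le>
        norm (\<phi> (k \<otimes>\<^bsub>G\<^esub> h \<otimes>\<^bsub>G\<^esub> inv_into U \<phi> z \<otimes>\<^bsub>G\<^esub> inv\<^bsub>G\<^esub> k) -
          \<phi> (k \<otimes>\<^bsub>G\<^esub> h \<otimes>\<^bsub>G\<^esub> inv_into U \<phi> z' \<otimes>\<^bsub>G\<^esub> inv\<^bsub>G\<^esub> k))"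
      using assms(1) sub unfolding conj_chart_bounds_def Let_def by blast+
    show "jensen_lipschitz (1 / \<epsilon>') (ball (\<phi> \<one>\<^bsub>G\<^esub>) \<epsilon>')
        (\<lambda>z. \<phi> (k \<otimes>\<^bsub>G\<^esub> h \<otimes>\<^bsub>G\<^esub> inv_into U \<phi> z \<otimes>\<^bsub>G\<^esub> inv\<^bsub>G\<^esub> k))"
      by (rule jensen_lipschitz_mono[OF h(2) sub inv_le])
    fix z assume z: "z \<in> ball (\<phi> \<one>\<^bsub>G\<^esub>) \<epsilon>'"
    show "k \<otimes>\<^bsub>G\<^esub> h \<otimes>\<^bsub>G\<^esub> inv_into U \<phi> z \<otimes>\<^bsub>G\<^esub> inv\<^bsub>G\<^esub> k \<in> U"
      using h(1) z sub by blast
    fix z' assume "z' \<in> ball (\<phi> \<one>\<^bsub>G\<^esub>) \<epsilon>'"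
    then show "\<epsilon>' * norm (z - z') \<le>
        norm (\<phi> (k \<otimes>\<^bsub>G\<^esub> h \<otimes>\<^bsub>G\<^esub> inv_into U \<phi> z \<otimes>\<^bsub>G\<^esub> inv\<^bsub>G\<^esub> k) -
          \<phi> (k \<otimes>\<^bsub>G\<^esub> h \<otimes>\<^bsub>G\<^esub> inv_into U \<phi> z' \<otimes>\<^bsub>G\<^esub> inv\<^bsub>G\<^esub> k))"
      using h(3) z sub by (intro low) blast
  qed
qed

text \<open>The intermediate product \<open>k h g\<close> lies near \<open>k0\<close>, in general
  far from \<open>U\<close>. So \<open>f\<close> is factored through a chart around
  \<open>k0\<close>: left multiplication by \<open>k h\<close>, then right multiplication by
  \<open>k^-1\<close>. Inverting the two factors gives the lower bound.\<close>

lemma conj_chart_bounds_local: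
  fixes G (structure) and A :: "('g set \<times> ('g \<Rightarrow> 'd::euclidean_space)) set"
  assumes lie: "lie_group_atlas G TG A" and U: "(U, \<phi>) \<in> A" and e: "\<one>\<^bsub>G\<^esub> \<in> U" and k0: "k0 \<in> carrier G"
  obtains N \<epsilon> where "openin TG N" and "k0 \<in> N" and "0 < \<epsilon>"
    and "\<And>k. k \<in> N \<Longrightarrow> conj_chart_bounds G U \<phi> \<epsilon> k"
proof -
  have tg: "topological_group G TG" and atl: "smooth_atlas TG A"
    using lie by (auto simp: lie_group_atlas_def smooth_manifold_def)
  have top: "topspace TG = carrier G" using tg by (simp add: topological_group_def)
  interpret group G using tg by (simp add: topological_group_def)
  have chart: "is_chart TG C \<zeta>" if "(C, \<zeta>) \<in> A" for C \<zeta>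
    using that atl by (auto simp: smooth_atlas_def)
  have sub: "C \<subseteq> carrier G" if "(C, \<zeta>) \<in> A" for C \<zeta>
    using chart[OF that] openin_subset top by (fastforce simp: is_chart_def)
  have cover: "\<exists>C \<zeta>. (C, \<zeta>) \<in> A \<and> g \<in> C" if "g \<in> carrier G" for g
  proof -
    have "g \<in> (\<Union>(C, \<zeta>)\<in>A. C)" using that atl top by (simp add: smooth_atlas_def)
    then show ?thesis by auto
  qed
  obtain V \<xi> where V: "(V, \<xi>) \<in> A" "k0 \<in> V" using cover[OF k0] by blast
  obtain V' \<xi>' where V': "(V', \<xi>') \<in> A" "inv k0 \<in> V'" using cover k0 by blast
  let ?p = "\<phi> \<one>" and ?\<iota> = "inv_into U \<phi>" and ?\<iota>V = "inv_into V \<xi>"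
  \<comment> \<open>One base point for each of four multiplications: the first two compose to
    \<open>f\<close>, the third undoes the second, and the fourth undoes the first.\<close>
  have prods: "k0 \<otimes> \<one> \<in> V" "k0 \<otimes> inv k0 \<in> U" "\<one> \<otimes> k0 \<in> V" "inv k0 \<otimes> k0 \<in> U"
    using k0 e V(2) by simp_all
  obtain \<eta>1 L1 where 1: "0 < \<eta>1" "0 < L1" "ball ?p \<eta>1 \<subseteq> \<phi> ` U"
      "\<And>a b. \<lbrakk>a \<in> V; b \<in> U; \<xi> a \<in> ball (\<xi> k0) \<eta>1; \<phi> b \<in> ball ?p \<eta>1\<rbrakk> \<Longrightarrow> a \<otimes> b \<in> V"
      "\<And>a. \<lbrakk>a \<in> V; \<xi> a \<in> ball (\<xi> k0) \<eta>1\<rbrakk> \<Longrightarrow> jensen_lipschitz L1 (ball ?p \<eta>1) (\<lambda>z. \<xi> (a \<otimes> ?\<iota> z))"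
    by (rule mult_chart_estimates[OF lie V(1) U V(1) V(2) e prods(1)]) (rule that; assumption)
  obtain \<eta>2 L2 where 2: "0 < \<eta>2" "0 < L2"
      "\<And>a b. \<lbrakk>a \<in> V; b \<in> V'; \<xi> a \<in> ball (\<xi> k0) \<eta>2; \<xi>' b \<in> ball (\<xi>' (inv k0)) \<eta>2\<rbrakk> \<Longrightarrow> a \<otimes> b \<in> U"
      "\<And>b. \<lbrakk>b \<in> V'; \<xi>' b \<in> ball (\<xi>' (inv k0)) \<eta>2\<rbrakk> \<Longrightarrow>
        jensen_lipschitz L2 (ball (\<xi> k0) \<eta>2) (\<lambda>z. \<phi> (?\<iota>V z \<otimes> b))"
    by (rule mult_chart_estimates[OF lie V(1) V'(1) U V(2) V'(2) prods(2)]) (rule that; assumption)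
  obtain \<eta>3 L3 where 3: "0 < \<eta>3" "0 < L3"
      "\<And>b. \<lbrakk>b \<in> V; \<xi> b \<in> ball (\<xi> k0) \<eta>3\<rbrakk> \<Longrightarrow> jensen_lipschitz L3 (ball ?p \<eta>3) (\<lambda>z. \<xi> (?\<iota> z \<otimes> b))"
    by (rule mult_chart_estimates[OF lie U V(1) V(1) e V(2) prods(3)]) (rule that; assumption)
  obtain \<eta>4 L4 where 4: "0 < \<eta>4" "0 < L4"
      "\<And>a. \<lbrakk>a \<in> V'; \<xi>' a \<in> ball (\<xi>' (inv k0)) \<eta>4\<rbrakk> \<Longrightarrow>
        jensen_lipschitz L4 (ball (\<xi> k0) \<eta>4) (\<lambda>z. \<phi> (a \<otimes> ?\<iota>V z))"
    by (rule mult_chart_estimates[OF lie V'(1) V(1) U V'(2) V(2) prods(4)]) (rule that; assumption)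
  define \<eta> where "\<eta> = min (min \<eta>1 \<eta>2) (min \<eta>3 \<eta>4)"
  have \<eta>: "0 < \<eta>" "\<eta> \<le> \<eta>1" "\<eta> \<le> \<eta>2" "\<eta> \<le> \<eta>3" "\<eta> \<le> \<eta>4" using 1 2 3 4 by (auto simp: \<eta>_def)
  define B1 where "B1 = {g \<in> V. \<xi> g \<in> ball (\<xi> k0) \<eta>}"
  define B2 where "B2 = {g \<in> V'. \<xi>' g \<in> ball (\<xi>' (inv k0)) \<eta>}"
  define B3 where "B3 = {g \<in> U. \<phi> g \<in> ball ?p \<eta>}"
  have opn: "openin TG B1" "openin TG B2" "openin TG B3"
    unfolding B1_def B2_def B3_def by (intro is_chart_openin_vimage chart U V V' open_ball)+
  let ?T = "prod_topology TG (prod_topology TG TG)"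
  have mul: "continuous_map X TG (\<lambda>x. a x \<otimes> b x)" if "continuous_map X TG a" "continuous_map X TG b"
    for a b and X :: "('g \<times> 'g \<times> 'g) topology"
    using continuous_map_binary[OF _ that, where f = "\<lambda>a b. a \<otimes> b"] tg
    by (simp add: topological_group_def)
  have invc: "continuous_map X TG (\<lambda>x. inv (a x))" if "continuous_map X TG a"
    for a and X :: "('g \<times> 'g \<times> 'g) topology"
    using continuous_map_compose[OF that, of TG "\<lambda>a. inv a"] tg by (simp add: topological_group_def o_def)
  have c: "continuous_map ?T TG (\<lambda>x. fst x)" "continuous_map ?T TG (\<lambda>x. fst (snd x))"
      "continuous_map ?T TG (\<lambda>x. snd (snd x))"
    using continuous_map_compose[OF continuous_map_snd[of TG "prod_topology TG TG"] continuous_map_fst]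
      continuous_map_compose[OF continuous_map_snd[of TG "prod_topology TG TG"] continuous_map_snd]
    by (simp_all add: o_def continuous_map_fst)
  \<comment> \<open>Each membership used below is an open condition on the triple and holds at
    \<open>(k0, \<one>, \<one>)\<close>. Collecting them all lets one product neighbourhood serve
    for everything.\<close>
  define R where "R = topspace ?T
      \<inter> {x \<in> topspace ?T. fst x \<in> B1} \<inter> {x \<in> topspace ?T. fst (snd x) \<in> B3}
      \<inter> {x \<in> topspace ?T. snd (snd x) \<in> B3}
      \<inter> {x \<in> topspace ?T. fst x \<otimes> fst (snd x) \<in> B1}
      \<inter> {x \<in> topspace ?T. fst x \<otimes> fst (snd x) \<otimes> snd (snd x) \<in> B1}
      \<inter> {x \<in> topspace ?T. inv (fst x) \<in> B2}
      \<inter> {x \<in> topspace ?T. inv (fst x \<otimes> fst (snd x)) \<in> B2}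
      \<inter> {x \<in> topspace ?T. fst x \<otimes> fst (snd x) \<otimes> snd (snd x) \<otimes> inv (fst x) \<in> B3}"
  have "openin ?T R"
    unfolding R_def
    by (intro openin_Int openin_topspace openin_continuous_map_preimage[OF _ opn(1)]
        openin_continuous_map_preimage[OF _ opn(2)] openin_continuous_map_preimage[OF _ opn(3)]
        mul invc c)
  moreover have "(k0, \<one>, \<one>) \<in> R"
    using k0 V V' e \<eta>(1) top by (auto simp: R_def B1_def B2_def B3_def)
  ultimately obtain N M where NM: "openin TG N" "openin (prod_topology TG TG) M" "k0 \<in> N"
      "(\<one>, \<one>) \<in> M" "N \<times> M \<subseteq> R"
    unfolding openin_prod_topology_alt[of TG "prod_topology TG TG"] by meson
  then obtain Q Q' where Q: "openin TG Q" "openin TG Q'" "\<one> \<in> Q" "\<one> \<in> Q'" "Q \<times> Q' \<subseteq> M"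
    unfolding openin_prod_topology_alt by meson
  have "openin TG (Q \<inter> Q' \<inter> U)" using Q chart[OF U] by (auto simp: is_chart_def)
  moreover have "homeomorphic_map (subtopology TG U) (top_of_set (\<phi> ` U)) \<phi>" "open (\<phi> ` U)"
    using chart[OF U] by (auto simp: is_chart_def)
  ultimately have "open (\<phi> ` (Q \<inter> Q' \<inter> U))"
    using homeomorphic_imp_open_map[of "subtopology TG U" "top_of_set (\<phi> ` U)" \<phi>]
    unfolding open_map_def
    by (metis inf_le2 openin_open_subtopology openin_subtopology_Int2 openin_open_trans Int_assoc
        openin_Int openin_subtopology_refl openin_subtopology_Int inf.idem)
  then obtain \<rho> where \<rho>: "0 < \<rho>" "ball ?p \<rho> \<subseteq> \<phi> ` (Q \<inter> Q' \<inter> U)"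
    using Q e open_contains_ball by (metis IntI image_eqI)
  define LL where "LL = L2 * L1 + L2 * L1\<^sup>2"
  \<comment> \<open>\<open>\<rho>\<close> keeps preimages in the chosen neighbourhoods and
    \<open>\<eta>\<close> keeps the estimates valid; \<open>1 / LL\<close> gives the upper constant
    \<open>LL \<le> 1 / \<epsilon>\<close>, and \<open>1 / (L3 * L4)\<close> gives the lower
    expansion factor.\<close>
  define \<epsilon> where "\<epsilon> = min (min \<rho> \<eta>) (min (1 / LL) (1 / (L3 * L4)))"
  have LL: "0 < LL" using 1 2 by (simp add: LL_def add_pos_pos)
  have \<epsilon>: "0 < \<epsilon>" "\<epsilon> \<le> \<rho>" "\<epsilon> \<le> \<eta>" "\<epsilon> \<le> 1 / LL" "\<epsilon> \<le> 1 / (L3 * L4)"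
    using \<rho> \<eta> 3 4 LL by (auto simp: \<epsilon>_def)
  have LLe: "LL \<le> 1 / \<epsilon>" using \<epsilon>(1,4) LL by (simp add: field_simps)
  have iU: "?\<iota> z \<in> Q \<inter> Q' \<inter> U" "\<phi> (?\<iota> z) = z" if "z \<in> ball ?p \<epsilon>" for z
  proof -
    have "z \<in> \<phi> ` (Q \<inter> Q' \<inter> U)" using that \<rho> \<epsilon>(2) by auto
    then obtain g where "g \<in> Q \<inter> Q' \<inter> U" "z = \<phi> g" by blast
    then show "?\<iota> z \<in> Q \<inter> Q' \<inter> U" "\<phi> (?\<iota> z) = z"
      using is_chart_inv_into(1)[OF chart[OF U]] by auto
  qed
  show thesis
  proof
    fix k assume k: "k \<in> N"
    show "conj_chart_bounds G U \<phi> \<epsilon> k"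
      unfolding conj_chart_bounds_def Let_def
    proof (intro conjI ballI impI)
      have "z \<in> \<phi> ` U" if "z \<in> ball ?p \<epsilon>" for z
        using iU[OF that] image_eqI[of z \<phi> "?\<iota> z" U] by simp
      then show "ball ?p \<epsilon> \<subseteq> \<phi> ` U" by blast
    next
      fix h assume h: "h \<in> U" "\<phi> h \<in> ball ?p \<epsilon>"
      have hQ: "h \<in> Q" using iU(1)[OF h(2)] is_chart_inv_into(1)[OF chart[OF U] h(1)] by auto
      have R: "k \<in> B1" "h \<in> B3" "?\<iota> z \<in> B3" "k \<otimes> h \<in> B1" "k \<otimes> h \<otimes> ?\<iota> z \<in> B1" "inv k \<in> B2"
          "inv (k \<otimes> h) \<in> B2" "k \<otimes> h \<otimes> ?\<iota> z \<otimes> inv k \<in> B3" if "z \<in> ball ?p \<epsilon>" for z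
      proof -
        have "(k, h, ?\<iota> z) \<in> R" using k hQ iU(1)[OF that] NM(5) Q(5) by blast
        then show "k \<in> B1" "h \<in> B3" "?\<iota> z \<in> B3" "k \<otimes> h \<in> B1" "k \<otimes> h \<otimes> ?\<iota> z \<in> B1" "inv k \<in> B2"
          "inv (k \<otimes> h) \<in> B2" "k \<otimes> h \<otimes> ?\<iota> z \<otimes> inv k \<in> B3"
          by (auto simp: R_def)
      qed
      have kh: "k \<in> carrier G" "h \<in> carrier G"
        using R(1,2)[OF h(2)] sub[OF U] sub[OF V(1)] by (auto simp: B1_def B3_def)
      have B1: "g \<in> V" "\<xi> g \<in> ball (\<xi> k0) \<eta>1" "\<xi> g \<in> ball (\<xi> k0) \<eta>2" "\<xi> g \<in> ball (\<xi> k0) \<eta>3"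
        "\<xi> g \<in> ball (\<xi> k0) \<eta>4" if "g \<in> B1" for g
        using that \<eta> by (auto simp: B1_def)
      have B2: "g \<in> V'" "\<xi>' g \<in> ball (\<xi>' (inv k0)) \<eta>2" "\<xi>' g \<in> ball (\<xi>' (inv k0)) \<eta>4" if "g \<in> B2" for g
        using that \<eta> by (auto simp: B2_def)
      let ?f = "\<lambda>z. \<phi> (k \<otimes> h \<otimes> ?\<iota> z \<otimes> inv k)"
      let ?g = "\<lambda>z. \<xi> (k \<otimes> h \<otimes> ?\<iota> z)"
      have iV: "?\<iota>V (\<xi> g) = g" if "g \<in> B1" for g
        using is_chart_inv_into(1)[OF chart[OF V(1)]] B1(1)[OF that] by simp
      show "k \<otimes> h \<otimes> ?\<iota> z \<otimes> inv k \<in> U" if "z \<in> ball ?p \<epsilon>" for z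
        using R(8)[OF that] by (simp add: B3_def)
      have g: "jensen_lipschitz L1 (ball ?p \<epsilon>) ?g"
        by (rule jensen_lipschitz_mono[OF 1(5)[OF B1(1,2)[OF R(4)[OF h(2)]]]]) (use \<epsilon> \<eta> in auto)
      have gim: "?g ` ball ?p \<epsilon> \<subseteq> ball (\<xi> k0) \<eta>2"
        using B1(3)[OF R(5)] by blast
      have "jensen_lipschitz LL (ball ?p \<epsilon>) ((\<lambda>z. \<phi> (?\<iota>V z \<otimes> inv k)) \<circ> ?g)"
        unfolding LL_def
        by (rule jensen_lipschitz_compose[OF g 2(4)[OF B2(1,2)[OF R(6)[OF h(2)]]] gim])
          (use 1 2 in auto)
      then have "jensen_lipschitz LL (ball ?p \<epsilon>) ?f"
        by (rule jensen_lipschitz_cong) (simp_all add: iV[OF R(5)])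
      then show "jensen_lipschitz (1 / \<epsilon>) (ball ?p \<epsilon>) ?f"
        by (rule jensen_lipschitz_mono) (use LLe in auto)
      fix z z' assume z: "z \<in> ball ?p \<epsilon>" "z' \<in> ball ?p \<epsilon>"
      \<comment> \<open>Left multiplication by \<open>inv (k \<otimes> h)\<close> undoes the first
        factor, and in \<open>fg\<close> right multiplication by \<open>k\<close> undoes the second.
        The two Lipschitz constants then bound \<open>norm (z - z')\<close> by
        \<open>L3 * L4\<close> times the distance of the images.\<close>
      have recover: "z = \<phi> (inv (k \<otimes> h) \<otimes> ?\<iota>V (?g z))" if "z \<in> ball ?p \<epsilon>" for z
      proof -
        have "?\<iota> z \<in> carrier G" using R(3)[OF that] sub[OF U] by (auto simp: B3_def)
        then have "inv (k \<otimes> h) \<otimes> (k \<otimes> h \<otimes> ?\<iota> z) = ?\<iota> z"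
          using kh inv_solve_left'[of "?\<iota> z" "k \<otimes> h"] by simp
        then show ?thesis using iV[OF R(5)[OF that]] iU(2)[OF that] by simp
      qed
      have fg: "?g z = \<xi> (?\<iota> (?f z) \<otimes> k)" "?f z \<in> ball ?p \<eta>3" if "z \<in> ball ?p \<epsilon>" for z
      proof -
        have "?\<iota> z \<in> carrier G" using R(3)[OF that] sub[OF U] by (auto simp: B3_def)
        then have "k \<otimes> h \<otimes> ?\<iota> z \<otimes> inv k \<otimes> k = k \<otimes> h \<otimes> ?\<iota> z"
          using kh by (simp add: m_assoc)
        moreover have "?\<iota> (?f z) = k \<otimes> h \<otimes> ?\<iota> z \<otimes> inv k"
          using is_chart_inv_into(1)[OF chart[OF U]] R(8)[OF that] by (simp add: B3_def)
        ultimately show "?g z = \<xi> (?\<iota> (?f z) \<otimes> k)" by simp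
        show "?f z \<in> ball ?p \<eta>3" using R(8)[OF that] \<eta> by (simp add: B3_def)
      qed
      have "norm (z - z') \<le> L4 * norm (?g z - ?g z')"
        using jensen_lipschitzD(1)[OF 4(3)[OF B2(1,3)[OF R(7)[OF h(2)]]]
            B1(5)[OF R(5)[OF z(1)]] B1(5)[OF R(5)[OF z(2)]]] recover z by metis
      also have "\<dots> \<le> L4 * (L3 * norm (?f z - ?f z'))"
      proof (rule mult_left_mono)
        show "norm (?g z - ?g z') \<le> L3 * norm (?f z - ?f z')"
          using jensen_lipschitzD(1)[OF 3(3)[OF B1(1,4)[OF R(1)[OF h(2)]]] fg(2)[OF z(1)] fg(2)[OF z(2)]]
            fg(1)[OF z(1)] fg(1)[OF z(2)] by metis
      qed (use 4 in simp)
      finally have "norm (z - z') \<le> (L3 * L4) * norm (?f z - ?f z')" by (simp add: mult_ac)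
      then have "\<epsilon> * norm (z - z') \<le> \<epsilon> * ((L3 * L4) * norm (?f z - ?f z'))"
        using \<epsilon>(1) by simp
      also have "\<epsilon> * ((L3 * L4) * norm (?f z - ?f z')) = (\<epsilon> * (L3 * L4)) * norm (?f z - ?f z')" by simp
      also have "\<dots> \<le> 1 * norm (?f z - ?f z')"
        using \<epsilon>(5) 3(2) 4(2) by (intro mult_right_mono) (simp_all add: field_simps)
      finally show "\<epsilon> * norm (z - z') \<le> norm (?f z - ?f z')" by simp
    qed
  qed (use NM \<epsilon> in auto)
qed

text \<open>Finitely many of the local neighbourhoods cover the group, and the smallest of their
  constants works on all of them by monotonicity.\<close>

lemma conj_chart_bounds_uniform:
  fixes A :: "('g set \<times> ('g \<Rightarrow> 'd::euclidean_space)) set"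
  assumes lie: "lie_group_atlas G TG A" and "compact_space TG" and U: "(U, \<phi>) \<in> A" and e: "\<one>\<^bsub>G\<^esub> \<in> U"
  obtains \<epsilon> where "0 < \<epsilon>" and "\<And>k. k \<in> carrier G \<Longrightarrow> conj_chart_bounds G U \<phi> \<epsilon> k"
proof -
  have top: "topspace TG = carrier G"
    using lie by (simp add: lie_group_atlas_def topological_group_def)
  let ?\<U> = "{N. openin TG N \<and> (\<exists>\<epsilon>>0. \<forall>k\<in>N. conj_chart_bounds G U \<phi> \<epsilon> k)}"
  have "topspace TG \<subseteq> \<Union>?\<U>"
  proof
    fix k assume "k \<in> topspace TG"
    then obtain N \<epsilon> where "openin TG N" "k \<in> N" "0 < \<epsilon>" "\<And>k. k \<in> N \<Longrightarrow> conj_chart_bounds G U \<phi> \<epsilon> k"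
      using conj_chart_bounds_local[OF lie U e, of k] top by metis
    then show "k \<in> \<Union>?\<U>" by blast
  qed
  moreover have "compactin TG (topspace TG)" using assms(2) by (simp add: compact_space_def)
  ultimately obtain \<F> where \<F>: "finite \<F>" "\<F> \<subseteq> ?\<U>" "topspace TG \<subseteq> \<Union>\<F>"
    unfolding compactin_def by (elim conjE allE[of _ ?\<U>]) auto
  have "\<exists>\<epsilon>>0. \<forall>k\<in>\<Union>\<F>. conj_chart_bounds G U \<phi> \<epsilon> k"
    using \<F>(1,2)
  proof (induction \<F> rule: finite_induct)
    case (insert N \<F>)
    then obtain \<epsilon> \<epsilon>' where "0 < \<epsilon>" "\<forall>k\<in>\<Union>\<F>. conj_chart_bounds G U \<phi> \<epsilon> k"
        "0 < \<epsilon>'" "\<forall>k\<in>N. conj_chart_bounds G U \<phi> \<epsilon>' k" by auto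
    moreover from this have "conj_chart_bounds G U \<phi> (min \<epsilon> \<epsilon>') k" if "k \<in> N \<or> k \<in> \<Union>\<F>" for k
      using conj_chart_bounds_mono[of G U \<phi> \<epsilon> k "min \<epsilon> \<epsilon>'"]
        conj_chart_bounds_mono[of G U \<phi> \<epsilon>' k "min \<epsilon> \<epsilon>'"] that by fastforce
    ultimately have "\<forall>k\<in>\<Union>(insert N \<F>). conj_chart_bounds G U \<phi> (min \<epsilon> \<epsilon>') k" "0 < min \<epsilon> \<epsilon>'"
      by auto
    then show ?case by blast
  qed (simp add: exI[of _ 1])
  then show thesis using that \<F>(3) top by blast
qed

section \<open>Centers in compact Lie groups\<close>

lemma topological_group_maps:
  assumes "topological_group G TG"
  shows "group G" and "topspace TG = carrier G"
    and "\<And>X a b. \<lbrakk>continuous_map X TG a; continuous_map X TG b\<rbrakk> \<Longrightarrow>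
      continuous_map X TG (\<lambda>x. a x \<otimes>\<^bsub>G\<^esub> b x)"
    and "\<And>X a. continuous_map X TG a \<Longrightarrow> continuous_map X TG (\<lambda>x. inv\<^bsub>G\<^esub> (a x))"
proof -
  show "group G" "topspace TG = carrier G" using assms by (auto simp: topological_group_def)
  show "continuous_map X TG (\<lambda>x. a x \<otimes>\<^bsub>G\<^esub> b x)"
    if "continuous_map X TG a" "continuous_map X TG b" for X a b
    using continuous_map_binary[OF _ that, where f = "\<lambda>a b. a \<otimes>\<^bsub>G\<^esub> b"] assms
    by (simp add: topological_group_def)
  show "continuous_map X TG (\<lambda>x. inv\<^bsub>G\<^esub> (a x))" if "continuous_map X TG a" for X a
    using continuous_map_compose[OF that, of TG "\<lambda>a. inv\<^bsub>G\<^esub> a"] assms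
    by (simp add: topological_group_def o_def)
qed

text \<open>The last clause makes minimisers of weighted maxima of the functions \<open>N _ w\<close>, for \<open>w\<close> in a small set, unique.\<close>

definition center_function ::
    "('g, 'm) monoid_scheme \<Rightarrow> 'g topology \<Rightarrow> ('g \<Rightarrow> 'g \<Rightarrow> real) \<Rightarrow> real \<Rightarrow> bool" where
  "center_function G TG N r \<longleftrightarrow>
     continuous_map (prod_topology TG TG) euclideanreal (\<lambda>(x, y). N x y) \<and>
     (\<forall>x\<in>carrier G. \<forall>y\<in>carrier G. 0 \<le> N x y) \<and>
     (\<forall>x\<in>carrier G. \<forall>y\<in>carrier G. N x y = 0 \<longleftrightarrow> x = y) \<and>
     (\<forall>a\<in>carrier G. \<forall>x\<in>carrier G. \<forall>y\<in>carrier G. N (a \<otimes>\<^bsub>G\<^esub> x) (a \<otimes>\<^bsub>G\<^esub> y) = N x y) \<and>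
     (\<forall>a\<in>carrier G. \<forall>x\<in>carrier G. \<forall>y\<in>carrier G. N (x \<otimes>\<^bsub>G\<^esub> a) (y \<otimes>\<^bsub>G\<^esub> a) = N x y) \<and>
     0 < r \<and>
     (\<forall>x\<in>carrier G. \<forall>y\<in>carrier G. x \<noteq> y \<longrightarrow> N x \<one>\<^bsub>G\<^esub> < r \<longrightarrow> N y \<one>\<^bsub>G\<^esub> < r \<longrightarrow>
       (\<exists>m\<in>carrier G. \<forall>w\<in>carrier G. N \<one>\<^bsub>G\<^esub> w < r \<longrightarrow> N m w < max (N x w) (N y w)))"

text \<open>The chart midpoint of \<open>x\<close> and \<open>y\<close> is the required
  \<open>m\<close>, independently of \<open>w\<close>. For a given \<open>w\<close> only one
  conjugation matters, the one attaining the supremum at \<open>m\<close>: a strict inequality there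
  suffices, because at \<open>x\<close> and \<open>y\<close> the supremum can only be larger than
  the value for that conjugation.\<close>

lemma lie_group_center_function:
  fixes G (structure) and A :: "('g set \<times> ('g \<Rightarrow> 'd::euclidean_space)) set"
  assumes lie: "lie_group_atlas G TG A" and cpt: "compact_space TG"
  obtains N r where "center_function G TG N r"
proof -
  have tg: "topological_group G TG" and haus: "Hausdorff_space TG" and atl: "smooth_atlas TG A"
    using lie by (auto simp: lie_group_atlas_def smooth_manifold_def)
  interpret group G by (rule topological_group_maps(1)[OF tg])
  note top = topological_group_maps(2)[OF tg]
  note mul = topological_group_maps(3)[OF tg]
  note invc = topological_group_maps(4)[OF tg]
  have "\<one> \<in> (\<Union>(C, \<zeta>)\<in>A. C)" using atl top by (simp add: smooth_atlas_def)
  then obtain U \<phi> where U: "(U, \<phi>) \<in> A" and e: "\<one> \<in> U" by auto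
  have chart: "is_chart TG U \<phi>" using U atl by (auto simp: smooth_atlas_def)
  have UG: "U \<subseteq> carrier G" using chart openin_subset top by (fastforce simp: is_chart_def)
  let ?p = "\<phi> \<one>" and ?\<iota> = "inv_into U \<phi>"
  obtain \<epsilon> where \<epsilon>: "0 < \<epsilon>" and ccb: "\<And>k. k \<in> carrier G \<Longrightarrow> conj_chart_bounds G U \<phi> \<epsilon> k"
    using conj_chart_bounds_uniform[OF lie cpt U e] by blast
  have "open (\<phi> ` U)" "?p \<in> \<phi> ` U" using chart e by (auto simp: is_chart_def)
  then obtain \<rho> where \<rho>: "0 < \<rho>" "cball ?p \<rho> \<subseteq> \<phi> ` U" using open_contains_cball by blast
  \<comment> \<open>The closed ball of radius \<open>\<rho>\<close> lies inside the chart, so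
    truncating at \<open>\<rho>\<close> makes the extension by the constant \<open>\<rho>\<close>
    continuous.\<close>
  define \<nu>0 where "\<nu>0 g = (if g \<in> U then min \<rho> (norm (\<phi> g - ?p)) else \<rho>)" for g
  have \<nu>0_nonneg: "0 \<le> \<nu>0 g" for g using \<rho>(1) by (simp add: \<nu>0_def)
  have \<nu>0_cont: "continuous_map TG euclideanreal \<nu>0"
    unfolding continuous_map_upper_lower_semicontinuous_lte
  proof (intro conjI allI)
    fix a
    have "openin TG {x \<in> U. \<phi> x \<in> ball ?p a}" by (rule is_chart_openin_vimage[OF chart open_ball])
    moreover have "{x \<in> topspace TG. \<nu>0 x < a} =
        (if a \<le> \<rho> then {x \<in> U. \<phi> x \<in> ball ?p a} else topspace TG)"
      using UG top by (auto simp: \<nu>0_def dist_norm norm_minus_commute min_less_iff_disj)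
    ultimately show "openin TG {x \<in> topspace TG. \<nu>0 x < a}" by simp
    have "closedin TG {x \<in> U. \<phi> x \<in> cball ?p a}" if "a < \<rho>"
    proof (rule is_chart_closedin_vimage[OF chart haus compact_cball])
      show "cball ?p a \<subseteq> \<phi> ` U" using \<rho>(2) that by auto
    qed
    moreover have "{x \<in> topspace TG. \<nu>0 x \<le> a} =
        (if a < \<rho> then {x \<in> U. \<phi> x \<in> cball ?p a} else topspace TG)"
      using UG top by (auto simp: \<nu>0_def dist_norm norm_minus_commute min_le_iff_disj)
    ultimately show "closedin TG {x \<in> topspace TG. \<nu>0 x \<le> a}" by auto
  qed
  have ne: "topspace TG \<noteq> {}" using top by auto
  define \<nu> where "\<nu> g = (SUP k\<in>topspace TG. \<nu>0 (k \<otimes> g \<otimes> inv k))" for g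
  have conj_cont: "continuous_map (prod_topology TG TG) euclideanreal (\<lambda>(g, k). \<nu>0 (k \<otimes> g \<otimes> inv k))"
  proof -
    have "continuous_map (prod_topology TG TG) TG (\<lambda>x. snd x \<otimes> fst x \<otimes> inv (snd x))"
      by (intro mul invc continuous_map_fst continuous_map_snd)
    from continuous_map_compose[OF this \<nu>0_cont] show ?thesis
      by (simp add: o_def case_prod_unfold)
  qed
  have \<nu>_cont: "continuous_map TG euclideanreal \<nu>"
    unfolding \<nu>_def by (rule continuous_map_SUP[OF cpt ne conj_cont])
  have conj_cont1: "continuous_map TG euclideanreal (\<lambda>k. \<nu>0 (k \<otimes> g \<otimes> inv k))" if "g \<in> carrier G" for g
    using continuous_map_binary[OF conj_cont, of TG "\<lambda>_. g" "\<lambda>x. x"] that top by simp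
  have \<nu>_ge: "\<nu>0 (k \<otimes> g \<otimes> inv k) \<le> \<nu> g" if "g \<in> carrier G" "k \<in> carrier G" for g k
    unfolding \<nu>_def using compact_SUP_upper[OF cpt conj_cont1[OF that(1)]] that(2) top by simp
  have \<nu>_att: "\<exists>k\<in>carrier G. \<nu> g = \<nu>0 (k \<otimes> g \<otimes> inv k)" if "g \<in> carrier G" for g
    unfolding \<nu>_def using compact_SUP_attained[OF cpt ne conj_cont1[OF that]] top by auto
  have \<nu>_ge0: "\<nu>0 g \<le> \<nu> g" if "g \<in> carrier G" for g
    using \<nu>_ge[OF that one_closed] that by simp
  have \<nu>0_zero: "\<nu>0 g = 0 \<longleftrightarrow> g = \<one>" if "g \<in> carrier G" for g
  proof
    assume "\<nu>0 g = 0"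
    then have "g \<in> U" "\<phi> g = ?p" using \<rho>(1) by (auto simp: \<nu>0_def min_def split: if_splits)
    then show "g = \<one>" using is_chart_inv_into(1)[OF chart] e by metis
  qed (use e \<rho>(1) in \<open>simp add: \<nu>0_def\<close>)
  have \<nu>_zero: "\<nu> g = 0 \<longleftrightarrow> g = \<one>" if g: "g \<in> carrier G" for g
  proof
    assume "\<nu> g = 0"
    then have "\<nu>0 g = 0" using \<nu>_ge0[OF g] \<nu>0_nonneg[of g] by simp
    then show "g = \<one>" using \<nu>0_zero[OF g] by simp
  next
    assume "g = \<one>"
    then obtain k where "k \<in> carrier G" "\<nu> g = \<nu>0 (k \<otimes> \<one> \<otimes> inv k)" using \<nu>_att[OF g] by auto
    then show "\<nu> g = 0" using \<nu>0_zero[of \<one>] by simp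
  qed
  have \<nu>_nonneg: "0 \<le> \<nu> g" if "g \<in> carrier G" for g
    using \<nu>_ge0[OF that] \<nu>0_nonneg[of g] by linarith
  have \<nu>_conj_le: "\<nu> (inv a \<otimes> g \<otimes> a) \<le> \<nu> g" if ag: "a \<in> carrier G" "g \<in> carrier G" for a g
  proof -
    obtain k where k: "k \<in> carrier G" "\<nu> (inv a \<otimes> g \<otimes> a) = \<nu>0 (k \<otimes> (inv a \<otimes> g \<otimes> a) \<otimes> inv k)"
      using \<nu>_att[of "inv a \<otimes> g \<otimes> a"] ag by auto
    have "k \<otimes> (inv a \<otimes> g \<otimes> a) \<otimes> inv k = (k \<otimes> inv a) \<otimes> g \<otimes> inv (k \<otimes> inv a)"
      using k(1) ag by (simp add: m_assoc inv_mult_group)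
    then show ?thesis using \<nu>_ge[OF ag(2), of "k \<otimes> inv a"] k ag by simp
  qed
  have \<nu>_conj: "\<nu> (inv a \<otimes> g \<otimes> a) = \<nu> g" if "a \<in> carrier G" "g \<in> carrier G" for a g
  proof (rule antisym[OF \<nu>_conj_le[OF that]])
    have "inv (inv a) \<otimes> (inv a \<otimes> g \<otimes> a) \<otimes> inv a = g"
      using that by (simp add: m_assoc) (simp flip: m_assoc)
    then show "\<nu> g \<le> \<nu> (inv a \<otimes> g \<otimes> a)"
      using \<nu>_conj_le[of "inv a" "inv a \<otimes> g \<otimes> a"] that by simp
  qed
  define N where "N x y = \<nu> (inv y \<otimes> x)" for x y
  \<comment> \<open>In coordinates a conjugated translation is
    \<open>1 / \<epsilon>\<close>-Lipschitz and moves \<open>?p\<close> by less than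
    \<open>r\<close>, so points within \<open>r\<close> of \<open>?p\<close> stay within
    \<open>r / \<epsilon> + r \<le> c\<close>. The bound \<open>\<epsilon> ^ 3 / 8\<close> is the
    radius of strict quasiconvexity, and \<open>\<rho>\<close> keeps the truncation
    inactive.\<close>
  define c where "c = min \<rho> (\<epsilon> ^ 3 / 8)"
  define r where "r = min (min \<rho> \<epsilon>) (c / (1 / \<epsilon> + 1))"
  have r: "0 < r" "r \<le> \<rho>" "r \<le> \<epsilon>" "r \<le> c / (1 / \<epsilon> + 1)"
    using \<rho>(1) \<epsilon> by (auto simp: r_def c_def add_pos_pos)
  have r_small: "(1 / \<epsilon>) * r + r \<le> c"
  proof -
    have "r * (1 / \<epsilon> + 1) \<le> c"
      using r(4) \<epsilon> pos_le_divide_eq[of "1 / \<epsilon> + 1" r c] by (simp add: add_pos_pos)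
    then show ?thesis by (simp add: algebra_simps)
  qed
  have small: "g \<in> U \<and> norm (\<phi> g - ?p) = \<nu>0 g" if "\<nu>0 g < \<rho>" for g
    using that by (auto simp: \<nu>0_def min_def split: if_splits)
  have "center_function G TG N r"
    unfolding center_function_def
  proof (intro conjI ballI impI)
    have "continuous_map (prod_topology TG TG) TG (\<lambda>x. inv (snd x) \<otimes> fst x)"
      by (intro mul invc continuous_map_fst continuous_map_snd)
    from continuous_map_compose[OF this \<nu>_cont]
    show "continuous_map (prod_topology TG TG) euclideanreal (\<lambda>(x, y). N x y)"
      by (simp add: o_def case_prod_unfold N_def)
    show "0 \<le> N x y" if "x \<in> carrier G" "y \<in> carrier G" for x y
      using that \<nu>_nonneg by (simp add: N_def)
    show "N x y = 0 \<longleftrightarrow> x = y" if "x \<in> carrier G" "y \<in> carrier G" for x y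
      using that \<nu>_zero[of "inv y \<otimes> x"] inv_solve_left'[of \<one> y x] by (auto simp: N_def)
    show "N (a \<otimes> x) (a \<otimes> y) = N x y" if "a \<in> carrier G" "x \<in> carrier G" "y \<in> carrier G" for a x y
    proof -
      have "inv (a \<otimes> y) \<otimes> (a \<otimes> x) = inv y \<otimes> x"
        using that by (simp add: inv_mult_group m_assoc) (simp flip: m_assoc)
      then show ?thesis by (simp add: N_def)
    qed
    show "N (x \<otimes> a) (y \<otimes> a) = N x y" if "a \<in> carrier G" "x \<in> carrier G" "y \<in> carrier G" for a x y
    proof -
      have "inv (y \<otimes> a) \<otimes> (x \<otimes> a) = inv a \<otimes> (inv y \<otimes> x) \<otimes> a"
        using that by (simp add: inv_mult_group m_assoc)
      then show ?thesis using \<nu>_conj that by (simp add: N_def)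
    qed
    show "0 < r" by (rule r)
  next
    fix x y assume x: "x \<in> carrier G" and y: "y \<in> carrier G" and xy: "x \<noteq> y"
      and Nx: "N x \<one> < r" and Ny: "N y \<one> < r"
    have near: "g \<in> U" "norm (\<phi> g - ?p) < r" if "g \<in> carrier G" "\<nu> g < r" for g
      using small[of g] \<nu>_ge0[OF that(1)] that r by auto
    have \<nu>xy: "\<nu> x < r" "\<nu> y < r" using Nx Ny x y by (auto simp: N_def)
    note xU = near[OF x \<nu>xy(1)] and yU = near[OF y \<nu>xy(2)]
    have inx: "\<phi> x \<in> ball ?p \<epsilon>" and iny: "\<phi> y \<in> ball ?p \<epsilon>" and inp: "?p \<in> ball ?p \<epsilon>"
      using xU yU r(3) \<epsilon> by (auto simp: dist_norm norm_minus_commute)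
    have ballU: "ball ?p \<epsilon> \<subseteq> \<phi> ` U" using ccb[OF one_closed] by (simp add: conj_chart_bounds_def)
    let ?z = "midpoint (\<phi> x) (\<phi> y)"
    have inz: "?z \<in> ball ?p \<epsilon>" by (rule midpoint_in_convex[OF convex_ball inx iny])
    define m where "m = ?\<iota> ?z"
    have \<iota>G: "?\<iota> z \<in> carrier G" if "z \<in> ball ?p \<epsilon>" for z
      using is_chart_inv_into(2)[OF chart subsetD[OF ballU that]] UG by blast
    have m: "m \<in> carrier G" using \<iota>G[OF inz] by (simp add: m_def)
    have \<phi>xy: "\<phi> x \<noteq> \<phi> y" using xy xU yU is_chart_inv_into(1)[OF chart] by metis
    have "N m w < max (N x w) (N y w)" if w: "w \<in> carrier G" "N \<one> w < r" for w
    proof -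
      \<comment> \<open>\<open>N g w = \<nu> (h \<otimes> g)\<close>, so \<open>w\<close> enters
        only through left translation by \<open>h\<close>, and \<open>N \<one> w < r\<close> puts
        \<open>h\<close> near the identity.\<close>
      define h where "h = inv w"
      have h: "h \<in> carrier G" "\<nu> h < r" using w by (auto simp: h_def N_def)
      note hU = near[OF h]
      obtain k where k: "k \<in> carrier G" "\<nu> (h \<otimes> m) = \<nu>0 (k \<otimes> (h \<otimes> m) \<otimes> inv k)"
        using \<nu>_att[of "h \<otimes> m"] h m by auto
      define f where "f = (\<lambda>z. \<phi> (k \<otimes> h \<otimes> ?\<iota> z \<otimes> inv k))"
      have fin: "k \<otimes> h \<otimes> ?\<iota> z \<otimes> inv k \<in> U" if "z \<in> ball ?p \<epsilon>" for z
        using ccb[OF k(1)] hU r(3) that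
        by (auto simp: conj_chart_bounds_def Let_def dist_norm norm_minus_commute)
      have fjl: "jensen_lipschitz (1 / \<epsilon>) (ball ?p \<epsilon>) f"
        and flow: "\<And>z z'. \<lbrakk>z \<in> ball ?p \<epsilon>; z' \<in> ball ?p \<epsilon>\<rbrakk> \<Longrightarrow> \<epsilon> * norm (z - z') \<le> norm (f z - f z')"
        using ccb[OF k(1)] hU r(3)
        by (auto simp: conj_chart_bounds_def Let_def dist_norm norm_minus_commute f_def)
      have f_upper: "\<nu>0 (k \<otimes> (h \<otimes> ?\<iota> z) \<otimes> inv k) \<le> norm (f z - ?p)" if "z \<in> ball ?p \<epsilon>" for z
        using \<iota>G[OF that] fin[OF that] k h by (simp add: f_def \<nu>0_def m_assoc)
      \<comment> \<open>\<open>f ?p\<close> is the coordinate of a conjugate of \<open>h\<close>,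
        and \<open>\<nu> h\<close> dominates \<open>\<nu>0\<close> on all conjugates.\<close>
      have f_e: "norm (f ?p - ?p) < r"
      proof -
        have "\<nu>0 (k \<otimes> h \<otimes> inv k) < r" using \<nu>_ge[OF h(1) k(1)] h(2) by simp
        then show ?thesis
          using small[of "k \<otimes> h \<otimes> inv k"] r(2) is_chart_inv_into(1)[OF chart e] k h by (simp add: f_def)
      qed
      have f_small: "norm (f (\<phi> g) - ?p) < c" if "\<phi> g \<in> ball ?p \<epsilon>" "norm (\<phi> g - ?p) < r" for g
      proof -
        have "norm (f (\<phi> g) - ?p) \<le> norm (f (\<phi> g) - f ?p) + norm (f ?p - ?p)"
          using norm_triangle_ineq[of "f (\<phi> g) - f ?p" "f ?p - ?p"] by simp
        moreover have "norm (f (\<phi> g) - f ?p) \<le> (1 / \<epsilon>) * norm (\<phi> g - ?p)"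
          by (rule jensen_lipschitzD(1)[OF fjl that(1) inp])
        moreover have "(1 / \<epsilon>) * norm (\<phi> g - ?p) \<le> (1 / \<epsilon>) * r"
          using that(2) \<epsilon> by (intro mult_left_mono) auto
        ultimately show ?thesis using f_e r_small by linarith
      qed
      have lt: "norm (f ?z - ?p) < max (norm (f (\<phi> x) - ?p)) (norm (f (\<phi> y) - ?p))"
        by (rule jensen_lipschitz_strict_quasiconvex[OF fjl inx iny \<phi>xy \<epsilon> flow[OF inx iny]
            less_le_trans[OF f_small[OF inx xU(2)]] less_le_trans[OF f_small[OF iny yU(2)]]])
          (simp_all add: c_def)
      have le_\<nu>: "\<nu>0 (k \<otimes> (h \<otimes> g) \<otimes> inv k) \<le> \<nu> (h \<otimes> g)" if "g \<in> carrier G" for g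
        using \<nu>_ge h k that by simp
      have f_eq: "min \<rho> (norm (f (\<phi> g) - ?p)) \<le> \<nu> (h \<otimes> g)" if "g \<in> U" "\<phi> g \<in> ball ?p \<epsilon>" for g
      proof -
        have "g \<in> carrier G" using that UG by auto
        then show ?thesis
          using le_\<nu>[of g] fin[OF that(2)] is_chart_inv_into(1)[OF chart that(1)] k h
          by (simp add: f_def \<nu>0_def m_assoc)
      qed
      have "N m w = \<nu>0 (k \<otimes> (h \<otimes> m) \<otimes> inv k)" using k(2) by (simp add: N_def h_def)
      also have "\<dots> \<le> min \<rho> (norm (f ?z - ?p))"
        using f_upper[OF inz] by (simp add: m_def \<nu>0_def)
      finally have 1: "N m w \<le> min \<rho> (norm (f ?z - ?p))" .
      \<comment> \<open>The images of \<open>x\<close> and \<open>y\<close> are at distance below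
        \<open>c \<le> \<rho>\<close>, so truncation does not spoil the strict inequality.\<close>
      have "N m w < max (min \<rho> (norm (f (\<phi> x) - ?p))) (min \<rho> (norm (f (\<phi> y) - ?p)))"
        using 1 lt f_small[OF inx xU(2)] f_small[OF iny yU(2)] by (auto simp: c_def)
      also have "\<dots> \<le> max (N x w) (N y w)"
        using f_eq[OF xU(1) inx] f_eq[OF yU(1) iny] by (auto simp: N_def h_def)
      finally show ?thesis .
    qed
    then show "\<exists>m\<in>carrier G. \<forall>w\<in>carrier G. N \<one> w < r \<longrightarrow> N m w < max (N x w) (N y w)"
      using m by blast
  qed
  then show thesis by (rule that)
qed

lemma compact_lie_group_center_function:
  assumes "compact_lie_group G TG TYPE('d::euclidean_space)"
  obtains N r where "center_function G TG N r"
proof -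
  have tg: "topological_group G TG" and cpt: "compact_space TG"
    using assms by (auto simp: compact_lie_group_def)
  interpret group G by (rule topological_group_maps(1)[OF tg])
  consider "TG = discrete_topology (carrier G)"
    | A :: "('a set \<times> ('a \<Rightarrow> 'd)) set" where "lie_group_atlas G TG A"
    using assms unfolding compact_lie_group_def by blast
  then show thesis
  proof cases
    case 1
    \<comment> \<open>In the discrete case radius \<open>1\<close> leaves only the identity within
      reach of the identity, so the clause on distinct \<open>x\<close> and \<open>y\<close> holds
      vacuously.\<close>
    have "center_function G TG (\<lambda>x y. if x = y then 0 else 1) 1"
      using 1 by (auto simp: center_function_def prod_topology_discrete_topology[symmetric])
    then show thesis by (rule that)
  qed (use lie_group_center_function cpt that in blast)
qed

section \<open>Transport between orbits of a free action\<close>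

lemma (in group) image_right_mult: "a \<in> carrier G \<Longrightarrow> (\<lambda>k. k \<otimes> a) ` carrier G = carrier G"
proof (intro subset_antisym subsetI)
  fix x assume "a \<in> carrier G" "x \<in> carrier G"
  then show "x \<in> (\<lambda>k. k \<otimes> a) ` carrier G"
    by (intro image_eqI[of _ _ "x \<otimes> inv a"]) (simp_all add: m_assoc)
qed auto

lemma (in group) image_left_mult: "a \<in> carrier G \<Longrightarrow> (\<lambda>k. a \<otimes> k) ` carrier G = carrier G"
proof (intro subset_antisym subsetI)
  fix x assume "a \<in> carrier G" "x \<in> carrier G"
  then show "x \<in> (\<lambda>k. a \<otimes> k) ` carrier G"
    by (intro image_eqI[of _ _ "inv a \<otimes> x"]) (simp_all flip: m_assoc)
qed auto

text \<open>Translation invariance of suprema takes the place of the invariance of a Haar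
  integral.\<close>

lemma (in group) SUP_right_mult:
  "a \<in> carrier G \<Longrightarrow> (SUP k\<in>carrier G. F (k \<otimes> a)) = (SUP k\<in>carrier G. F k :: real)"
  using image_image[of F "\<lambda>k. k \<otimes> a" "carrier G"] by (simp add: image_right_mult)

lemma (in group) SUP_left_mult:
  "a \<in> carrier G \<Longrightarrow> (SUP k\<in>carrier G. F (a \<otimes> k)) = (SUP k\<in>carrier G. F k :: real)"
  using image_image[of F "\<lambda>k. a \<otimes> k" "carrier G"] by (simp add: image_left_mult)

locale free_isometric_action =
  fixes G :: "('g, 'm) monoid_scheme" (structure) and TG :: "'g topology" and TZ :: "'z topology"
    and act :: "'g \<Rightarrow> 'z \<Rightarrow> 'z" and d :: "'z \<Rightarrow> 'z \<Rightarrow> real" and N :: "'g \<Rightarrow> 'g \<Rightarrow> real" and r :: real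
  assumes compact_group: "compact_space TG"
    and action: "continuous_action G TG TZ act"
    and free: "\<lbrakk>g \<in> carrier G; z \<in> topspace TZ; act g z = z\<rbrakk> \<Longrightarrow> g = \<one>"
    and center: "center_function G TG N r"
    and d_cont: "continuous_map (prod_topology TZ TZ) euclideanreal (\<lambda>(z, w). d z w)"
    and d_nonneg: "\<lbrakk>z \<in> topspace TZ; w \<in> topspace TZ\<rbrakk> \<Longrightarrow> 0 \<le> d z w"
    and d_zero: "\<lbrakk>z \<in> topspace TZ; w \<in> topspace TZ\<rbrakk> \<Longrightarrow> d z w = 0 \<longleftrightarrow> z = w"
    and d_commute: "\<lbrakk>z \<in> topspace TZ; w \<in> topspace TZ\<rbrakk> \<Longrightarrow> d z w = d w z"
    and d_triangle: "\<lbrakk>z \<in> topspace TZ; w \<in> topspace TZ; x \<in> topspace TZ\<rbrakk> \<Longrightarrow> d z x \<le> d z w + d w x"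
    and d_act: "\<lbrakk>g \<in> carrier G; z \<in> topspace TZ; w \<in> topspace TZ\<rbrakk> \<Longrightarrow> d (act g z) (act g w) = d z w"
begin

lemma tg: "topological_group G TG"
  using action by (simp add: continuous_action_def)

sublocale group G by (rule topological_group_maps(1)[OF tg])

lemmas top = topological_group_maps(2)[OF tg]

lemma ne: "topspace TG \<noteq> {}" using top by auto

lemma act_cont:
  assumes "continuous_map X TG a" and "continuous_map X TZ b"
  shows "continuous_map X TZ (\<lambda>x. act (a x) (b x))"
  by (rule continuous_map_binary[OF _ assms]) (use action in \<open>simp add: continuous_action_def\<close>)

lemma act_closed [simp, intro]: "\<lbrakk>g \<in> carrier G; z \<in> topspace TZ\<rbrakk> \<Longrightarrow> act g z \<in> topspace TZ"
proof -
  assume "g \<in> carrier G" "z \<in> topspace TZ"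
  moreover have "(\<lambda>(g, z). act g z) \<in> topspace (prod_topology TG TZ) \<rightarrow> topspace TZ"
    using action unfolding continuous_action_def by (blast dest: continuous_map_funspace)
  ultimately show "act g z \<in> topspace TZ"
    using funcset_mem[of "\<lambda>(g, z). act g z" _ _ "(g, z)"] top by force
qed

lemma act_one [simp]: "z \<in> topspace TZ \<Longrightarrow> act \<one> z = z"
  using action by (simp add: continuous_action_def)

lemma act_mult: "\<lbrakk>g \<in> carrier G; h \<in> carrier G; z \<in> topspace TZ\<rbrakk> \<Longrightarrow> act (g \<otimes> h) z = act g (act h z)"
  using action by (simp add: continuous_action_def)

lemma N_cont: "continuous_map (prod_topology TG TG) euclideanreal (\<lambda>(x, y). N x y)"
  and N_nonneg: "\<lbrakk>x \<in> carrier G; y \<in> carrier G\<rbrakk> \<Longrightarrow> 0 \<le> N x y"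
  and N_zero: "\<lbrakk>x \<in> carrier G; y \<in> carrier G\<rbrakk> \<Longrightarrow> N x y = 0 \<longleftrightarrow> x = y"
  and N_left: "\<lbrakk>a \<in> carrier G; x \<in> carrier G; y \<in> carrier G\<rbrakk> \<Longrightarrow> N (a \<otimes> x) (a \<otimes> y) = N x y"
  and N_right: "\<lbrakk>a \<in> carrier G; x \<in> carrier G; y \<in> carrier G\<rbrakk> \<Longrightarrow> N (x \<otimes> a) (y \<otimes> a) = N x y"
  and r_pos: "0 < r"
  using center by (simp_all add: center_function_def)

lemma N_center:
  "\<lbrakk>x \<in> carrier G; y \<in> carrier G; x \<noteq> y; N x \<one> < r; N y \<one> < r\<rbrakk> \<Longrightarrow>
    \<exists>m\<in>carrier G. \<forall>w\<in>carrier G. N \<one> w < r \<longrightarrow> N m w < max (N x w) (N y w)"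
  using center by (simp add: center_function_def)

text \<open>The second term is positive exactly where \<open>N \<one> g < r\<close>, in particular
  at the identity, where the first term vanishes. Elsewhere freeness makes the first term
  positive.\<close>

definition disp :: "'z \<Rightarrow> 'g \<Rightarrow> real" where
  "disp z g = d z (act g z) + max 0 (r - N \<one> g)"

text \<open>A radius of freeness: an element that moves \<open>z\<close> by less than
  \<open>mu z\<close> satisfies \<open>N \<one> g < r\<close>.\<close>

definition mu :: "'z \<Rightarrow> real" where
  "mu z = (INF g\<in>topspace TG. disp z g)"

text \<open>The cutoff is half of \<open>mu z\<close> because two points of one orbit with positive
  weight are compared through \<open>z\<close>, and their two distances must add up to less than
  \<open>mu z\<close>.\<close>

definition wt :: "'z \<Rightarrow> 'z \<Rightarrow> real" where
  "wt z w = max 0 (mu z / 2 - d z w)"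

definition beta :: "'z \<Rightarrow> 'z \<Rightarrow> real" where
  "beta z w = (SUP k\<in>topspace TG. wt z (act k w))"

definition energy :: "'z \<Rightarrow> 'z \<Rightarrow> 'g \<Rightarrow> real" where
  "energy z w g = (SUP k\<in>topspace TG. wt z (act k w) * N g k)"

text \<open>Some minimiser always exists by compactness; it is unique, hence canonical, where
  \<open>beta z w > 0\<close>.\<close>

definition centre :: "'z \<Rightarrow> 'z \<Rightarrow> 'g" where
  "centre z w = (SOME g. g \<in> carrier G \<and> (\<forall>k\<in>carrier G. energy z w g \<le> energy z w k))"

text \<open>The factor \<open>inv (centre z z)\<close> forces \<open>transport z z = z\<close>,
  whatever element \<open>centre z z\<close> is.\<close>

definition transport :: "'z \<Rightarrow> 'z \<Rightarrow> 'z" where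
  "transport z w = act (inv (centre z z) \<otimes> centre z w) w"

lemma disp_cont: "continuous_map (prod_topology TZ TG) euclideanreal (\<lambda>(z, g). disp z g)"
proof -
  have "continuous_map (prod_topology TZ TG) euclideanreal
      (\<lambda>x. d (fst x) (act (snd x) (fst x)) + max 0 (r - N \<one> (snd x)))"
    by (intro continuous_map_add continuous_map_real_max continuous_map_diff
        continuous_map_binary[OF d_cont] continuous_map_binary[OF N_cont] act_cont
        continuous_map_fst continuous_map_snd) (auto simp: top)
  then show ?thesis by (simp add: disp_def case_prod_unfold)
qed

lemma disp_cont1: "z \<in> topspace TZ \<Longrightarrow> continuous_map TG euclideanreal (disp z)"
  using continuous_map_binary[OF disp_cont, of TG "\<lambda>_. z" "\<lambda>x. x"] by simp

lemma mu_cont: "continuous_map TZ euclideanreal mu"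
  unfolding mu_def by (rule continuous_map_INF[OF compact_group ne disp_cont])

lemma mu_le: "\<lbrakk>z \<in> topspace TZ; g \<in> carrier G\<rbrakk> \<Longrightarrow> mu z \<le> disp z g"
  unfolding mu_def using compact_INF_lower[OF compact_group disp_cont1] top by simp

lemma mu_att: "z \<in> topspace TZ \<Longrightarrow> \<exists>g\<in>carrier G. mu z = disp z g"
  unfolding mu_def using compact_INF_attained[OF compact_group ne disp_cont1[of z]] unfolding top by metis

lemma mu_pos:
  assumes z: "z \<in> topspace TZ"
  shows "0 < mu z"
proof -
  obtain g where g: "g \<in> carrier G" "mu z = disp z g" using mu_att[OF z] by blast
  show ?thesis
  proof (cases "act g z = z")
    case True
    then have "g = \<one>" using free g z by blast
    then have "N \<one> g = 0" using N_zero by simp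
    then show ?thesis using g r_pos d_nonneg[of z "act g z"] z by (simp add: disp_def)
  next
    case False
    then have "0 < d z (act g z)" using d_nonneg[of z "act g z"] d_zero[of z "act g z"] g z by auto
    then show ?thesis using g by (simp add: disp_def)
  qed
qed

text \<open>By the triangle inequality and invariance of \<open>d\<close>, the element
  \<open>k \<otimes> inv l\<close> moves \<open>z\<close> by less than \<open>mu z\<close>. So
  \<open>N \<one> (k \<otimes> inv l) < r\<close>, and right invariance turns this into the
  claim.\<close>

lemma near_in_fibre:
  assumes z: "z \<in> topspace TZ" and w: "w \<in> topspace TZ" and k: "k \<in> carrier G" "l \<in> carrier G"
    and pos: "0 < wt z (act k w)" "0 < wt z (act l w)"
  shows "N l k < r"
proof -
  let ?g = "k \<otimes> inv l"
  have g: "?g \<in> carrier G" using k by simp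
  have "act ?g (act l w) = act k w"
    using k w by (simp flip: act_mult add: m_assoc)
  then have "d (act k w) (act ?g z) = d (act l w) z"
    using d_act[OF g, of "act l w" z] z w k by simp
  then have "d z (act ?g z) \<le> d z (act k w) + d z (act l w)"
    using d_triangle[of z "act k w" "act ?g z"] d_commute[of z "act l w"] z w k g by simp
  then have "d z (act ?g z) < mu z" using pos by (simp add: wt_def)
  then have "N \<one> ?g < r" using mu_le[OF z g] by (simp add: disp_def max_def split: if_splits)
  moreover have "N \<one> ?g = N (\<one> \<otimes> l) (?g \<otimes> l)" using N_right[of l \<one> ?g] k by simp
  ultimately show ?thesis using k by (simp add: m_assoc)
qed

lemma wt_cont:
  assumes "continuous_map X TZ a" and "continuous_map X TZ b"
  shows "continuous_map X euclideanreal (\<lambda>x. wt (a x) (b x))"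
proof -
  have "continuous_map X euclideanreal (\<lambda>x. mu (a x))"
    using continuous_map_compose[OF assms(1) mu_cont] by (simp add: o_def)
  then have "continuous_map X euclideanreal (\<lambda>x. max 0 (mu (a x) / 2 - d (a x) (b x)))"
    by (intro continuous_map_real_max continuous_map_diff continuous_map_real_divide
        continuous_map_binary[OF d_cont] assms) auto
  then show ?thesis by (simp add: wt_def)
qed

lemma wt_nonneg: "0 \<le> wt z w" by (simp add: wt_def)

lemma beta_cont: "continuous_map (prod_topology TZ TZ) euclideanreal (\<lambda>(z, w). beta z w)"
proof -
  let ?X = "prod_topology (prod_topology TZ TZ) TG"
  have "continuous_map ?X euclideanreal (\<lambda>x. wt (fst (fst x)) (act (snd x) (snd (fst x))))"
    by (intro wt_cont act_cont continuous_map_snd continuous_map_fst_of[unfolded o_def]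
        continuous_map_compose[OF continuous_map_fst continuous_map_fst, unfolded o_def]
        continuous_map_compose[OF continuous_map_fst continuous_map_snd, unfolded o_def])
  then show ?thesis
    unfolding beta_def case_prod_unfold
    by (intro continuous_map_SUP[OF compact_group ne]) (simp add: case_prod_unfold)
qed

lemma wt_cont1:
  "\<lbrakk>z \<in> topspace TZ; w \<in> topspace TZ\<rbrakk> \<Longrightarrow> continuous_map TG euclideanreal (\<lambda>k. wt z (act k w))"
  by (intro wt_cont act_cont) auto

lemma beta_ge: "\<lbrakk>z \<in> topspace TZ; w \<in> topspace TZ; k \<in> carrier G\<rbrakk> \<Longrightarrow> wt z (act k w) \<le> beta z w"
  unfolding beta_def using compact_SUP_upper[OF compact_group wt_cont1] top by simp

lemma beta_att: "\<lbrakk>z \<in> topspace TZ; w \<in> topspace TZ\<rbrakk> \<Longrightarrow> \<exists>k\<in>carrier G. beta z w = wt z (act k w)"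
  unfolding beta_def using compact_SUP_attained[OF compact_group ne wt_cont1[of z w]] unfolding top by metis

lemma beta_nonneg: "\<lbrakk>z \<in> topspace TZ; w \<in> topspace TZ\<rbrakk> \<Longrightarrow> 0 \<le> beta z w"
  using beta_ge[of z w \<one>] wt_nonneg[of z "act \<one> w"] by simp

lemma beta_diag:
  assumes z: "z \<in> topspace TZ"
  shows "0 < beta z z"
proof -
  have "0 < wt z (act \<one> z)" using mu_pos[OF z] d_zero[of z z] z by (simp add: wt_def)
  then show ?thesis using beta_ge[OF z z one_closed] by linarith
qed

lemma energy_cont:
  "continuous_map (prod_topology (prod_topology TZ TZ) TG) euclideanreal (\<lambda>(p, g). energy (fst p) (snd p) g)"
proof -
  let ?X = "prod_topology (prod_topology (prod_topology TZ TZ) TG) TG"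
  have p: "continuous_map ?X (prod_topology TZ TZ) (\<lambda>x. fst (fst x))"
      "continuous_map ?X TG (\<lambda>x. snd (fst x))"
    using continuous_map_compose[OF continuous_map_fst[of "prod_topology (prod_topology TZ TZ) TG" TG] continuous_map_fst]
      continuous_map_compose[OF continuous_map_fst[of "prod_topology (prod_topology TZ TZ) TG" TG] continuous_map_snd]
    by (simp_all add: o_def)
  have q: "continuous_map ?X TZ (\<lambda>x. fst (fst (fst x)))" "continuous_map ?X TZ (\<lambda>x. snd (fst (fst x)))"
    using continuous_map_compose[OF p(1) continuous_map_fst] continuous_map_compose[OF p(1) continuous_map_snd]
    by (simp_all add: o_def)
  have "continuous_map ?X euclideanreal
      (\<lambda>x. wt (fst (fst (fst x))) (act (snd x) (snd (fst (fst x)))) * N (snd (fst x)) (snd x))"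
    by (intro continuous_map_real_mult wt_cont act_cont continuous_map_binary[OF N_cont]
        p q continuous_map_snd)
  then show ?thesis
    unfolding energy_def case_prod_unfold
    by (intro continuous_map_SUP[OF compact_group ne]) (simp add: case_prod_unfold)
qed

lemma energy_cont1:
  assumes "z \<in> topspace TZ" and "w \<in> topspace TZ"
  shows "continuous_map TG euclideanreal (energy z w)"
  using continuous_map_binary[OF energy_cont, of TG "\<lambda>_. (z, w)" "\<lambda>x. x"] assms by simp

lemma energy_summand_cont:
  "\<lbrakk>z \<in> topspace TZ; w \<in> topspace TZ; g \<in> carrier G\<rbrakk> \<Longrightarrow>
    continuous_map TG euclideanreal (\<lambda>k. wt z (act k w) * N g k)"
  by (intro continuous_map_real_mult wt_cont1 continuous_map_binary[OF N_cont]) (auto simp: top)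

lemma energy_ge: "\<lbrakk>z \<in> topspace TZ; w \<in> topspace TZ; g \<in> carrier G; k \<in> carrier G\<rbrakk> \<Longrightarrow>
    wt z (act k w) * N g k \<le> energy z w g"
  unfolding energy_def using compact_SUP_upper[OF compact_group energy_summand_cont] top by simp

lemma energy_att: "\<lbrakk>z \<in> topspace TZ; w \<in> topspace TZ; g \<in> carrier G\<rbrakk> \<Longrightarrow>
    \<exists>k\<in>carrier G. energy z w g = wt z (act k w) * N g k"
  unfolding energy_def using compact_SUP_attained[OF compact_group ne energy_summand_cont[of z w g]]
  unfolding top by metis

text \<open>Two distinct minimisers would both lie near an element \<open>l\<close> of largest
  weight. After right translation by \<open>inv l\<close> they are in the range where
  \<open>center_function\<close> supplies an element strictly better at every \<open>k\<close> of
  positive weight, hence of smaller energy.\<close>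

lemma energy_minimizer_unique:
  assumes z: "z \<in> topspace TZ" and w: "w \<in> topspace TZ" and pos: "0 < beta z w"
    and x: "x \<in> carrier G" "\<And>k. k \<in> carrier G \<Longrightarrow> energy z w x \<le> energy z w k"
    and y: "y \<in> carrier G" "\<And>k. k \<in> carrier G \<Longrightarrow> energy z w y \<le> energy z w k"
  shows "x = y"
proof (rule ccontr)
  assume "x \<noteq> y"
  obtain l where l: "l \<in> carrier G" "beta z w = wt z (act l w)" using beta_att[OF z w] by blast
  have eq: "energy z w x = energy z w y" using x y by (simp add: antisym)
  \<comment> \<open>Every nonzero term of \<open>energy z w l\<close> is a weight at most
    \<open>beta z w\<close> times a value below \<open>r\<close>. Since \<open>l\<close> itself
    carries the weight \<open>beta z w\<close>, every \<open>g\<close> of no larger energy satisfies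
    \<open>N g l < r\<close>.\<close>
  have "energy z w l < beta z w * r"
  proof -
    obtain k where k: "k \<in> carrier G" "energy z w l = wt z (act k w) * N l k"
      using energy_att[OF z w l(1)] by blast
    show ?thesis
    proof (cases "0 < wt z (act k w)")
      case True
      then have "wt z (act k w) * N l k < wt z (act k w) * r"
        using near_in_fibre[OF z w k(1) l(1)] pos l(2) by simp
      also have "\<dots> \<le> beta z w * r"
        using beta_ge[OF z w k(1)] r_pos by (intro mult_right_mono) auto
      finally show ?thesis using k(2) by simp
    next
      case False
      then have "wt z (act k w) = 0" using wt_nonneg[of z "act k w"] by simp
      then show ?thesis using k(2) pos r_pos by simp
    qed
  qed
  then have near: "N g l < r" if "g \<in> carrier G" "energy z w g \<le> energy z w l" for g
  proof -
    have "beta z w * N g l < beta z w * r"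
      using energy_ge[OF z w that(1) l(1)] that(2) l(2) \<open>energy z w l < beta z w * r\<close> by simp
    then show ?thesis using pos by simp
  qed
  have shift: "N (g \<otimes> inv l) (h \<otimes> inv l) = N g h" if "g \<in> carrier G" "h \<in> carrier G" for g h
    using N_right[of "inv l" g h] that l by simp
  have "N (x \<otimes> inv l) \<one> < r" "N (y \<otimes> inv l) \<one> < r"
    using near x y l shift[of x l] shift[of y l] by simp_all
  moreover have "x \<otimes> inv l \<noteq> y \<otimes> inv l" using \<open>x \<noteq> y\<close> x y l by simp
  ultimately obtain m' where m': "m' \<in> carrier G"
      "\<forall>h\<in>carrier G. N \<one> h < r \<longrightarrow> N m' h < max (N (x \<otimes> inv l) h) (N (y \<otimes> inv l) h)"
    using N_center[of "x \<otimes> inv l" "y \<otimes> inv l"] x y l by auto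
  define m where "m = m' \<otimes> l"
  have m: "m \<in> carrier G" "m \<otimes> inv l = m'" using m' l by (simp_all add: m_def m_assoc)
  have better: "N m k < max (N x k) (N y k)" if "k \<in> carrier G" "N l k < r" for k
  proof -
    have "N \<one> (k \<otimes> inv l) = N l k" using shift[of l k] l that by simp
    moreover have "k \<otimes> inv l \<in> carrier G" using l that by simp
    ultimately have "N m' (k \<otimes> inv l) < max (N (x \<otimes> inv l) (k \<otimes> inv l)) (N (y \<otimes> inv l) (k \<otimes> inv l))"
      using m'(2) that(2) by simp
    then show ?thesis
      using shift[of m k] shift[of x k] shift[of y k] m x y that by simp
  qed
  obtain k where k: "k \<in> carrier G" "energy z w m = wt z (act k w) * N m k"
    using energy_att[OF z w m(1)] by blast
  have "energy z w m < energy z w x"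
  proof (cases "0 < wt z (act k w)")
    case True
    have "N m k < max (N x k) (N y k)"
      using better[OF k(1) near_in_fibre[OF z w k(1) l(1) True]] pos l(2) by simp
    then have "energy z w m < max (wt z (act k w) * N x k) (wt z (act k w) * N y k)"
      using True k(2) by (auto simp: max_def split: if_splits)
    then show ?thesis
      using energy_ge[OF z w x(1) k(1)] energy_ge[OF z w y(1) k(1)] eq by auto
  next
    case False
    \<comment> \<open>Zero energy at \<open>m\<close> is still strictly smaller: \<open>l\<close>
      cannot equal both \<open>x\<close> and \<open>y\<close>, so one of them has positive energy
      from its term at \<open>l\<close>, and the two energies agree.\<close>
    then have "energy z w m = 0" using k(2) wt_nonneg[of z "act k w"] by simp
    moreover have "0 < N x l \<or> 0 < N y l"
      using \<open>x \<noteq> y\<close> N_nonneg N_zero x y l by (metis order_less_le)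
    then have "0 < wt z (act l w) * N x l \<or> 0 < wt z (act l w) * N y l"
      using pos l(2) by auto
    ultimately show ?thesis
      using energy_ge[OF z w x(1) l(1)] energy_ge[OF z w y(1) l(1)] eq by auto
  qed
  then show False using x(2)[OF m(1)] by simp
qed

lemma centre_min:
  assumes "z \<in> topspace TZ" and "w \<in> topspace TZ"
  shows "centre z w \<in> carrier G" and "k \<in> carrier G \<Longrightarrow> energy z w (centre z w) \<le> energy z w k"
proof -
  have "\<exists>g. g \<in> carrier G \<and> (\<forall>k\<in>carrier G. energy z w g \<le> energy z w k)"
    using compact_INF_attained[OF compact_group ne energy_cont1[OF assms]] top by auto
  from someI_ex[OF this]
  show "centre z w \<in> carrier G" "k \<in> carrier G \<Longrightarrow> energy z w (centre z w) \<le> energy z w k"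
    by (auto simp: centre_def)
qed

lemma centre_eqI:
  assumes "z \<in> topspace TZ" and "w \<in> topspace TZ" and "0 < beta z w"
    and "g \<in> carrier G" and "\<And>k. k \<in> carrier G \<Longrightarrow> energy z w g \<le> energy z w k"
  shows "centre z w = g"
  using energy_minimizer_unique[OF assms(1-3) centre_min(1)[OF assms(1,2)] centre_min(2)[OF assms(1,2)] assms(4,5)]
  by simp

abbreviation near_diagonal :: "('z \<times> 'z) topology" where
  "near_diagonal \<equiv> subtopology (prod_topology TZ TZ) {(z, w). 0 < beta z w}"

lemma centre_cont: "continuous_map near_diagonal TG (\<lambda>p. centre (fst p) (snd p))"
proof (rule continuous_map_unique_argmin[OF compact_group])
  show "continuous_map (prod_topology near_diagonal TG) euclideanreal (\<lambda>(p, g). energy (fst p) (snd p) g)"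
    using continuous_map_from_subtopology[OF energy_cont, of "{(z, w). 0 < beta z w} \<times> topspace TG"]
    by (simp add: prod_topology_subtopology)
  fix p assume p: "p \<in> topspace near_diagonal"
  then show "centre (fst p) (snd p) \<in> topspace TG" using centre_min(1) top by auto
  fix k assume k: "k \<in> topspace TG" "k \<noteq> centre (fst p) (snd p)"
  show "energy (fst p) (snd p) (centre (fst p) (snd p)) < energy (fst p) (snd p) k"
  proof (rule ccontr)
    assume "\<not> ?thesis"
    then have "energy (fst p) (snd p) k \<le> energy (fst p) (snd p) l" if "l \<in> carrier G" for l
      using centre_min(2)[of "fst p" "snd p" l] that p by fastforce
    then have "centre (fst p) (snd p) = k"
      using centre_eqI[of "fst p" "snd p" k] k p top by auto
    then show False using k by simp
  qed
qed

section \<open>Equivariance of weights, centres and transport\<close>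

lemma mu_act_le:
  assumes a: "a \<in> carrier G" and z: "z \<in> topspace TZ"
  shows "mu (act a z) \<le> mu z"
proof -
  obtain g where g: "g \<in> carrier G" "mu z = disp z g" using mu_att[OF z] by blast
  \<comment> \<open>The conjugate displaces \<open>act a z\<close> exactly as \<open>g\<close>
    displaces \<open>z\<close>, and two-sided invariance of \<open>N\<close> preserves the second
    term of \<open>disp\<close>.\<close>
  let ?g = "a \<otimes> g \<otimes> inv a"
  have "act ?g (act a z) = act a (act g z)"
    using a g z by (simp flip: act_mult add: m_assoc)
  then have "d (act a z) (act ?g (act a z)) = d z (act g z)" using d_act a g z by simp
  moreover have "N \<one> ?g = N (a \<otimes> \<one> \<otimes> inv a) ?g" using a by simp
  then have "N \<one> ?g = N \<one> g"
    using N_right[of "inv a" "a \<otimes> \<one>" "a \<otimes> g"] N_left[of a \<one> g] a g by simp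
  ultimately have "disp (act a z) ?g = disp z g" by (simp add: disp_def)
  then show ?thesis using mu_le[of "act a z" ?g] a z g by simp
qed

lemma mu_act: "\<lbrakk>a \<in> carrier G; z \<in> topspace TZ\<rbrakk> \<Longrightarrow> mu (act a z) = mu z"
  using mu_act_le[of a z] mu_act_le[of "inv a" "act a z"] by (simp flip: act_mult)

lemma wt_act:
  "\<lbrakk>a \<in> carrier G; z \<in> topspace TZ; w \<in> topspace TZ\<rbrakk> \<Longrightarrow> wt (act a z) (act a w) = wt z w"
  by (simp add: wt_def mu_act d_act)

lemma wt_act_left:
  assumes "a \<in> carrier G" and "z \<in> topspace TZ" and "w \<in> topspace TZ"
  shows "wt (act a z) w = wt z (act (inv a) w)"
  using wt_act[of "inv a" "act a z" w] assms by (simp flip: act_mult)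

lemma beta_act_right:
  assumes a: "a \<in> carrier G" and z: "z \<in> topspace TZ" and w: "w \<in> topspace TZ"
  shows "beta z (act a w) = beta z w"
proof -
  have "(SUP k\<in>carrier G. wt z (act k (act a w))) = (SUP k\<in>carrier G. wt z (act (k \<otimes> a) w))"
    using a w by (simp add: act_mult)
  also have "\<dots> = (SUP k\<in>carrier G. wt z (act k w))" by (rule SUP_right_mult[OF a])
  finally show ?thesis by (simp add: beta_def top)
qed

lemma beta_act_left:
  assumes a: "a \<in> carrier G" and z: "z \<in> topspace TZ" and w: "w \<in> topspace TZ"
  shows "beta (act a z) w = beta z w"
proof -
  have "(SUP k\<in>carrier G. wt (act a z) (act k w)) = (SUP k\<in>carrier G. wt z (act (inv a \<otimes> k) w))"
    using a z w by (simp add: act_mult wt_act_left)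
  also have "\<dots> = (SUP k\<in>carrier G. wt z (act k w))" by (rule SUP_left_mult) (use a in simp)
  finally show ?thesis by (simp add: beta_def top)
qed

lemma energy_act_right:
  assumes a: "a \<in> carrier G" and z: "z \<in> topspace TZ" and w: "w \<in> topspace TZ" and g: "g \<in> carrier G"
  shows "energy z (act a w) g = energy z w (g \<otimes> a)"
proof -
  have "(SUP k\<in>carrier G. wt z (act k (act a w)) * N g k) =
      (SUP k\<in>carrier G. wt z (act (k \<otimes> a) w) * N (g \<otimes> a) (k \<otimes> a))"
    using a w g by (simp add: act_mult N_right)
  also have "\<dots> = (SUP k\<in>carrier G. wt z (act k w) * N (g \<otimes> a) k)" by (rule SUP_right_mult[OF a])
  finally show ?thesis by (simp add: energy_def top)
qed

lemma energy_act_left: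
  assumes a: "a \<in> carrier G" and z: "z \<in> topspace TZ" and w: "w \<in> topspace TZ" and g: "g \<in> carrier G"
  shows "energy (act a z) w g = energy z w (inv a \<otimes> g)"
proof -
  have "(SUP k\<in>carrier G. wt (act a z) (act k w) * N g k) =
      (SUP k\<in>carrier G. wt z (act (inv a \<otimes> k) w) * N (inv a \<otimes> g) (inv a \<otimes> k))"
    using a z w g by (simp add: act_mult wt_act_left N_left)
  also have "\<dots> = (SUP k\<in>carrier G. wt z (act k w) * N (inv a \<otimes> g) k)"
    by (rule SUP_left_mult) (use a in simp)
  finally show ?thesis by (simp add: energy_def top)
qed

lemma centre_act_right:
  assumes a: "a \<in> carrier G" and z: "z \<in> topspace TZ" and w: "w \<in> topspace TZ" and pos: "0 < beta z w"
  shows "centre z (act a w) = centre z w \<otimes> inv a"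
proof (rule centre_eqI)
  note c = centre_min[OF z w]
  show "centre z w \<otimes> inv a \<in> carrier G" using c a by simp
  show "energy z (act a w) (centre z w \<otimes> inv a) \<le> energy z (act a w) k" if "k \<in> carrier G" for k
    using c(1) c(2)[of "k \<otimes> a"] that a by (simp add: energy_act_right[OF a z w] m_assoc)
qed (use a z w pos in \<open>auto simp: beta_act_right\<close>)

lemma centre_act_left:
  assumes a: "a \<in> carrier G" and z: "z \<in> topspace TZ" and w: "w \<in> topspace TZ" and pos: "0 < beta z w"
  shows "centre (act a z) w = a \<otimes> centre z w"
proof (rule centre_eqI)
  note c = centre_min[OF z w]
  show "a \<otimes> centre z w \<in> carrier G" using c a by simp
  show "energy (act a z) w (a \<otimes> centre z w) \<le> energy (act a z) w k" if "k \<in> carrier G" for k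
    using c(1) c(2)[of "inv a \<otimes> k"] that a by (simp add: energy_act_left[OF a z w] flip: m_assoc)
qed (use a z w pos in \<open>auto simp: beta_act_left\<close>)

lemma transport_cont: "continuous_map near_diagonal TZ (\<lambda>(z, w). transport z w)"
proof -
  have "continuous_map near_diagonal near_diagonal (\<lambda>p. (fst p, fst p))"
    unfolding continuous_map_in_subtopology
    using beta_diag by (auto intro!: continuous_map_pairedI continuous_map_subtopology_fst)
  from continuous_map_compose[OF this centre_cont]
  have "continuous_map near_diagonal TG (\<lambda>p. centre (fst p) (fst p))" by (simp add: o_def)
  then have "continuous_map near_diagonal TZ
      (\<lambda>p. act (inv (centre (fst p) (fst p)) \<otimes> centre (fst p) (snd p)) (snd p))"
    by (intro act_cont topological_group_maps(3,4)[OF tg] centre_cont continuous_map_subtopology_snd)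
  then show ?thesis by (simp add: transport_def case_prod_unfold)
qed

lemma transport_in_orbit:
  assumes "z \<in> topspace TZ" and "w \<in> topspace TZ"
  shows "\<exists>g\<in>carrier G. transport z w = act g w"
  using centre_min(1)[OF assms(1,1)] centre_min(1)[OF assms] by (auto simp: transport_def)

lemma transport_diag: "z \<in> topspace TZ \<Longrightarrow> transport z z = z"
  using centre_min(1)[of z z] by (simp add: transport_def)

lemma transport_act_right:
  assumes a: "a \<in> carrier G" and z: "z \<in> topspace TZ" and w: "w \<in> topspace TZ" and pos: "0 < beta z w"
  shows "transport z (act a w) = transport z w"
  using centre_act_right[OF assms] centre_min(1)[OF z z] centre_min(1)[OF z w] a w
  by (simp add: transport_def m_assoc flip: act_mult)

text \<open>The normalising element \<open>centre z z\<close> is conjugated by \<open>a\<close>,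
  while \<open>centre z w\<close> is multiplied by \<open>a\<close> on the left. The inner factors
  cancel and one \<open>a\<close> remains outside.\<close>

lemma transport_act_left:
  assumes a: "a \<in> carrier G" and z: "z \<in> topspace TZ" and w: "w \<in> topspace TZ" and pos: "0 < beta z w"
  shows "transport (act a z) w = act a (transport z w)"
proof -
  have "centre (act a z) (act a z) = a \<otimes> centre z z \<otimes> inv a"
    using centre_act_left[OF a z, of "act a z"] centre_act_right[OF a z z] beta_diag[OF z]
      beta_act_right[OF a z z] centre_min(1)[OF z z] a z by (simp add: m_assoc)
  moreover have "inv (a \<otimes> centre z z \<otimes> inv a) \<otimes> (a \<otimes> centre z w) = a \<otimes> (inv (centre z z) \<otimes> centre z w)"
    using a centre_min(1)[OF z z] centre_min(1)[OF z w]
    by (simp add: inv_mult_group m_assoc inv_solve_left')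
  ultimately show ?thesis
    using centre_act_left[OF assms] centre_min(1)[OF z z] centre_min(1)[OF z w] a w
    by (simp add: transport_def act_mult)
qed

text \<open>Weights, energies and centres are built from \<open>d\<close>, the action and
  \<open>N\<close> alone, so a map that preserves \<open>d\<close> and commutes with the action
  leaves them unchanged.\<close>

lemma natural_isometry:
  assumes b: "\<And>z. z \<in> topspace TZ \<Longrightarrow> b z \<in> topspace TZ"
    and b_act: "\<And>g z. \<lbrakk>g \<in> carrier G; z \<in> topspace TZ\<rbrakk> \<Longrightarrow> b (act g z) = act g (b z)"
    and b_d: "\<And>z w. \<lbrakk>z \<in> topspace TZ; w \<in> topspace TZ\<rbrakk> \<Longrightarrow> d (b z) (b w) = d z w"
    and z: "z \<in> topspace TZ" and w: "w \<in> topspace TZ"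
  shows "beta (b z) (b w) = beta z w" and "transport (b z) (b w) = b (transport z w)"
proof -
  have wt: "wt (b z) (act k (b w)) = wt z (act k w)" if "k \<in> topspace TG" "z \<in> topspace TZ" "w \<in> topspace TZ" for k z w
  proof -
    have "disp (b z) g = disp z g" if "g \<in> topspace TG" for g
      using that \<open>z \<in> topspace TZ\<close> b_d[of z "act g z"] top by (simp add: disp_def b_act)
    then have "mu (b z) = mu z" by (simp add: mu_def)
    then show ?thesis using that b_d[of z "act k w"] top by (simp add: wt_def b_act)
  qed
  show "beta (b z) (b w) = beta z w" using wt z w by (simp add: beta_def)
  \<comment> \<open>Equality as functions on \<open>'g\<close> makes the choice in
    \<open>centre\<close> return the same element, even without appeal to uniqueness.\<close>
  have "energy (b z) (b w) = energy z w" if "z \<in> topspace TZ" "w \<in> topspace TZ" for z w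
    using wt that by (auto simp: energy_def)
  then have "centre (b z) (b w) = centre z w" "centre (b z) (b z) = centre z z"
    using z w by (simp_all add: centre_def)
  then show "transport (b z) (b w) = b (transport z w)"
    using centre_min(1)[OF z z] centre_min(1)[OF z w] w by (simp add: transport_def b_act)
qed

end

section \<open>Invariant metrics and compressibility\<close>

lemma continuous_action_closed:
  assumes "continuous_action G TG TX act" and "g \<in> carrier G" and "x \<in> topspace TX"
  shows "act g x \<in> topspace TX"
proof -
  have "(\<lambda>(g, x). act g x) \<in> topspace (prod_topology TG TX) \<rightarrow> topspace TX"
    using assms(1) unfolding continuous_action_def by (blast dest: continuous_map_funspace)
  moreover have "topspace TG = carrier G"
    using assms(1) by (simp add: continuous_action_def topological_group_def)
  ultimately show ?thesis
    using assms funcset_mem[of "\<lambda>(g, x). act g x" _ _ "(g, x)"] by force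
qed

text \<open>The supremum of a given metric over all translates of a pair of points. It is attained,
  so the triangle inequality and the vanishing on the diagonal follow from the original metric at a
  single group element.\<close>

lemma invariant_metric_exists:
  fixes G (structure)
  assumes met: "metrizable_space TX" and act: "continuous_action G TG TX act" and cpt: "compact_space TG"
  obtains d :: "'x \<Rightarrow> 'x \<Rightarrow> real" where
    "continuous_map (prod_topology TX TX) euclideanreal (\<lambda>(x, y). d x y)"
    "\<And>x y. \<lbrakk>x \<in> topspace TX; y \<in> topspace TX\<rbrakk> \<Longrightarrow> 0 \<le> d x y"
    "\<And>x y. \<lbrakk>x \<in> topspace TX; y \<in> topspace TX\<rbrakk> \<Longrightarrow> d x y = 0 \<longleftrightarrow> x = y"
    "\<And>x y. \<lbrakk>x \<in> topspace TX; y \<in> topspace TX\<rbrakk> \<Longrightarrow> d x y = d y x"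
    "\<And>x y z. \<lbrakk>x \<in> topspace TX; y \<in> topspace TX; z \<in> topspace TX\<rbrakk> \<Longrightarrow> d x z \<le> d x y + d y z"
    "\<And>g x y. \<lbrakk>g \<in> carrier G; x \<in> topspace TX; y \<in> topspace TX\<rbrakk> \<Longrightarrow> d (act g x) (act g y) = d x y"
proof -
  obtain M d0 where M: "Metric_space M d0" "TX = Metric_space.mtopology M d0"
    using met by (auto simp: metrizable_space_def)
  interpret Metric_space M d0 by (rule M(1))
  have topX: "topspace TX = M" using M(2) by simp
  have d0_cont: "continuous_map (prod_topology TX TX) euclideanreal (\<lambda>(x, y). d0 x y)"
    using continuous_map_metric[of "metric (M, d0)"] M(2) by simp
  have tg: "topological_group G TG" using act by (simp add: continuous_action_def)
  interpret group G by (rule topological_group_maps(1)[OF tg])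
  note top = topological_group_maps(2)[OF tg]
  have ne: "topspace TG \<noteq> {}" using top by auto
  have act_cont: "continuous_map X TX (\<lambda>x. act (a x) (b x))"
    if "continuous_map X TG a" "continuous_map X TX b" for X :: "(('x \<times> 'x) \<times> 'a) topology" and a b
    by (rule continuous_map_binary[OF _ that]) (use act in \<open>simp add: continuous_action_def\<close>)
  have c: "continuous_map (prod_topology (prod_topology TX TX) TG) euclideanreal
      (\<lambda>(p, g). d0 (act g (fst p)) (act g (snd p)))"
  proof -
    have "continuous_map (prod_topology (prod_topology TX TX) TG) euclideanreal
        (\<lambda>x. d0 (act (snd x) (fst (fst x))) (act (snd x) (snd (fst x))))"
      by (intro continuous_map_binary[OF d0_cont] act_cont continuous_map_snd
          continuous_map_compose[OF continuous_map_fst continuous_map_fst, unfolded o_def]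
          continuous_map_compose[OF continuous_map_fst continuous_map_snd, unfolded o_def])
    then show ?thesis by (simp add: case_prod_unfold)
  qed
  define d where "d x y = (SUP g\<in>topspace TG. d0 (act g x) (act g y))" for x y
  have c1: "continuous_map TG euclideanreal (\<lambda>g. d0 (act g x) (act g y))"
    if "x \<in> topspace TX" "y \<in> topspace TX" for x y
    using continuous_map_binary[OF c, of TG "\<lambda>_. (x, y)" "\<lambda>g. g"] that by simp
  have ge: "d0 (act g x) (act g y) \<le> d x y"
    if "x \<in> topspace TX" "y \<in> topspace TX" "g \<in> carrier G" for g x y
    unfolding d_def using compact_SUP_upper[OF cpt c1[OF that(1,2)]] that(3) top by simp
  have att: "\<exists>g\<in>carrier G. d x y = d0 (act g x) (act g y)"
    if "x \<in> topspace TX" "y \<in> topspace TX" for x y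
    unfolding d_def using compact_SUP_attained[OF cpt ne c1[OF that]] unfolding top by metis
  note cl = continuous_action_closed[OF act]
  have one: "act \<one> x = x" if "x \<in> topspace TX" for x
    using act that by (simp add: continuous_action_def)
  have mult: "act (g \<otimes> h) x = act g (act h x)"
    if "g \<in> carrier G" "h \<in> carrier G" "x \<in> topspace TX" for g h x
    using act that by (simp add: continuous_action_def)
  show thesis
  proof
    show "continuous_map (prod_topology TX TX) euclideanreal (\<lambda>(x, y). d x y)"
      using continuous_map_SUP[OF cpt ne c] by (simp add: d_def case_prod_unfold)
    show d_nonneg: "0 \<le> d x y" if "x \<in> topspace TX" "y \<in> topspace TX" for x y
      using ge[OF that one_closed] nonneg order_trans by blast
    show "d x y = 0 \<longleftrightarrow> x = y" if xy: "x \<in> topspace TX" "y \<in> topspace TX" for x y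
    proof
      assume "d x y = 0"
      then have "d0 x y \<le> 0" using ge[OF xy one_closed] one xy by simp
      then show "x = y" using zero[of x y] nonneg[of x y] xy topX by auto
    next
      assume "x = y"
      obtain g where g: "g \<in> carrier G" "d x y = d0 (act g x) (act g y)" using att[OF xy] by blast
      then show "d x y = 0" using \<open>x = y\<close> cl[OF g(1) xy(1)] topX by simp
    qed
    show "d x y = d y x" for x y unfolding d_def by (simp add: commute)
    show "d x z \<le> d x y + d y z"
      if xyz: "x \<in> topspace TX" "y \<in> topspace TX" "z \<in> topspace TX" for x y z
    proof -
      obtain g where g: "g \<in> carrier G" "d x z = d0 (act g x) (act g z)" using att[OF xyz(1,3)] by blast
      then show ?thesis
        using triangle[of "act g x" "act g y" "act g z"] ge[OF xyz(1,2) g(1)] ge[OF xyz(2,3) g(1)]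
          cl[OF g(1)] xyz topX by fastforce
    qed
    show "d (act g x) (act g y) = d x y" if "g \<in> carrier G" "x \<in> topspace TX" "y \<in> topspace TX" for g x y
    proof -
      have "(SUP k\<in>carrier G. d0 (act k (act g x)) (act k (act g y))) =
          (SUP k\<in>carrier G. d0 (act (k \<otimes> g) x) (act (k \<otimes> g) y))"
        using that by (simp add: mult)
      also have "\<dots> = (SUP k\<in>carrier G. d0 (act k x) (act k y))" by (rule SUP_right_mult[OF that(1)])
      finally show ?thesis by (simp add: d_def top)
    qed
  qed
qed

text \<open>\<open>N\<close> is not assumed symmetric and carries no triangle inequality. The
  uniform distance between the functions \<open>N x\<close> and \<open>N y\<close> has both,
  separates points by evaluation at \<open>y\<close>, and inherits two-sided invariance by
  reindexing.\<close>

lemma biinvariant_metric_exists: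
  fixes H (structure)
  assumes tg: "topological_group H TH" and cpt: "compact_space TH" and N: "center_function H TH N r"
  obtains d :: "'h \<Rightarrow> 'h \<Rightarrow> real" where
    "continuous_map (prod_topology TH TH) euclideanreal (\<lambda>(x, y). d x y)"
    "\<And>x y. \<lbrakk>x \<in> carrier H; y \<in> carrier H\<rbrakk> \<Longrightarrow> 0 \<le> d x y"
    "\<And>x y. \<lbrakk>x \<in> carrier H; y \<in> carrier H\<rbrakk> \<Longrightarrow> d x y = 0 \<longleftrightarrow> x = y"
    "\<And>x y. \<lbrakk>x \<in> carrier H; y \<in> carrier H\<rbrakk> \<Longrightarrow> d x y = d y x"
    "\<And>x y z. \<lbrakk>x \<in> carrier H; y \<in> carrier H; z \<in> carrier H\<rbrakk> \<Longrightarrow> d x z \<le> d x y + d y z"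
    "\<And>g x y. \<lbrakk>g \<in> carrier H; x \<in> carrier H; y \<in> carrier H\<rbrakk> \<Longrightarrow> d (g \<otimes> x) (g \<otimes> y) = d x y"
    "\<And>g x y. \<lbrakk>g \<in> carrier H; x \<in> carrier H; y \<in> carrier H\<rbrakk> \<Longrightarrow> d (x \<otimes> g) (y \<otimes> g) = d x y"
proof -
  interpret group H by (rule topological_group_maps(1)[OF tg])
  note top = topological_group_maps(2)[OF tg]
  have ne: "topspace TH \<noteq> {}" using top by auto
  have N_cont: "continuous_map (prod_topology TH TH) euclideanreal (\<lambda>(x, y). N x y)"
    and N_zero: "\<And>x y. \<lbrakk>x \<in> carrier H; y \<in> carrier H\<rbrakk> \<Longrightarrow> N x y = 0 \<longleftrightarrow> x = y"
    and N_left: "\<And>a x y. \<lbrakk>a \<in> carrier H; x \<in> carrier H; y \<in> carrier H\<rbrakk> \<Longrightarrow> N (a \<otimes> x) (a \<otimes> y) = N x y"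
    and N_right: "\<And>a x y. \<lbrakk>a \<in> carrier H; x \<in> carrier H; y \<in> carrier H\<rbrakk> \<Longrightarrow> N (x \<otimes> a) (y \<otimes> a) = N x y"
    using N by (simp_all add: center_function_def)
  have c: "continuous_map (prod_topology (prod_topology TH TH) TH) euclideanreal
      (\<lambda>(p, k). \<bar>N (fst p) k - N (snd p) k\<bar>)"
  proof -
    have "continuous_map (prod_topology (prod_topology TH TH) TH) euclideanreal
        (\<lambda>x. \<bar>N (fst (fst x)) (snd x) - N (snd (fst x)) (snd x)\<bar>)"
      by (intro continuous_map_real_abs continuous_map_diff continuous_map_binary[OF N_cont] continuous_map_snd
          continuous_map_compose[OF continuous_map_fst continuous_map_fst, unfolded o_def]
          continuous_map_compose[OF continuous_map_fst continuous_map_snd, unfolded o_def])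
    then show ?thesis by (simp add: case_prod_unfold)
  qed
  define d where "d x y = (SUP k\<in>topspace TH. \<bar>N x k - N y k\<bar>)" for x y
  have c1: "continuous_map TH euclideanreal (\<lambda>k. \<bar>N x k - N y k\<bar>)"
    if "x \<in> carrier H" "y \<in> carrier H" for x y
    using continuous_map_binary[OF c, of TH "\<lambda>_. (x, y)" "\<lambda>g. g"] that top by simp
  have ge: "\<bar>N x k - N y k\<bar> \<le> d x y" if "x \<in> carrier H" "y \<in> carrier H" "k \<in> carrier H" for k x y
    unfolding d_def using compact_SUP_upper[OF cpt c1[OF that(1,2)]] that(3) top by simp
  have att: "\<exists>k\<in>carrier H. d x y = \<bar>N x k - N y k\<bar>" if "x \<in> carrier H" "y \<in> carrier H" for x y
    unfolding d_def using compact_SUP_attained[OF cpt ne c1[OF that]] unfolding top by metis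
  show thesis
  proof
    show "continuous_map (prod_topology TH TH) euclideanreal (\<lambda>(x, y). d x y)"
      using continuous_map_SUP[OF cpt ne c] by (simp add: d_def case_prod_unfold)
    show "0 \<le> d x y" if "x \<in> carrier H" "y \<in> carrier H" for x y
      using ge[OF that one_closed] by linarith
    show "d x y = 0 \<longleftrightarrow> x = y" if xy: "x \<in> carrier H" "y \<in> carrier H" for x y
    proof
      assume "d x y = 0"
      then have "N x y = N y y" using ge[OF xy xy(2)] by simp
      then show "x = y" using N_zero xy by metis
    next
      assume "x = y"
      then show "d x y = 0" using att[OF xy] by auto
    qed
    show "d x y = d y x" for x y unfolding d_def by (simp add: abs_minus_commute)
    show "d x z \<le> d x y + d y z" if xyz: "x \<in> carrier H" "y \<in> carrier H" "z \<in> carrier H" for x y z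
    proof -
      obtain k where k: "k \<in> carrier H" "d x z = \<bar>N x k - N z k\<bar>" using att[OF xyz(1,3)] by blast
      then show ?thesis using ge[OF xyz(1,2) k(1)] ge[OF xyz(2,3) k(1)] by linarith
    qed
    show "d (g \<otimes> x) (g \<otimes> y) = d x y" if "g \<in> carrier H" "x \<in> carrier H" "y \<in> carrier H" for g x y
    proof -
      have "(SUP k\<in>carrier H. \<bar>N (g \<otimes> x) (g \<otimes> k) - N (g \<otimes> y) (g \<otimes> k)\<bar>) =
          (SUP k\<in>carrier H. \<bar>N x k - N y k\<bar>)"
        using that by (simp add: N_left)
      then show ?thesis
        using SUP_left_mult[OF that(1), of "\<lambda>k. \<bar>N (g \<otimes> x) k - N (g \<otimes> y) k\<bar>"] by (simp add: d_def top)
    qed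
    show "d (x \<otimes> g) (y \<otimes> g) = d x y" if "g \<in> carrier H" "x \<in> carrier H" "y \<in> carrier H" for g x y
    proof -
      have "(SUP k\<in>carrier H. \<bar>N (x \<otimes> g) (k \<otimes> g) - N (y \<otimes> g) (k \<otimes> g)\<bar>) =
          (SUP k\<in>carrier H. \<bar>N x k - N y k\<bar>)"
        using that by (simp add: N_right)
      then show ?thesis
        using SUP_right_mult[OF that(1), of "\<lambda>k. \<bar>N (x \<otimes> g) k - N (y \<otimes> g) k\<bar>"] by (simp add: d_def top)
    qed
  qed
qed

text \<open>The characterisation of \<open>homotopic_with\<close> asks for a property that depends
  only on values on the domain; invariance of \<open>U\<close> guarantees this for equivariance. The
  end map is then read off at time \<open>1\<close>.\<close>

lemma compressible_iff:
  assumes "U \<subseteq> topspace TX" and "invariant_set G act U"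
  shows "compressible G TX act U A \<longleftrightarrow>
    (\<exists>h. continuous_map (prod_topology (top_of_set {0..1::real}) (subtopology TX U)) TX h \<and>
       (\<forall>u\<in>U. h (0, u) = u) \<and>
       (\<forall>t\<in>{0..1}. \<forall>g\<in>carrier G. \<forall>u\<in>U. h (t, act g u) = act g (h (t, u))) \<and>
       (\<forall>u\<in>U. h (1, u) \<in> A))"
proof -
  have U: "topspace (subtopology TX U) = U" using assms(1) by auto
  have hw: "homotopic_with (\<lambda>k. \<forall>g\<in>carrier G. \<forall>u\<in>U. k (act g u) = act g (k u)) (subtopology TX U) TX id c \<longleftrightarrow>
      (\<exists>h. continuous_map (prod_topology (top_of_set {0..1::real}) (subtopology TX U)) TX h \<and>
         (\<forall>x\<in>U. h (0, x) = id x) \<and> (\<forall>x\<in>U. h (1, x) = c x) \<and>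
         (\<forall>t\<in>{0..1}. \<forall>g\<in>carrier G. \<forall>u\<in>U. h (t, act g u) = act g (h (t, u))))" for c
  proof (subst homotopic_with, goal_cases)
    case (1 h k)
    then have "h u = k u" if "u \<in> U" for u using that U by blast
    then show ?case using assms(2) by (simp add: invariant_set_def)
  qed (simp only: U)
  show ?thesis
    unfolding compressible_def hw
  proof (intro iffI; elim exE conjE)
    fix h
    assume "continuous_map (prod_topology (top_of_set {0..1::real}) (subtopology TX U)) TX h"
      "\<forall>u\<in>U. h (0, u) = u" "\<forall>u\<in>U. h (1, u) \<in> A"
      "\<forall>t\<in>{0..1}. \<forall>g\<in>carrier G. \<forall>u\<in>U. h (t, act g u) = act g (h (t, u))"
    then show "\<exists>c. (\<exists>h. continuous_map (prod_topology (top_of_set {0..1::real}) (subtopology TX U)) TX h \<and>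
         (\<forall>x\<in>U. h (0, x) = id x) \<and> (\<forall>x\<in>U. h (1, x) = c x) \<and>
         (\<forall>t\<in>{0..1}. \<forall>g\<in>carrier G. \<forall>u\<in>U. h (t, act g u) = act g (h (t, u)))) \<and> c ` U \<subseteq> A"
      by (intro exI[of _ "\<lambda>u. h (1, u)"] conjI exI[of _ h]) auto
  next
    fix c h
    assume "continuous_map (prod_topology (top_of_set {0..1::real}) (subtopology TX U)) TX h"
      "\<forall>x\<in>U. h (0, x) = id x" "\<forall>x\<in>U. h (1, x) = c x" "c ` U \<subseteq> A"
      "\<forall>t\<in>{0..1}. \<forall>g\<in>carrier G. \<forall>u\<in>U. h (t, act g u) = act g (h (t, u))"
    then show "\<exists>h. continuous_map (prod_topology (top_of_set {0..1::real}) (subtopology TX U)) TX h \<and>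
       (\<forall>u\<in>U. h (0, u) = u) \<and>
       (\<forall>t\<in>{0..1}. \<forall>g\<in>carrier G. \<forall>u\<in>U. h (t, act g u) = act g (h (t, u))) \<and>
       (\<forall>u\<in>U. h (1, u) \<in> A)"
      by (intro exI[of _ h]) auto
  qed
qed

section \<open>Essential equivalences\<close>

text \<open>Of the Lie structure only the center functions are retained; everything else here
  concerns compact topological groups.\<close>

locale lie_essential_equivalence =
  fixes G :: "('g, 'gm) monoid_scheme" and TG :: "'g topology"
    and H :: "('h, 'hm) monoid_scheme" and TH :: "'h topology"
    and TX :: "'x topology" and TY :: "'y topology"
    and actG :: "'g \<Rightarrow> 'x \<Rightarrow> 'x" and actH :: "'h \<Rightarrow> 'y \<Rightarrow> 'y"
    and \<psi> :: "'g \<Rightarrow> 'h" and \<epsilon> :: "'x \<Rightarrow> 'y"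
    and NG rG NH rH
  assumes compact_G: "compact_space TG" and compact_H: "compact_space TH"
    and center_G: "center_function G TG NG rG" and center_H: "center_function H TH NH rH"
    and metrizable_X: "metrizable_space TX"
    and action_G: "continuous_action G TG TX actG"
    and action_H: "continuous_action H TH TY actH"
    and ess: "essential_equivalence G TG TX actG H TH TY actH \<psi> \<epsilon>"
begin

lemma tgG: "topological_group G TG" and tgH: "topological_group H TH"
  using action_G action_H by (simp_all add: continuous_action_def)

sublocale G: group G by (rule topological_group_maps(1)[OF tgG])
sublocale H: group H by (rule topological_group_maps(1)[OF tgH])

lemmas topG = topological_group_maps(2)[OF tgG] and topH = topological_group_maps(2)[OF tgH]
lemmas actG_closed [simp, intro] = continuous_action_closed[OF action_G]
  and actH_closed [simp, intro] = continuous_action_closed[OF action_H]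

lemma actG_one [simp]: "x \<in> topspace TX \<Longrightarrow> actG \<one>\<^bsub>G\<^esub> x = x"
  and actH_one [simp]: "y \<in> topspace TY \<Longrightarrow> actH \<one>\<^bsub>H\<^esub> y = y"
  and actG_mult: "\<lbrakk>g \<in> carrier G; g' \<in> carrier G; x \<in> topspace TX\<rbrakk> \<Longrightarrow>
    actG (g \<otimes>\<^bsub>G\<^esub> g') x = actG g (actG g' x)"
  and actH_mult: "\<lbrakk>h \<in> carrier H; h' \<in> carrier H; y \<in> topspace TY\<rbrakk> \<Longrightarrow>
    actH (h \<otimes>\<^bsub>H\<^esub> h') y = actH h (actH h' y)"
  using action_G action_H by (simp_all add: continuous_action_def)

lemma equivariant: "equivariant_map G TG TX actG H TH TY actH \<psi> \<epsilon>"
  using ess by (simp add: essential_equivalence_def)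

lemma psi_hom: "group_hom G H \<psi>"
  using equivariant G.group_axioms H.group_axioms
  by (simp add: equivariant_map_def group_hom_def group_hom_axioms_def)

sublocale \<psi>: group_hom G H \<psi> by (rule psi_hom)

lemma eps_cont: "continuous_map TX TY \<epsilon>" and psi_cont: "continuous_map TG TH \<psi>"
  and eps_act: "\<lbrakk>g \<in> carrier G; x \<in> topspace TX\<rbrakk> \<Longrightarrow> \<epsilon> (actG g x) = actH (\<psi> g) (\<epsilon> x)"
  using equivariant by (simp_all add: equivariant_map_def)

lemma eps_closed [simp, intro]: "x \<in> topspace TX \<Longrightarrow> \<epsilon> x \<in> topspace TY"
  using continuous_map_funspace[OF eps_cont] by blast

lemma lambda_homeo: "homeomorphic_map (prod_topology TG TX)
    (subtopology (prod_topology (prod_topology TH TY) (prod_topology TX TX))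
      {((h, y), (x, x')). y = \<epsilon> x \<and> actH h y = \<epsilon> x'}) (\<lambda>(g, x). ((\<psi> g, \<epsilon> x), (x, actG g x)))"
  using ess by (simp add: essential_equivalence_def)

text \<open>Surjectivity of the comparison map onto the pullback.\<close>

lemma lift_arrow:
  assumes "h \<in> carrier H" and "x \<in> topspace TX" and "x' \<in> topspace TX" and "actH h (\<epsilon> x) = \<epsilon> x'"
  obtains g where "g \<in> carrier G" and "\<psi> g = h" and "actG g x = x'"
proof -
  have "((h, \<epsilon> x), (x, x')) \<in> (\<lambda>(g, x). ((\<psi> g, \<epsilon> x), (x, actG g x))) ` topspace (prod_topology TG TX)"
    unfolding homeomorphic_imp_surjective_map[OF lambda_homeo] using assms topH by simp
  then show thesis using that topG by auto
qed

text \<open>Injectivity of the comparison map, tested against the identity at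
  \<open>x\<close>.\<close>

lemma isotropy_faithful:
  assumes "g \<in> carrier G" and "x \<in> topspace TX" and "\<psi> g = \<one>\<^bsub>H\<^esub>" and "actG g x = x"
  shows "g = \<one>\<^bsub>G\<^esub>"
proof -
  have "inj_on (\<lambda>(g, x). ((\<psi> g, \<epsilon> x), (x, actG g x))) (topspace (prod_topology TG TX))"
    by (rule homeomorphic_imp_injective_map[OF lambda_homeo])
  from inj_onD[OF this, of "(g, x)" "(\<one>\<^bsub>G\<^esub>, x)"] show ?thesis
    using assms topG by simp
qed

abbreviation TZ :: "('x \<times> 'h) topology" where "TZ \<equiv> prod_topology TX TH"

definition q :: "'x \<times> 'h \<Rightarrow> 'y" where "q = (\<lambda>(x, h). actH h (\<epsilon> x))"

definition gact :: "'g \<Rightarrow> 'x \<times> 'h \<Rightarrow> 'x \<times> 'h" where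
  "gact g = (\<lambda>(x, h). (actG g x, h \<otimes>\<^bsub>H\<^esub> inv\<^bsub>H\<^esub> \<psi> g))"

definition hact :: "'h \<Rightarrow> 'x \<times> 'h \<Rightarrow> 'x \<times> 'h" where
  "hact k = (\<lambda>(x, h). (x, k \<otimes>\<^bsub>H\<^esub> h))"

lemma q_apply: "q (x, h) = actH h (\<epsilon> x)" and gact_apply: "gact g (x, h) = (actG g x, h \<otimes>\<^bsub>H\<^esub> inv\<^bsub>H\<^esub> \<psi> g)"
  and hact_apply: "hact k (x, h) = (x, k \<otimes>\<^bsub>H\<^esub> h)"
  by (simp_all add: q_def gact_def hact_def)

lemma q_open: "open_map TZ TY q" and q_surj: "q ` topspace TZ = topspace TY"
  using ess by (simp_all add: essential_equivalence_def q_def)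

lemma q_cont: "continuous_map TZ TY q"
proof -
  have "continuous_map TZ TY (\<lambda>z. actH (snd z) (\<epsilon> (fst z)))"
  proof (rule continuous_map_binary[where f = actH and A = TH and B = TY])
    show "continuous_map (prod_topology TH TY) TY (\<lambda>(h, y). actH h y)"
      using action_H by (simp add: continuous_action_def)
    show "continuous_map TZ TY (\<lambda>z. \<epsilon> (fst z))"
      using continuous_map_compose[OF continuous_map_fst eps_cont] by (simp add: o_def)
  qed (rule continuous_map_snd)
  then show ?thesis by (simp add: q_def case_prod_unfold)
qed

lemma q_gact: "\<lbrakk>g \<in> carrier G; z \<in> topspace TZ\<rbrakk> \<Longrightarrow> q (gact g z) = q z"
  using topH by (auto simp: q_apply gact_apply eps_act actH_mult[symmetric] H.m_assoc)

lemma q_hact: "\<lbrakk>k \<in> carrier H; z \<in> topspace TZ\<rbrakk> \<Longrightarrow> q (hact k z) = actH k (q z)"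
  using topH by (auto simp: q_apply hact_apply actH_mult)

text \<open>For points \<open>(x, h)\<close> and \<open>(x', h')\<close> of one fibre,
  \<open>h'^-1 h\<close> carries \<open>\<epsilon> x\<close> to \<open>\<epsilon> x'\<close>. Its
  lift to an element of \<open>G\<close> does the rest.\<close>

lemma q_eqD:
  assumes "z \<in> topspace TZ" and "z' \<in> topspace TZ" and "q z = q z'"
  obtains g where "g \<in> carrier G" and "z' = gact g z"
proof -
  obtain x h x' h' where z: "z = (x, h)" "z' = (x', h')" by fastforce
  have xh: "x \<in> topspace TX" "x' \<in> topspace TX" "h \<in> carrier H" "h' \<in> carrier H"
    using assms z topH by auto
  have "actH (inv\<^bsub>H\<^esub> h' \<otimes>\<^bsub>H\<^esub> h) (\<epsilon> x) = actH (inv\<^bsub>H\<^esub> h') (actH h' (\<epsilon> x'))"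
    using assms(3) xh by (simp add: z q_apply actH_mult)
  also have "\<dots> = \<epsilon> x'" using xh by (simp add: actH_mult[symmetric])
  finally obtain g where g: "g \<in> carrier G" "\<psi> g = inv\<^bsub>H\<^esub> h' \<otimes>\<^bsub>H\<^esub> h" "actG g x = x'"
    using lift_arrow[of "inv\<^bsub>H\<^esub> h' \<otimes>\<^bsub>H\<^esub> h" x x'] xh by auto
  have "h \<otimes>\<^bsub>H\<^esub> inv\<^bsub>H\<^esub> \<psi> g = h'"
    using xh g(2) by (simp add: H.inv_mult_group H.m_assoc[symmetric])
  then show thesis using that[OF g(1)] g(3) z by (simp add: gact_apply)
qed

lemma gact_action: "continuous_action G TG TZ gact"
  unfolding continuous_action_def
proof (intro conjI ballI)
  show "topological_group G TG" by (rule tgG)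
  have "continuous_map (prod_topology TG TZ) TX (\<lambda>p. actG (fst p) (fst (snd p)))"
    by (rule continuous_map_binary[where f = actG and A = TG and B = TX])
      (use action_G in \<open>auto simp: continuous_action_def continuous_map_fst
        intro: continuous_map_compose[OF continuous_map_snd continuous_map_fst, unfolded o_def]\<close>)
  moreover have "continuous_map (prod_topology TG TZ) TH (\<lambda>p. snd (snd p) \<otimes>\<^bsub>H\<^esub> inv\<^bsub>H\<^esub> \<psi> (fst p))"
    by (intro topological_group_maps(3,4)[OF tgH]
        continuous_map_compose[OF continuous_map_snd continuous_map_snd, unfolded o_def]
        continuous_map_compose[OF continuous_map_fst psi_cont, unfolded o_def])
  ultimately show "continuous_map (prod_topology TG TZ) TZ (\<lambda>(g, z). gact g z)"
    by (simp add: gact_def case_prod_unfold continuous_map_pairedI)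
  show "gact \<one>\<^bsub>G\<^esub> z = z" if "z \<in> topspace TZ" for z
    using that topH by (auto simp: gact_apply)
  show "gact (g \<otimes>\<^bsub>G\<^esub> g') z = gact g (gact g' z)"
    if "g \<in> carrier G" "g' \<in> carrier G" "z \<in> topspace TZ" for g g' z
    using that topH by (auto simp: gact_apply actG_mult H.inv_mult_group H.m_assoc)
qed

lemma gact_free: "\<lbrakk>g \<in> carrier G; z \<in> topspace TZ; gact g z = z\<rbrakk> \<Longrightarrow> g = \<one>\<^bsub>G\<^esub>"
  using isotropy_faithful[of g "fst z"] topH H.inv_eq_1_iff[of "\<psi> g"]
  by (auto simp: gact_apply)

lemma hact_closed: "\<lbrakk>k \<in> carrier H; z \<in> topspace TZ\<rbrakk> \<Longrightarrow> hact k z \<in> topspace TZ"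
  using topH by (auto simp: hact_apply)

lemma hact_gact: "\<lbrakk>k \<in> carrier H; g \<in> carrier G; z \<in> topspace TZ\<rbrakk> \<Longrightarrow> hact k (gact g z) = gact g (hact k z)"
  using topH by (auto simp: hact_apply gact_apply H.m_assoc)

text \<open>Right invariance of the metric on \<open>H\<close> serves \<open>gact\<close> and left
  invariance serves \<open>hact\<close>, which is why it is taken bi-invariant.\<close>

lemma bundle_metric_exists:
  obtains d where "free_isometric_action G TG TZ gact d NG rG"
    and "\<And>k z w. \<lbrakk>k \<in> carrier H; z \<in> topspace TZ; w \<in> topspace TZ\<rbrakk> \<Longrightarrow> d (hact k z) (hact k w) = d z w"
proof -
  obtain dX where dX: "continuous_map (prod_topology TX TX) euclideanreal (\<lambda>(x, y). dX x y)"
    "\<And>x y. \<lbrakk>x \<in> topspace TX; y \<in> topspace TX\<rbrakk> \<Longrightarrow> (0::real) \<le> dX x y"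
    "\<And>x y. \<lbrakk>x \<in> topspace TX; y \<in> topspace TX\<rbrakk> \<Longrightarrow> dX x y = 0 \<longleftrightarrow> x = y"
    "\<And>x y. \<lbrakk>x \<in> topspace TX; y \<in> topspace TX\<rbrakk> \<Longrightarrow> dX x y = dX y x"
    "\<And>x y z. \<lbrakk>x \<in> topspace TX; y \<in> topspace TX; z \<in> topspace TX\<rbrakk> \<Longrightarrow> dX x z \<le> dX x y + dX y z"
    "\<And>g x y. \<lbrakk>g \<in> carrier G; x \<in> topspace TX; y \<in> topspace TX\<rbrakk> \<Longrightarrow> dX (actG g x) (actG g y) = dX x y"
    by (rule invariant_metric_exists[OF metrizable_X action_G compact_G]) (rule that; assumption)
  obtain dH where dH: "continuous_map (prod_topology TH TH) euclideanreal (\<lambda>(x, y). dH x y)"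
    "\<And>x y. \<lbrakk>x \<in> carrier H; y \<in> carrier H\<rbrakk> \<Longrightarrow> (0::real) \<le> dH x y"
    "\<And>x y. \<lbrakk>x \<in> carrier H; y \<in> carrier H\<rbrakk> \<Longrightarrow> dH x y = 0 \<longleftrightarrow> x = y"
    "\<And>x y. \<lbrakk>x \<in> carrier H; y \<in> carrier H\<rbrakk> \<Longrightarrow> dH x y = dH y x"
    "\<And>x y z. \<lbrakk>x \<in> carrier H; y \<in> carrier H; z \<in> carrier H\<rbrakk> \<Longrightarrow> dH x z \<le> dH x y + dH y z"
    "\<And>g x y. \<lbrakk>g \<in> carrier H; x \<in> carrier H; y \<in> carrier H\<rbrakk> \<Longrightarrow> dH (g \<otimes>\<^bsub>H\<^esub> x) (g \<otimes>\<^bsub>H\<^esub> y) = dH x y"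
    "\<And>g x y. \<lbrakk>g \<in> carrier H; x \<in> carrier H; y \<in> carrier H\<rbrakk> \<Longrightarrow> dH (x \<otimes>\<^bsub>H\<^esub> g) (y \<otimes>\<^bsub>H\<^esub> g) = dH x y"
    by (rule biinvariant_metric_exists[OF tgH compact_H center_H]) (rule that; assumption)
  define d where "d z w = dX (fst z) (fst w) + dH (snd z) (snd w)" for z w
  show thesis
  proof
    show "free_isometric_action G TG TZ gact d NG rG"
    proof
      show "compact_space TG" by (rule compact_G)
      show "continuous_action G TG TZ gact" by (rule gact_action)
      show "center_function G TG NG rG" by (rule center_G)
      show "g = \<one>\<^bsub>G\<^esub>" if "g \<in> carrier G" "z \<in> topspace TZ" "gact g z = z" for g z
        by (rule gact_free[OF that])
      have "continuous_map (prod_topology TZ TZ) euclideanreal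
          (\<lambda>p. dX (fst (fst p)) (fst (snd p)) + dH (snd (fst p)) (snd (snd p)))"
        by (intro continuous_map_add continuous_map_binary[OF dX(1)] continuous_map_binary[OF dH(1)]
            continuous_map_compose[OF continuous_map_fst continuous_map_fst, unfolded o_def]
            continuous_map_compose[OF continuous_map_fst continuous_map_snd, unfolded o_def]
            continuous_map_compose[OF continuous_map_snd continuous_map_fst, unfolded o_def]
            continuous_map_compose[OF continuous_map_snd continuous_map_snd, unfolded o_def])
      then show "continuous_map (prod_topology TZ TZ) euclideanreal (\<lambda>(z, w). d z w)"
        by (simp add: d_def case_prod_unfold)
      fix z w assume zw: "z \<in> topspace TZ" "w \<in> topspace TZ"
      then have in': "fst z \<in> topspace TX" "snd z \<in> carrier H" "fst w \<in> topspace TX" "snd w \<in> carrier H"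
        using topH by (simp_all add: mem_Times_iff)
      show "0 \<le> d z w" using in' dX(2) dH(2) by (simp add: d_def)
      show "d z w = 0 \<longleftrightarrow> z = w"
        using in' dX(2)[of "fst z" "fst w"] dX(3)[of "fst z" "fst w"]
          dH(2)[of "snd z" "snd w"] dH(3)[of "snd z" "snd w"]
        by (auto simp: d_def add_nonneg_eq_0_iff prod_eq_iff)
      show "d z w = d w z" using in' dX(4) dH(4) by (simp add: d_def)
      show "d z x \<le> d z w + d w x" if "x \<in> topspace TZ" for x
      proof -
        have "fst x \<in> topspace TX" "snd x \<in> carrier H"
          using that topH by (simp_all add: mem_Times_iff)
        then show ?thesis
          using in' dX(5)[of "fst z" "fst w" "fst x"] dH(5)[of "snd z" "snd w" "snd x"]
          by (simp add: d_def)
      qed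
      show "d (gact g z) (gact g w) = d z w" if "g \<in> carrier G" for g
        using that in' dX(6) dH(7) by (simp add: d_def gact_def case_prod_unfold)
    qed
    show "d (hact k z) (hact k w) = d z w"
      if "k \<in> carrier H" "z \<in> topspace TZ" "w \<in> topspace TZ" for k z w
      using that topH dH(6) by (auto simp: d_def hact_def)
  qed
qed

section \<open>Transfer of open sets, compressions and covers\<close>

lemma saturation_openin:
  assumes "openin TX U"
  shows "openin TY (saturation H actH \<epsilon> U)"
proof -
  have "saturation H actH \<epsilon> U = q ` (U \<times> topspace TH)"
    by (auto simp: saturation_def q_def topH image_iff)
  moreover have "openin TZ (U \<times> topspace TH)" using assms by (simp add: openin_prod_Times_iff)
  ultimately show ?thesis using q_open by (simp add: open_map_def)
qed

lemma saturation_invariant: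
  assumes "U \<subseteq> topspace TX"
  shows "invariant_set H actH (saturation H actH \<epsilon> U)"
  unfolding invariant_set_def saturation_def
proof (intro ballI)
  fix k y assume "k \<in> carrier H" "y \<in> {actH h (\<epsilon> a) |h a. h \<in> carrier H \<and> a \<in> U}"
  then obtain h a where "h \<in> carrier H" "a \<in> U" "y = actH h (\<epsilon> a)" by blast
  then show "actH k y \<in> {actH h (\<epsilon> a) |h a. h \<in> carrier H \<and> a \<in> U}"
    using \<open>k \<in> carrier H\<close> assms actH_mult[of k h "\<epsilon> a"]
    by (auto intro!: exI[of _ "k \<otimes>\<^bsub>H\<^esub> h"] exI[of _ a])
qed

lemma compressible_saturation:
  assumes U: "openin TX U" "invariant_set G actG U" and A: "compressible G TX actG U A"
  shows "compressible H TY actH (saturation H actH \<epsilon> U) (saturation H actH \<epsilon> A)"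
proof -
  let ?I = "top_of_set {0..1::real}" and ?V = "saturation H actH \<epsilon> U"
  have UX: "U \<subseteq> topspace TX" using U(1) openin_subset by blast
  have VY: "?V \<subseteq> topspace TY" using saturation_openin[OF U(1)] openin_subset by blast
  obtain f where f: "continuous_map (prod_topology ?I (subtopology TX U)) TX f"
      "\<And>u. u \<in> U \<Longrightarrow> f (0, u) = u"
      "\<And>t g u. \<lbrakk>t \<in> {0..1}; g \<in> carrier G; u \<in> U\<rbrakk> \<Longrightarrow> f (t, actG g u) = actG g (f (t, u))"
      "\<And>u. u \<in> U \<Longrightarrow> f (1, u) \<in> A"
    using A unfolding compressible_iff[OF UX U(2)] by blast
  have fX: "f (t, u) \<in> topspace TX" if "t \<in> {0..1}" "u \<in> U" for t u
    using funcset_mem[OF continuous_map_funspace[OF f(1)], of "(t, u)"] that UX by auto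
  define s where "s y = (SOME z. z \<in> U \<times> carrier H \<and> q z = y)" for y
  have s: "s y \<in> U \<times> carrier H" "q (s y) = y" if "y \<in> ?V" for y
  proof -
    have "\<exists>z. z \<in> U \<times> carrier H \<and> q z = y"
      using that by (fastforce simp: saturation_def q_def)
    from someI_ex[OF this] show "s y \<in> U \<times> carrier H" "q (s y) = y" by (auto simp: s_def)
  qed
  have UH: "U \<times> carrier H \<subseteq> topspace TZ" using UX topH by auto
  define \<Phi> where "\<Phi> = (\<lambda>(t, y). q (f (t, fst (s y)), snd (s y)))"
  \<comment> \<open>Two preimages of a point differ by some \<open>gact g\<close>. Equivariance of
    \<open>f\<close> moves this element past the homotopy, and \<open>q\<close> absorbs it.\<close>
  have \<Phi>_q: "\<Phi> (t, q z) = q (f (t, fst z), snd z)" if t: "t \<in> {0..1}" and z: "z \<in> U \<times> carrier H" for t z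
  proof -
    have "q z \<in> ?V" using z by (auto simp: saturation_def q_def)
    note sz = s[OF this]
    obtain g where g: "g \<in> carrier G" "s (q z) = gact g z"
      using q_eqD[of z "s (q z)"] sz UH z by (metis subsetD)
    obtain x h where xh: "z = (x, h)" "x \<in> U" "h \<in> carrier H" using z by auto
    have "(f (t, fst (s (q z))), snd (s (q z))) = gact g (f (t, x), h)"
      using g xh f(3)[OF t] by (simp add: gact_apply)
    then show ?thesis
      using q_gact[OF g(1), of "(f (t, x), h)"] fX[OF t xh(2)] xh topH by (simp add: \<Phi>_def)
  qed
  have qV: "q ` (U \<times> carrier H) = ?V"
    by (auto simp: saturation_def q_def image_iff)
  \<comment> \<open>Invariance of \<open>U\<close> makes \<open>U \<times> carrier H\<close> a union
    of fibres, so \<open>q\<close> stays open when restricted to it.\<close>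
  have pre: "{z \<in> topspace TZ. q z \<in> ?V} = U \<times> carrier H"
  proof (intro subset_antisym subsetI)
    fix z assume "z \<in> {z \<in> topspace TZ. q z \<in> ?V}"
    then obtain z' where z: "z \<in> topspace TZ" "z' \<in> U \<times> carrier H" "q z' = q z"
      using qV by (metis (no_types, lifting) imageE mem_Collect_eq)
    then obtain g where "g \<in> carrier G" "z = gact g z'"
      using q_eqD[of z' z] UH by (metis subsetD)
    then show "z \<in> U \<times> carrier H" using z(2) U(2) by (auto simp: gact_apply invariant_set_def)
  qed (use UH qV in auto)
  let ?ZU = "subtopology TZ (U \<times> carrier H)"
  have om: "open_map (prod_topology ?I ?ZU) (prod_topology ?I (subtopology TY ?V)) (\<lambda>(t, z). (t, q z))"
    by (intro open_map_prod_map open_map_id open_map_restriction[OF q_open pre])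
  have cm: "continuous_map ?ZU (subtopology TY ?V) q"
    using continuous_map_from_subtopology[OF q_cont, of "U \<times> carrier H"] qV
    by (auto simp: continuous_map_in_subtopology)
  have topZU: "topspace ?ZU = U \<times> carrier H" using UX topH by auto
  have \<Phi>_cont: "continuous_map (prod_topology ?I (subtopology TY ?V)) TY \<Phi>"
  proof (rule continuous_map_descend[OF _ om, where f = "\<lambda>(t, z). q (f (t, fst z), snd z)"])
    show "continuous_map (prod_topology ?I ?ZU) (prod_topology ?I (subtopology TY ?V)) (\<lambda>(t, z). (t, q z))"
      using cm by (simp add: continuous_map_prod_top)
    show "(\<lambda>(t, z). (t, q z)) ` topspace (prod_topology ?I ?ZU) = topspace (prod_topology ?I (subtopology TY ?V))"
      using qV topZU VY image_paired_Times[of "\<lambda>t. t" q "{0..1}" "U \<times> carrier H"] by (simp add: Int_absorb1)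
    have fst_z: "continuous_map ?ZU (subtopology TX U) fst"
      using continuous_map_subtopology_fst topZU by (auto simp: continuous_map_in_subtopology)
    have p: "continuous_map (prod_topology ?I ?ZU) (prod_topology ?I (subtopology TX U)) (\<lambda>p. (fst p, fst (snd p)))"
      by (intro continuous_map_pairedI continuous_map_fst
          continuous_map_compose[OF continuous_map_snd fst_z, unfolded o_def])
    have "continuous_map (prod_topology ?I ?ZU) TZ (\<lambda>p. (f (fst p, fst (snd p)), snd (snd p)))"
      by (intro continuous_map_pairedI continuous_map_compose[OF p f(1), unfolded o_def]
          continuous_map_compose[OF continuous_map_snd continuous_map_subtopology_snd, unfolded o_def])
    from continuous_map_compose[OF this q_cont]
    show "continuous_map (prod_topology ?I ?ZU) TY (\<lambda>(t, z). q (f (t, fst z), snd z))"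
      by (simp add: o_def case_prod_unfold)
    show "\<Phi> (case p of (t, z) \<Rightarrow> (t, q z)) = (case p of (t, z) \<Rightarrow> q (f (t, fst z), snd z))"
      if "p \<in> topspace (prod_topology ?I ?ZU)" for p
      using that topZU \<Phi>_q by auto
  qed
  show ?thesis
    unfolding compressible_iff[OF VY saturation_invariant[OF UX]]
  proof (intro exI[of _ \<Phi>] conjI ballI)
    show "continuous_map (prod_topology ?I (subtopology TY ?V)) TY \<Phi>" by (rule \<Phi>_cont)
    fix y assume y: "y \<in> ?V"
    obtain x h where xh: "s y = (x, h)" "x \<in> U" "h \<in> carrier H" using s(1)[OF y] by auto
    then show "\<Phi> (0, y) = y" using s(2)[OF y] f(2) by (simp add: \<Phi>_def)
    show "\<Phi> (1, y) \<in> saturation H actH \<epsilon> A"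
      using xh f(4)[OF xh(2)] by (auto simp: \<Phi>_def q_apply saturation_def)
  next
    fix t k y assume t: "t \<in> {0..1::real}" and k: "k \<in> carrier H" and y: "y \<in> ?V"
    obtain x h where xh: "s y = (x, h)" "x \<in> U" "h \<in> carrier H" using s(1)[OF y] by auto
    have "actH k y = q (x, k \<otimes>\<^bsub>H\<^esub> h)"
      using s(2)[OF y] q_hact[OF k, of "(x, h)"] xh UX topH by (auto simp: hact_apply)
    then have "\<Phi> (t, actH k y) = q (hact k (f (t, x), h))"
      using \<Phi>_q[OF t, of "(x, k \<otimes>\<^bsub>H\<^esub> h)"] xh k by (simp add: hact_apply)
    also have "\<dots> = actH k (q (f (t, x), h))"
      using q_hact[OF k, of "(f (t, x), h)"] fX[OF t xh(2)] xh(3) topH by simp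
    finally show "\<Phi> (t, actH k y) = actH k (\<Phi> (t, y))" by (simp add: \<Phi>_def xh(1))
  qed
qed

text \<open>Lift the path \<open>t \<mapsto> \<Phi> (t, \<epsilon> x)\<close> starting from
  \<open>(x, \<one>)\<close> and keep the first coordinate. There \<open>hact\<close> is invisible
  and \<open>gact g\<close> acts by \<open>g\<close>, so the symmetry of the lift becomes
  equivariance.\<close>

lemma compressible_preimage:
  assumes V: "openin TY V" "invariant_set H actH V"
    and A: "A \<subseteq> topspace TX" "invariant_set G actG A"
    and comp: "compressible H TY actH V (saturation H actH \<epsilon> A)"
  shows "openin TX {x \<in> topspace TX. \<epsilon> x \<in> V}"
    and "invariant_set G actG {x \<in> topspace TX. \<epsilon> x \<in> V}"
    and "compressible G TX actG {x \<in> topspace TX. \<epsilon> x \<in> V} A"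
proof -
  let ?I = "top_of_set {0..1::real}" and ?U = "{x \<in> topspace TX. \<epsilon> x \<in> V}"
  show "openin TX ?U" using eps_cont V(1) by (simp add: continuous_map_def)
  show inv_U: "invariant_set G actG ?U"
    using V(2) eps_act by (auto simp: invariant_set_def)
  have VY: "V \<subseteq> topspace TY" using V(1) openin_subset by blast
  obtain \<Phi> where \<Phi>: "continuous_map (prod_topology ?I (subtopology TY V)) TY \<Phi>"
      "\<And>y. y \<in> V \<Longrightarrow> \<Phi> (0, y) = y"
      "\<And>t k y. \<lbrakk>t \<in> {0..1}; k \<in> carrier H; y \<in> V\<rbrakk> \<Longrightarrow> \<Phi> (t, actH k y) = actH k (\<Phi> (t, y))"
      "\<And>y. y \<in> V \<Longrightarrow> \<Phi> (1, y) \<in> saturation H actH \<epsilon> A"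
    using comp unfolding compressible_iff[OF VY V(2)] by blast
  obtain d where d: "free_isometric_action G TG TZ gact d NG rG"
    and d_hact: "\<And>k z w. \<lbrakk>k \<in> carrier H; z \<in> topspace TZ; w \<in> topspace TZ\<rbrakk> \<Longrightarrow> d (hact k z) (hact k w) = d z w"
    by (rule bundle_metric_exists) (rule that; assumption)
  interpret Z: free_isometric_action G TG TZ gact d NG rG by (rule d)
  let ?P = "subtopology TX ?U"
  have topP: "topspace ?P = ?U" by auto
  have eps_P: "continuous_map ?P (subtopology TY V) \<epsilon>"
    using continuous_map_from_subtopology[OF eps_cont] by (auto simp: continuous_map_in_subtopology)
  have beta_fib: "Z.beta z w = Z.beta z' w'"
    if "z \<in> topspace TZ" "w \<in> topspace TZ" "z' \<in> topspace TZ" "w' \<in> topspace TZ" "q z = q z'" "q w = q w'"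
    for z w z' w'
    using q_eqD[OF that(1,3,5)] q_eqD[OF that(2,4,6)] Z.beta_act_left Z.beta_act_right that
      Z.act_closed by metis
  have T_over: "q (Z.transport z w) = q w" if "z \<in> topspace TZ" "w \<in> topspace TZ" "0 < Z.beta z w" for z w
    using Z.transport_in_orbit[OF that(1,2)] q_gact that(2) by metis
  have T_fib: "Z.transport z w = Z.transport z w'"
    if "z \<in> topspace TZ" "w \<in> topspace TZ" "w' \<in> topspace TZ" "q w = q w'" "0 < Z.beta z w" for z w w'
    using q_eqD[OF that(2,3,4)] Z.transport_act_right that by metis
  have \<Phi>_c: "continuous_map (prod_topology ?I ?P) TY (\<lambda>p. \<Phi> (fst p, \<epsilon> (snd p)))"
  proof -
    have "continuous_map (prod_topology ?I ?P) (prod_topology ?I (subtopology TY V)) (\<lambda>p. (fst p, \<epsilon> (snd p)))"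
      by (intro continuous_map_pairedI continuous_map_fst
          continuous_map_compose[OF continuous_map_snd eps_P, unfolded o_def])
    from continuous_map_compose[OF this \<Phi>(1)] show ?thesis by (simp add: o_def)
  qed
  have f0: "continuous_map ?P TZ (\<lambda>x. (x, \<one>\<^bsub>H\<^esub>))"
    using topH by (intro continuous_map_pairedI) (auto intro: continuous_map_from_subtopology)
  have f0_q: "q (x, \<one>\<^bsub>H\<^esub>) = \<Phi> (fst (0, x), \<epsilon> (snd (0, x)))" if "x \<in> topspace ?P" for x
    using that \<Phi>(2) by (simp add: q_apply)
  obtain F where F_cont: "continuous_map (prod_topology ?I ?P) TZ F"
    and F_over: "\<And>t p. \<lbrakk>t \<in> {0..1}; p \<in> topspace ?P\<rbrakk> \<Longrightarrow> q (F (t, p)) = \<Phi> (fst (t, p), \<epsilon> (snd (t, p)))"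
    and F_0: "\<And>p. p \<in> topspace ?P \<Longrightarrow> F (0, p) = (p, \<one>\<^bsub>H\<^esub>)"
    and F_nat: "\<forall>b. \<forall>p\<in>topspace ?P. \<forall>p'\<in>topspace ?P.
       (\<forall>z\<in>topspace TZ. b z \<in> topspace TZ) \<longrightarrow>
       (\<forall>z\<in>topspace TZ. \<forall>w\<in>topspace TZ. Z.beta (b z) (b w) = Z.beta z w) \<longrightarrow>
       (\<forall>z\<in>topspace TZ. \<forall>w\<in>topspace TZ. 0 < Z.beta z w \<longrightarrow>
         Z.transport (b z) (b w) = b (Z.transport z w)) \<longrightarrow>
       (\<forall>s\<in>{0..1}. \<forall>z\<in>topspace TZ. q z = \<Phi> (fst (s, p), \<epsilon> (snd (s, p))) \<longrightarrow>
         q (b z) = \<Phi> (fst (s, p'), \<epsilon> (snd (s, p')))) \<longrightarrow>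
       (p', \<one>\<^bsub>H\<^esub>) = b (p, \<one>\<^bsub>H\<^esub>) \<longrightarrow> (\<forall>t\<in>{0..1}. F (t, p') = b (F (t, p)))"
    by (rule homotopy_lifting_by_transport[OF q_cont q_open q_surj Z.beta_cont Z.beta_nonneg Z.beta_diag
          beta_fib Z.transport_cont T_over T_fib Z.transport_diag \<Phi>_c f0 f0_q])
      (assumption | (rule that, assumption, assumption, assumption, assumption))+
  have FZ: "F (t, x) \<in> topspace TZ" if "t \<in> {0..1}" "x \<in> ?U" for t x
    using funcset_mem[OF continuous_map_funspace[OF F_cont], of "(t, x)"] that by auto
  have F_equiv: "F (t, actG g x) = gact g (hact (\<psi> g) (F (t, x)))"
    if t: "t \<in> {0..1}" and g: "g \<in> carrier G" and x: "x \<in> ?U" for t g x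
  proof -
    \<comment> \<open>\<open>hact (\<psi> g)\<close> moves lifts over the path of \<open>x\<close>
      to lifts over the path of \<open>g x\<close>, but sends \<open>(x, \<one>)\<close> to
      \<open>(x, \<psi> g)\<close>. Following it by \<open>gact g\<close>, which preserves fibres,
      corrects the starting point to \<open>(g x, \<one>)\<close>.\<close>
    let ?b = "\<lambda>z. gact g (hact (\<psi> g) z)"
    have \<psi>g: "\<psi> g \<in> carrier H" using g by simp
    note hc = hact_closed[OF \<psi>g]
    \<comment> \<open>\<open>natural_isometry\<close> requires a map commuting with the whole action
      of \<open>G\<close>, which \<open>hact (\<psi> g)\<close> does and \<open>gact g\<close> need
      not. The factor \<open>gact g\<close> is handled through the behaviour of \<open>beta\<close>
      and \<open>transport\<close> in each variable separately.\<close>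
    have nat: "Z.beta (hact (\<psi> g) z) (hact (\<psi> g) w) = Z.beta z w"
      "Z.transport (hact (\<psi> g) z) (hact (\<psi> g) w) = hact (\<psi> g) (Z.transport z w)"
      if "z \<in> topspace TZ" "w \<in> topspace TZ" for z w
      using Z.natural_isometry[of "hact (\<psi> g)" z w, OF hc hact_gact[OF \<psi>g] d_hact[OF \<psi>g] that] by blast+
    have xP: "x \<in> topspace ?P" and gxP: "actG g x \<in> topspace ?P"
      using x g inv_U by (auto simp: invariant_set_def)
    have b1: "\<forall>z\<in>topspace TZ. ?b z \<in> topspace TZ"
      using hc g Z.act_closed by blast
    have b2: "\<forall>z\<in>topspace TZ. \<forall>w\<in>topspace TZ. Z.beta (?b z) (?b w) = Z.beta z w"
      using Z.beta_act_left[OF g hc] Z.beta_act_right[OF g hc hc] nat(1) Z.act_closed[OF g hc] by simp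
    have b3: "\<forall>z\<in>topspace TZ. \<forall>w\<in>topspace TZ. 0 < Z.beta z w \<longrightarrow>
        Z.transport (?b z) (?b w) = ?b (Z.transport z w)"
      using Z.transport_act_left[OF g hc Z.act_closed[OF g hc]] Z.transport_act_right[OF g hc hc] nat
        Z.beta_act_right[OF g hc hc] by simp
    have b4: "\<forall>s\<in>{0..1}. \<forall>z\<in>topspace TZ. q z = \<Phi> (fst (s, x), \<epsilon> (snd (s, x))) \<longrightarrow>
        q (?b z) = \<Phi> (fst (s, actG g x), \<epsilon> (snd (s, actG g x)))"
    proof (intro ballI impI)
      fix s z assume s: "s \<in> {0..1::real}" and z: "z \<in> topspace TZ" "q z = \<Phi> (fst (s, x), \<epsilon> (snd (s, x)))"
      have "q (?b z) = actH (\<psi> g) (q z)"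
        using q_gact[OF g hc[OF z(1)]] q_hact[OF \<psi>g z(1)] by simp
      then show "q (?b z) = \<Phi> (fst (s, actG g x), \<epsilon> (snd (s, actG g x)))"
        using z(2) \<Phi>(3)[OF s \<psi>g, of "\<epsilon> x"] eps_act[OF g] x by simp
    qed
    have b5: "(actG g x, \<one>\<^bsub>H\<^esub>) = ?b (x, \<one>\<^bsub>H\<^esub>)"
      using g by (simp add: gact_apply hact_apply)
    show ?thesis
      using F_nat[THEN spec[of _ ?b], THEN bspec, OF xP, THEN bspec, OF gxP, THEN mp, OF b1,
          THEN mp, OF b2, THEN mp, OF b3, THEN mp, OF b4, THEN mp, OF b5] t by blast
  qed
  show "compressible G TX actG ?U A"
    unfolding compressible_iff[OF Collect_subset inv_U]
  proof (intro exI[of _ "\<lambda>p. fst (F p)"] conjI ballI)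
    show "continuous_map (prod_topology ?I ?P) TX (\<lambda>p. fst (F p))"
      using continuous_map_compose[OF F_cont continuous_map_fst] by (simp add: o_def)
    show "fst (F (0, u)) = u" if "u \<in> ?U" for u using F_0[of u] that by simp
    show "fst (F (t, actG g u)) = actG g (fst (F (t, u)))"
      if "t \<in> {0..1}" "g \<in> carrier G" "u \<in> ?U" for t g u
      unfolding F_equiv[OF that] by (simp add: gact_def hact_def case_prod_unfold)
    fix u assume u: "u \<in> ?U"
    \<comment> \<open>The endpoint lies in the fibre of some \<open>(a, h)\<close> with
      \<open>a \<in> A\<close>, so it is a translate \<open>gact g (a, h)\<close>; invariance of
      \<open>A\<close> then applies to its first coordinate \<open>g a\<close>.\<close>
    have "q (F (1, u)) \<in> saturation H actH \<epsilon> A"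
      using F_over[of 1 u] \<Phi>(4)[of "\<epsilon> u"] u by simp
    then obtain h a where ha: "h \<in> carrier H" "a \<in> A" "q (F (1, u)) = q (a, h)"
      by (auto simp: saturation_def q_apply)
    then obtain g where "g \<in> carrier G" "F (1, u) = gact g (a, h)"
      using q_eqD[of "(a, h)" "F (1, u)"] FZ[of 1 u] u A(1) topH by auto
    then show "fst (F (1, u)) \<in> A" using A(2) ha(2) by (simp add: gact_apply invariant_set_def)
  qed
qed

text \<open>Saturation carries covers of \<open>X\<close> to covers of \<open>Y\<close> because
  \<open>q\<close> is onto, and preimages under \<open>\<epsilon>\<close> carry covers back. Both
  keep the number of sets.\<close>

lemma good_cover_iff:
  assumes \<A>: "\<forall>A\<in>\<A>. A \<subseteq> topspace TX \<and> invariant_set G actG A"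
  shows "good_cover G TX actG \<A> k \<longleftrightarrow> good_cover H TY actH ((\<lambda>A. saturation H actH \<epsilon> A) ` \<A>) k"
proof
  assume "good_cover G TX actG \<A> k"
  then obtain Us where Us: "\<forall>i<k. openin TX (Us i) \<and> invariant_set G actG (Us i) \<and>
      (\<exists>A\<in>\<A>. compressible G TX actG (Us i) A)" and Us_cover: "(\<Union>i<k. Us i) = topspace TX"
    unfolding good_cover_def by (elim exE conjE)
  let ?V = "\<lambda>i. saturation H actH \<epsilon> (Us i)"
  have "(\<Union>i<k. ?V i) = saturation H actH \<epsilon> (\<Union>i<k. Us i)" by (auto simp: saturation_def)
  also have "\<dots> = q ` topspace TZ" unfolding Us_cover by (auto simp: saturation_def q_def topH image_iff)
  finally have "(\<Union>i<k. ?V i) = topspace TY" using q_surj by simp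
  moreover have "openin TY (?V i) \<and> invariant_set H actH (?V i) \<and>
      (\<exists>A\<in>(\<lambda>A. saturation H actH \<epsilon> A) ` \<A>. compressible H TY actH (?V i) A)" if "i < k" for i
  proof -
    obtain A where A: "A \<in> \<A>" "compressible G TX actG (Us i) A" and U: "openin TX (Us i)" "invariant_set G actG (Us i)"
      using Us \<open>i < k\<close> by blast
    then show ?thesis
      using saturation_openin[OF U(1)] saturation_invariant[OF openin_subset[OF U(1)]]
        compressible_saturation[OF U A(2)] by auto
  qed
  ultimately show "good_cover H TY actH ((\<lambda>A. saturation H actH \<epsilon> A) ` \<A>) k"
    unfolding good_cover_def by (intro exI[of _ ?V]) simp
next
  assume "good_cover H TY actH ((\<lambda>A. saturation H actH \<epsilon> A) ` \<A>) k"
  then obtain Vs where Vs': "\<forall>i<k. openin TY (Vs i) \<and> invariant_set H actH (Vs i) \<and>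
      (\<exists>A\<in>(\<lambda>A. saturation H actH \<epsilon> A) ` \<A>. compressible H TY actH (Vs i) A)"
    and Vs_cover: "(\<Union>i<k. Vs i) = topspace TY"
    unfolding good_cover_def by (elim exE conjE)
  have Vs: "openin TY (Vs i) \<and> invariant_set H actH (Vs i) \<and>
      (\<exists>A\<in>\<A>. compressible H TY actH (Vs i) (saturation H actH \<epsilon> A))" if "i < k" for i
    using Vs' that by simp
  let ?U = "\<lambda>i. {x \<in> topspace TX. \<epsilon> x \<in> Vs i}"
  have "openin TX (?U i) \<and> invariant_set G actG (?U i) \<and> (\<exists>A\<in>\<A>. compressible G TX actG (?U i) A)"
    if "i < k" for i
  proof -
    obtain A where A: "A \<in> \<A>" "compressible H TY actH (Vs i) (saturation H actH \<epsilon> A)"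
      and V: "openin TY (Vs i)" "invariant_set H actH (Vs i)"
      using Vs[OF \<open>i < k\<close>] by blast
    have "A \<subseteq> topspace TX" "invariant_set G actG A" using \<A> A(1) by auto
    from compressible_preimage[OF V this A(2)] A(1) show ?thesis by blast
  qed
  moreover have "(\<Union>i<k. ?U i) = topspace TX"
  proof (intro subset_antisym subsetI)
    fix x assume x: "x \<in> topspace TX"
    then have "\<epsilon> x \<in> (\<Union>i<k. Vs i)" using Vs_cover eps_closed by simp
    then show "x \<in> (\<Union>i<k. ?U i)" using x by simp
  qed auto
  ultimately show "good_cover G TX actG \<A> k" unfolding good_cover_def by (intro exI[of _ ?U]) simp
qed

end

theorem theorem5p1:
  fixes G :: "('g, 'gm) monoid_scheme" and TG :: "'g topology"
    and H :: "('h, 'hm) monoid_scheme" and TH :: "'h topology"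
    and TX :: "'x topology" and TY :: "'y topology"
    and actG :: "'g \<Rightarrow> 'x \<Rightarrow> 'x" and actH :: "'h \<Rightarrow> 'y \<Rightarrow> 'y"
    and \<psi> :: "'g \<Rightarrow> 'h" and \<epsilon> :: "'x \<Rightarrow> 'y"
    and \<A> :: "'x set set"
  assumes "compact_lie_group G TG TYPE('dG::euclidean_space)"
    and "compact_lie_group H TH TYPE('dH::euclidean_space)"
    and "metrizable_space TX" and "metrizable_space TY"
    and "continuous_action G TG TX actG"
    and "continuous_action H TH TY actH"
    and "essential_equivalence G TG TX actG H TH TY actH \<psi> \<epsilon>"
    and "\<forall>A \<in> \<A>. A \<subseteq> topspace TX \<and> invariant_set G actG A"
  shows "equivariant_cat G TX actG \<A> =
         equivariant_cat H TY actH ((\<lambda>A. saturation H actH \<epsilon> A) ` \<A>)"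
proof -
  obtain NG rG where NG: "center_function G TG NG rG"
    using compact_lie_group_center_function[OF assms(1)] .
  obtain NH rH where NH: "center_function H TH NH rH"
    using compact_lie_group_center_function[OF assms(2)] .
  have "compact_space TG" "compact_space TH"
    using assms(1,2) by (auto simp: compact_lie_group_def)
  then interpret lie_essential_equivalence G TG H TH TX TY actG actH \<psi> \<epsilon> NG rG NH rH
    using assms NG NH by unfold_locales
  \<comment> \<open>Equality for every \<open>k\<close> settles both the existence of a cover and
    the least size, hence also the infinite case.\<close>
  have "good_cover G TX actG \<A> = good_cover H TY actH ((\<lambda>A. saturation H actH \<epsilon> A) ` \<A>)"
    using good_cover_iff[OF assms(8)] by (intro ext)
  then show ?thesis by (simp only: equivariant_cat_def)
qed

end
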